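(* Let $d\ge 2$ be a fixed integer and let $c\in\mathbb{R}$ be fixed. Suppose that $$p = \frac{d\log n + c + o(1)}{n}$$ as $n \to\infty$. Then the Betti number $b_{d-1}(Y_d(n,p))$ converges in law, as $n\to\infty$, to a Poisson random variable with mean $e^{-c}/d!$.
   Context: $Y_d(n,p)$ is the random simplicial complex formed by taking the complete $(d-1)$-skeleton of the simplex on vertex set $[n]=\{1,\dots,n\}$ and including each possible $d$-dimensional face independently with probability $p$. The Betti number is taken with rational coefficients: $b_{d-1}(Y)=\dim_{\mathbb{Q}} H_{d-1}(Y,\mathbb{Q})$. *)

theory Defs
  imports
    "HOL-Probability.Probability"
    "HOL-Probability.Product_PMF"
    "HOL-Library.Landau_Symbols"
    "HOL-Algebra.AbelCoset"
    "Jordan_Normal_Form.VS_Connect"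
begin

text \<open>
  An abstract simplicial complex with vertices in \<open>nat\<close> is represented by the set of its
  nonempty faces; a \<open>k\<close>-dimensional face has \<open>k + 1\<close> vertices. A \<open>k\<close>-chain with rational
  coefficients is a finitely supported function on the \<open>k\<close>-faces, extended by \<open>0\<close>. The value
  at a face refers to its orientation by increasing vertices.
\<close>

definition chains :: "nat \<Rightarrow> nat set set \<Rightarrow> (nat set \<Rightarrow> rat) set" where
  "chains k Y =
     {f. finite {\<sigma>. f \<sigma> \<noteq> 0} \<and> {\<sigma>. f \<sigma> \<noteq> 0} \<subseteq> {\<sigma> \<in> Y. card \<sigma> = k + 1}}"

text \<open>
  Linear extension of
  \<open>[v\<^sub>0 < \<dots> < v\<^sub>k] \<mapsto> (\<Sum>i\<le>k. (-1)^i [v\<^sub>0, \<dots>, v\<^sub>i omitted, \<dots>, v\<^sub>k])\<close>: the position \<open>i\<close> of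
  a vertex \<open>v\<close> of \<open>\<sigma>\<close> is the number of vertices of \<open>\<sigma>\<close> below \<open>v\<close>. The homology is unreduced,
  so the boundary map vanishes in degree \<open>0\<close>.
\<close>

definition boundary :: "nat \<Rightarrow> (nat set \<Rightarrow> rat) \<Rightarrow> nat set \<Rightarrow> rat" where
  "boundary k f = (\<lambda>\<tau>. if k = 0 then 0 else
     (\<Sum>\<sigma> | f \<sigma> \<noteq> 0. f \<sigma> * (\<Sum>v\<in>\<sigma>. (-1) ^ card {u \<in> \<sigma>. u < v} * of_bool (\<tau> = \<sigma> - {v}))))"

definition cycles :: "nat \<Rightarrow> nat set set \<Rightarrow> (nat set \<Rightarrow> rat) set" where
  "cycles k Y = {f \<in> chains k Y. boundary k f = (\<lambda>_. 0)}"

definition boundaries :: "nat \<Rightarrow> nat set set \<Rightarrow> (nat set \<Rightarrow> rat) set" where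
  "boundaries k Y = boundary (k + 1) ` chains (k + 1) Y"

text \<open>
  The fields \<open>mult\<close> and \<open>one\<close> of a module record carry no meaning and are filled arbitrarily.
\<close>

definition cycle_space :: "nat \<Rightarrow> nat set set \<Rightarrow> (rat, nat set \<Rightarrow> rat) module" where
  "cycle_space k Y =
     \<lparr>carrier = cycles k Y, mult = (\<lambda>f g \<sigma>. 0), one = (\<lambda>\<sigma>. 0),
      zero = (\<lambda>\<sigma>. 0), add = (\<lambda>f g \<sigma>. f \<sigma> + g \<sigma>), smult = (\<lambda>a f \<sigma>. a * f \<sigma>)\<rparr>"

text \<open>
  The scalar multiple of the coset of \<open>x\<close> by \<open>a\<close> is the coset of \<open>a \<odot> x\<close>; as in the quotient
  ring construction of HOL-Algebra, it is formed by a union over all representatives.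
\<close>

definition quotient_space ::
    "('a, 'b, 'c) module_scheme \<Rightarrow> 'b set \<Rightarrow> ('a, 'b set) module" where
  "quotient_space V W =
     \<lparr>carrier = a_rcosets\<^bsub>V\<^esub> W, mult = (\<lambda>A B. W), one = W,
      zero = W, add = set_add V, smult = (\<lambda>a A. \<Union>x\<in>A. W +>\<^bsub>V\<^esub> (a \<odot>\<^bsub>V\<^esub> x))\<rparr>"

definition homology :: "nat \<Rightarrow> nat set set \<Rightarrow> (rat, (nat set \<Rightarrow> rat) set) module" where
  "homology k Y = quotient_space (cycle_space k Y) (boundaries k Y)"

text \<open>\<open>class_ring\<close> is the field of rational numbers here.\<close>

definition betti :: "nat \<Rightarrow> nat set set \<Rightarrow> nat" where
  "betti k Y = vectorspace.dim (class_ring :: rat ring) (homology k Y)"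

text \<open>
  The law of \<open>Y\<^sub>d(n,p)\<close>: the coins \<open>\<omega>\<close> decide independently which \<open>d\<close>-faces are added to the
  complete \<open>(d - 1)\<close>-skeleton on \<open>{1..n}\<close>. Note that \<open>bernoulli_pmf\<close> truncates \<open>p\<close> to \<open>[0,1]\<close>.
\<close>

definition random_complex :: "nat \<Rightarrow> nat \<Rightarrow> real \<Rightarrow> nat set set pmf" where
  "random_complex d n p =
     map_pmf (\<lambda>\<omega>. {\<sigma>. \<sigma> \<subseteq> {1..n} \<and> \<sigma> \<noteq> {} \<and> card \<sigma> \<le> d} \<union>
                  {\<sigma>. \<sigma> \<subseteq> {1..n} \<and> card \<sigma> = d + 1 \<and> \<omega> \<sigma>})
       (Pi_pmf {\<sigma>. \<sigma> \<subseteq> {1..n} \<and> card \<sigma> = d + 1} False (\<lambda>_. bernoulli_pmf p))"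

end

theory Submission
  imports Defs "HOL-Real_Asymp.Real_Asymp"
begin

text \<open>
  Call a \<open>(d - 1)\<close>-face isolated if no chosen \<open>d\<close>-face contains it. In the critical window a given
  \<open>(d - 1)\<close>-face is isolated with probability \<open>(1 - p)^(n - d)\<close>, which is asymptotic to
  \<open>exp (- c) / n^d\<close>, so that \<open>exp (- c) / d!\<close> of the \<open>n choose d\<close> faces are isolated on average. Two
  of these faces have at most one \<open>d\<close>-face in common, so their isolation is nearly independent; the
  binomial moments of the number of isolated faces converge to those of a Poisson variable, and
  the Bonferroni inequalities turn this into convergence of the point probabilities
  (\<open>isolated_faces_poisson\<close>). What remains is that the Betti number is equal to the number of
  isolated faces with probability tending to \<open>1\<close>.

  The indicator function of an isolated face is a cocycle, and so is every coboundary.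
  Suppose that over the field with two elements these generate all cocycles. Then every rational
  cycle \<open>z\<close> that vanishes on the isolated faces is a boundary: otherwise an integral cocycle \<open>l\<close>
  detects a multiple of it, but \<open>l\<close> is, modulo \<open>2\<close>, a coboundary plus an indicator of isolated
  faces, both of which pair to \<open>0\<close> with \<open>z\<close>, so the pairing of \<open>l\<close> and \<open>z\<close> is twice another such
  pairing, hence divisible by every power of \<open>2\<close> (\<open>pairing_with_cycle_eq_0\<close>). A homology class is
  therefore determined by its coefficients at the isolated faces, and if there are few of these,
  the coefficients can be prescribed arbitrarily (\<open>betti_eq_card_isolated_faces\<close>).

  Working modulo \<open>2\<close> makes cocycles finite objects that can be counted: a cocycle is a
  set \<open>G\<close> of \<open>(d - 1)\<close>-faces such that all the \<open>b\<close> \<open>d\<close>-faces in its coboundary are absent, an event of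
  probability \<open>(1 - p)^b\<close>. If some cocycle is not generated by coboundaries and isolated faces,
  take one with the least number \<open>m\<close> of faces. It is connected, has \<open>m \<ge> 2\<close>, and satisfies
  \<open>n m \<le> (d + 1) b\<close>, because pushing it into the cone over a vertex cannot make it smaller
  (\<open>minimal_nontrivial_cocycle\<close>).

  The expected number of such sets \<open>G\<close> with coboundary disjoint from the complex tends
  to \<open>0\<close>. For \<open>m \<le> sqrt n\<close> nearly all cofaces of \<open>G\<close> meet it in one face only, so \<open>b\<close> is nearly \<open>m n\<close>
  and each \<open>G\<close> has probability about \<open>n^(- d m)\<close>, while there are at most
  \<open>n^d (m d n)^(m - 1)\<close> connected sets. For larger \<open>m\<close> the bound on \<open>b\<close> from the expansion alone need not
  beat the number of sets of \<open>m\<close> faces. The remedy is a dichotomy: choose a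
  sparse set \<open>S\<close> in \<open>G\<close> such that every face of \<open>G\<close> has few neighbours in \<open>G\<close> that are not adjacent to
  a member of \<open>S\<close>. The dominated faces cost only a constant factor each when \<open>G\<close> is described by
  \<open>S\<close> and the rest, and each of the \<open>u\<close> undominated faces contributes almost \<open>n\<close> cofaces to \<open>b\<close>,
  up to a total error that is a small multiple of \<open>n m\<close>
  (\<open>sparse_dominating_set\<close>, \<open>card_coboundary2_lower\<close>, \<open>undominated_term_bound\<close>).
\<close>

section \<open>Mod 2 cocycles and coboundary expansion\<close>

definition faces :: "nat \<Rightarrow> nat \<Rightarrow> nat set set" where
  "faces n k = {\<sigma>. \<sigma> \<subseteq> {1..n} \<and> card \<sigma> = k}"

text \<open>
  The coboundary of a cochain modulo \<open>2\<close>, a cochain being identified with its support; \<open>j\<close> is the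
  number of vertices of the target faces. Addition of cochains is symmetric difference.
\<close>

definition coboundary2 :: "nat \<Rightarrow> nat \<Rightarrow> nat set set \<Rightarrow> nat set set" where
  "coboundary2 n j G = {\<tau> \<in> faces n j. odd (card {\<sigma> \<in> G. \<sigma> \<subseteq> \<tau>})}"

definition isolated_faces :: "nat \<Rightarrow> nat \<Rightarrow> nat set set \<Rightarrow> nat set set" where
  "isolated_faces n d T = {\<sigma> \<in> faces n d. \<forall>\<tau>\<in>T. \<not> \<sigma> \<subseteq> \<tau>}"

text \<open>
  The subspace generated by the coboundaries and the isolated faces. If \<open>d\<close> is positive,
  all its elements are cocycles of the complex with set of \<open>d\<close>-faces \<open>T\<close>.
\<close>

definition trivial_cocycles :: "nat \<Rightarrow> nat \<Rightarrow> nat set set \<Rightarrow> nat set set set" where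
  "trivial_cocycles n d T =
     {sym_diff (coboundary2 n d P) J |P J. P \<subseteq> faces n (d - 1) \<and> J \<subseteq> isolated_faces n d T}"

definition only_trivial_cocycles :: "nat \<Rightarrow> nat \<Rightarrow> nat set set \<Rightarrow> bool" where
  "only_trivial_cocycles n d T \<longleftrightarrow>
     (\<forall>G \<subseteq> faces n d. coboundary2 n (Suc d) G \<inter> T = {} \<longrightarrow> G \<in> trivial_cocycles n d T)"

lemma facesD: "\<sigma> \<in> faces n k \<Longrightarrow> \<sigma> \<subseteq> {1..n}" "\<sigma> \<in> faces n k \<Longrightarrow> card \<sigma> = k"
  "\<sigma> \<in> faces n k \<Longrightarrow> finite \<sigma>"
  by (auto simp: faces_def intro: finite_subset)

lemma finite_faces [simp, intro]: "finite (faces n k)"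
  by (rule finite_subset[of _ "Pow {1..n}"]) (auto simp: faces_def)

lemma finite_subset_faces: "G \<subseteq> faces n k \<Longrightarrow> finite G"
  by (rule finite_subset[OF _ finite_faces])

lemma card_faces: "card (faces n k) = n choose k"
  unfolding faces_def by (subst n_subsets) auto

lemma coboundary2_subset: "coboundary2 n j G \<subseteq> faces n j"
  by (auto simp: coboundary2_def)

lemma finite_coboundary2 [simp, intro]: "finite (coboundary2 n j G)"
  by (rule finite_subset[OF coboundary2_subset]) simp

lemma odd_card_sym_diff:
  assumes "finite A" "finite B"
  shows "odd (card (sym_diff A B)) \<longleftrightarrow> odd (card A) \<noteq> odd (card B)"
proof -
  have "card (sym_diff A B) = card (A - B) + card (B - A)"
    using assms by (intro card_Un_disjoint) auto
  moreover have "card A = card (A - B) + card (A \<inter> B)"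
    using assms card_Int_Diff[of A B] by simp
  moreover have "card B = card (B - A) + card (A \<inter> B)"
    using assms card_Int_Diff[of B A] by (simp add: Int_commute)
  ultimately show ?thesis by presburger
qed

lemma coboundary2_sym_diff:
  assumes "finite A" "finite B"
  shows "coboundary2 n j (sym_diff A B) = sym_diff (coboundary2 n j A) (coboundary2 n j B)"
proof -
  have "{\<sigma> \<in> sym_diff A B. \<sigma> \<subseteq> \<tau>} = sym_diff {\<sigma> \<in> A. \<sigma> \<subseteq> \<tau>} {\<sigma> \<in> B. \<sigma> \<subseteq> \<tau>}" for \<tau>
    by auto
  then have "odd (card {\<sigma> \<in> sym_diff A B. \<sigma> \<subseteq> \<tau>})
      \<longleftrightarrow> odd (card {\<sigma> \<in> A. \<sigma> \<subseteq> \<tau>}) \<noteq> odd (card {\<sigma> \<in> B. \<sigma> \<subseteq> \<tau>})" for \<tau>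
    using odd_card_sym_diff[of "{\<sigma> \<in> A. \<sigma> \<subseteq> \<tau>}" "{\<sigma> \<in> B. \<sigma> \<subseteq> \<tau>}"] assms by simp
  then show ?thesis
    unfolding coboundary2_def by auto
qed

lemma double_counting:
  assumes "finite A" "finite B"
  shows "(\<Sum>a\<in>A. card {b \<in> B. R a b}) = (\<Sum>b\<in>B. card {a \<in> A. R a b})"
  by (rule sum_multicount_gen) (use assms in auto)

lemma card_between:
  assumes "finite \<tau>" "\<rho> \<subseteq> \<tau>"
  shows "card {\<sigma>. \<rho> \<subseteq> \<sigma> \<and> \<sigma> \<subseteq> \<tau> \<and> card \<sigma> = Suc (card \<rho>)} = card \<tau> - card \<rho>"
proof -
  have fin: "finite \<rho>" using assms finite_subset by auto
  have "{\<sigma>. \<rho> \<subseteq> \<sigma> \<and> \<sigma> \<subseteq> \<tau> \<and> card \<sigma> = Suc (card \<rho>)} = (\<lambda>v. insert v \<rho>) ` (\<tau> - \<rho>)"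
  proof (intro Set.set_eqI iffI)
    fix \<sigma> assume "\<sigma> \<in> {\<sigma>. \<rho> \<subseteq> \<sigma> \<and> \<sigma> \<subseteq> \<tau> \<and> card \<sigma> = Suc (card \<rho>)}"
    then have \<sigma>: "\<rho> \<subseteq> \<sigma>" "\<sigma> \<subseteq> \<tau>" "card \<sigma> = Suc (card \<rho>)" by auto
    then have "card (\<sigma> - \<rho>) = 1" using fin by (simp add: card_Diff_subset)
    then obtain v where "\<sigma> - \<rho> = {v}" by (rule card_1_singletonE)
    then have "\<sigma> = insert v \<rho>" "v \<in> \<tau> - \<rho>" using \<sigma> by auto
    then show "\<sigma> \<in> (\<lambda>v. insert v \<rho>) ` (\<tau> - \<rho>)" by auto
  qed (use assms fin in auto)
  moreover have "inj_on (\<lambda>v. insert v \<rho>) (\<tau> - \<rho>)"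
    by (auto simp: inj_on_def)
  ultimately show ?thesis
    using assms fin by (simp add: card_image card_Diff_subset)
qed

text \<open>
  A face of codimension \<open>2\<close> in \<open>\<tau>\<close> lies in exactly two facets of \<open>\<tau>\<close>.
\<close>

lemma coboundary2_coboundary2:
  assumes P: "P \<subseteq> faces n k"
  shows "coboundary2 n (Suc (Suc k)) (coboundary2 n (Suc k) P) = {}"
proof -
  have "even (card {\<sigma> \<in> coboundary2 n (Suc k) P. \<sigma> \<subseteq> \<tau>})" if \<tau>: "\<tau> \<in> faces n (Suc (Suc k))" for \<tau>
  proof -
    define S where "S = {\<sigma> \<in> faces n (Suc k). \<sigma> \<subseteq> \<tau>}"
    have fin: "finite S" "finite P" using P by (auto simp: S_def intro: finite_subset_faces)
    have "{\<sigma> \<in> coboundary2 n (Suc k) P. \<sigma> \<subseteq> \<tau>} = {\<sigma> \<in> S. odd (card {\<rho> \<in> P. \<rho> \<subseteq> \<sigma>})}"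
      by (auto simp: S_def coboundary2_def)
    moreover have "even (\<Sum>\<sigma>\<in>S. card {\<rho> \<in> P. \<rho> \<subseteq> \<sigma>})"
    proof -
      have "(\<Sum>\<sigma>\<in>S. card {\<rho> \<in> P. \<rho> \<subseteq> \<sigma>}) = (\<Sum>\<rho>\<in>P. card {\<sigma> \<in> S. \<rho> \<subseteq> \<sigma>})"
        using fin by (rule double_counting)
      moreover have "even (card {\<sigma> \<in> S. \<rho> \<subseteq> \<sigma>})" if \<rho>: "\<rho> \<in> P" for \<rho>
      proof (cases "\<rho> \<subseteq> \<tau>")
        case True
        have k: "card \<rho> = k" using \<rho> P by (auto dest: facesD)
        have "{\<sigma> \<in> S. \<rho> \<subseteq> \<sigma>} = {\<sigma>. \<rho> \<subseteq> \<sigma> \<and> \<sigma> \<subseteq> \<tau> \<and> card \<sigma> = Suc (card \<rho>)}"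
          using \<tau> k by (auto simp: S_def faces_def)
        then have "card {\<sigma> \<in> S. \<rho> \<subseteq> \<sigma>} = 2"
          using card_between[OF facesD(3)[OF \<tau>] True] k \<tau> by (simp add: faces_def)
        then show ?thesis by simp
      next
        case False
        then have "{\<sigma> \<in> S. \<rho> \<subseteq> \<sigma>} = {}" by (auto simp: S_def)
        then show ?thesis by (metis card.empty even_zero)
      qed
      ultimately show ?thesis by (simp add: dvd_sum)
    qed
    ultimately show ?thesis by (simp only: even_sum_iff[OF fin(1)])
  qed
  then show ?thesis unfolding coboundary2_def[of n "Suc (Suc k)"] by blast
qed

lemma isolated_faces_subset: "isolated_faces n d T \<subseteq> faces n d"
  by (auto simp: isolated_faces_def)

lemma trivial_cocyclesE:
  assumes "G \<in> trivial_cocycles n d T"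
  obtains P J where "P \<subseteq> faces n (d - 1)" "J \<subseteq> isolated_faces n d T" "G = sym_diff (coboundary2 n d P) J"
  using assms unfolding trivial_cocycles_def by blast

lemma sym_diff_trivial_cocycles:
  assumes "A \<in> trivial_cocycles n d T" "B \<in> trivial_cocycles n d T"
  shows "sym_diff A B \<in> trivial_cocycles n d T"
proof -
  obtain P J where A: "P \<subseteq> faces n (d - 1)" "J \<subseteq> isolated_faces n d T" "A = sym_diff (coboundary2 n d P) J"
    using assms(1) by (rule trivial_cocyclesE)
  obtain Q K where B: "Q \<subseteq> faces n (d - 1)" "K \<subseteq> isolated_faces n d T" "B = sym_diff (coboundary2 n d Q) K"
    using assms(2) by (rule trivial_cocyclesE)
  have "coboundary2 n d (sym_diff P Q) = sym_diff (coboundary2 n d P) (coboundary2 n d Q)"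
    using A B by (intro coboundary2_sym_diff) (auto intro: finite_subset_faces)
  moreover have "sym_diff (sym_diff X J) (sym_diff Y K) = sym_diff (sym_diff X Y) (sym_diff J K)"
    for X Y by blast
  ultimately have "sym_diff A B = sym_diff (coboundary2 n d (sym_diff P Q)) (sym_diff J K)"
    unfolding A(3) B(3) by simp
  moreover have "sym_diff P Q \<subseteq> faces n (d - 1)" "sym_diff J K \<subseteq> isolated_faces n d T"
    using A B by blast+
  ultimately show ?thesis
    unfolding trivial_cocycles_def by blast
qed

lemma coboundary_trivial:
  "P \<subseteq> faces n (d - 1) \<Longrightarrow> coboundary2 n d P \<in> trivial_cocycles n d T"
  unfolding trivial_cocycles_def by (intro CollectI exI[of _ P] exI[of _ "{}"]) auto

lemma isolated_trivial:
  "J \<subseteq> isolated_faces n d T \<Longrightarrow> J \<in> trivial_cocycles n d T"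
  unfolding trivial_cocycles_def by (intro CollectI exI[of _ "{}"] exI[of _ J]) (auto simp: coboundary2_def)

text \<open>
  Adding to \<open>G\<close> the coboundary of its link at \<open>v\<close> removes every face containing \<open>v\<close>. What is left is in
  bijection with the part of the coboundary of \<open>G\<close> at \<open>v\<close>: this is the mod 2 form of the contraction
  of the full simplex onto the vertex \<open>v\<close>.
\<close>

lemma card_push_in:
  assumes d: "d \<ge> 1" and G: "G \<subseteq> faces n d" and v: "v \<in> {1..n}"
  shows "card (sym_diff G (coboundary2 n d {\<rho> \<in> faces n (d - 1). v \<notin> \<rho> \<and> insert v \<rho> \<in> G}))
       = card {\<tau> \<in> coboundary2 n (Suc d) G. v \<in> \<tau>}"
proof -
  define P where "P = {\<rho> \<in> faces n (d - 1). v \<notin> \<rho> \<and> insert v \<rho> \<in> G}"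
  have fin: "finite G" "finite P" using G by (auto simp: P_def intro: finite_subset_faces)
  have with_v: "\<sigma> \<in> coboundary2 n d P \<longleftrightarrow> \<sigma> \<in> G" if \<sigma>: "\<sigma> \<in> faces n d" "v \<in> \<sigma>" for \<sigma>
  proof -
    have *: "\<rho> = \<sigma> - {v}" if "\<rho> \<in> P" "\<rho> \<subseteq> \<sigma>" for \<rho>
    proof -
      have "\<rho> \<subseteq> \<sigma> - {v}" using that \<sigma> by (auto simp: P_def)
      moreover have "card \<rho> = card (\<sigma> - {v})" using that \<sigma> by (auto simp: P_def faces_def)
      ultimately show ?thesis using facesD(3)[OF \<sigma>(1)] by (meson card_subset_eq finite_Diff)
    qed
    have mem: "\<sigma> - {v} \<in> P \<longleftrightarrow> \<sigma> \<in> G"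
      using \<sigma> facesD(3)[OF \<sigma>(1)] by (auto simp: P_def faces_def insert_absorb)
    have "{\<rho> \<in> P. \<rho> \<subseteq> \<sigma>} = (if \<sigma> \<in> G then {\<sigma> - {v}} else {})"
      using * mem by auto
    then show ?thesis using \<sigma> by (auto simp: coboundary2_def)
  qed
  have without_v: "\<sigma> \<in> sym_diff G (coboundary2 n d P) \<longleftrightarrow> insert v \<sigma> \<in> coboundary2 n (Suc d) G"
    if \<sigma>: "\<sigma> \<in> faces n d" "v \<notin> \<sigma>" for \<sigma>
  proof -
    have fs: "finite \<sigma>" using \<sigma> facesD by blast
    have ins: "insert v \<sigma> \<in> faces n (Suc d)" using \<sigma> v fs by (auto simp: faces_def)
    have Gv: "{\<sigma>' \<in> G. \<sigma>' \<subseteq> insert v \<sigma>} = {\<sigma>' \<in> G. \<sigma>' = \<sigma>} \<union> insert v ` {\<rho> \<in> P. \<rho> \<subseteq> \<sigma>}" (is "?L = ?R")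
    proof (intro Set.set_eqI iffI)
      fix \<sigma>' assume \<sigma>': "\<sigma>' \<in> ?L"
      then have s: "\<sigma>' \<in> faces n d" using G by auto
      show "\<sigma>' \<in> ?R"
      proof (cases "v \<in> \<sigma>'")
        case True
        then have "\<sigma>' - {v} \<in> P" using \<sigma>' s v facesD(3)[OF s] by (auto simp: P_def faces_def insert_absorb)
        moreover have "\<sigma>' - {v} \<subseteq> \<sigma>" using \<sigma>' by auto
        moreover have "\<sigma>' = insert v (\<sigma>' - {v})" using True by auto
        ultimately show ?thesis by blast
      next
        case False
        then have "\<sigma>' \<subseteq> \<sigma>" using \<sigma>' by auto
        then have "\<sigma>' = \<sigma>" using s \<sigma> fs by (simp add: card_subset_eq faces_def)
        then show ?thesis using \<sigma>' by auto
      qed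
    next
      fix \<sigma>' assume "\<sigma>' \<in> ?R"
      then show "\<sigma>' \<in> ?L" using \<sigma> by (auto simp: P_def)
    qed
    have "card ?L = card {\<sigma>' \<in> G. \<sigma>' = \<sigma>} + card (insert v ` {\<rho> \<in> P. \<rho> \<subseteq> \<sigma>})"
      unfolding Gv using fin \<sigma> by (intro card_Un_disjoint) (auto)
    moreover have "card (insert v ` {\<rho> \<in> P. \<rho> \<subseteq> \<sigma>}) = card {\<rho> \<in> P. \<rho> \<subseteq> \<sigma>}"
      by (rule card_image) (auto simp: inj_on_def P_def)
    moreover have "{\<sigma>' \<in> G. \<sigma>' = \<sigma>} = (if \<sigma> \<in> G then {\<sigma>} else {})"
      by auto
    ultimately show ?thesis using \<sigma> ins by (auto simp: coboundary2_def)
  qed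
  have "bij_betw (\<lambda>\<tau>. \<tau> - {v}) {\<tau> \<in> coboundary2 n (Suc d) G. v \<in> \<tau>} (sym_diff G (coboundary2 n d P))"
  proof (rule bij_betw_byWitness[where f' = "insert v"])
    show "\<forall>a\<in>{\<tau> \<in> coboundary2 n (Suc d) G. v \<in> \<tau>}. insert v (a - {v}) = a" by auto
    have *: "\<sigma> \<in> faces n d \<and> v \<notin> \<sigma>" if "\<sigma> \<in> sym_diff G (coboundary2 n d P)" for \<sigma>
      using with_v[of \<sigma>] that G coboundary2_subset[of n d P] by blast
    then show "\<forall>a'\<in>sym_diff G (coboundary2 n d P). insert v a' - {v} = a'"
      by auto
    show "(\<lambda>\<tau>. \<tau> - {v}) ` {\<tau> \<in> coboundary2 n (Suc d) G. v \<in> \<tau>} \<subseteq> sym_diff G (coboundary2 n d P)"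
    proof (rule image_subsetI)
      fix \<tau> assume "\<tau> \<in> {\<tau> \<in> coboundary2 n (Suc d) G. v \<in> \<tau>}"
      then have \<tau>: "\<tau> \<in> coboundary2 n (Suc d) G" "v \<in> \<tau>" "\<tau> \<in> faces n (Suc d)"
        using coboundary2_subset by auto
      then have "\<tau> - {v} \<in> faces n d" using facesD(3)[OF \<tau>(3)] by (auto simp: faces_def)
      then show "\<tau> - {v} \<in> sym_diff G (coboundary2 n d P)"
        using without_v[of "\<tau> - {v}"] \<tau> by (simp add: insert_absorb)
    qed
    show "insert v ` sym_diff G (coboundary2 n d P) \<subseteq> {\<tau> \<in> coboundary2 n (Suc d) G. v \<in> \<tau>}"
    proof (rule image_subsetI)
      fix \<sigma> assume "\<sigma> \<in> sym_diff G (coboundary2 n d P)"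
      then show "insert v \<sigma> \<in> {\<tau> \<in> coboundary2 n (Suc d) G. v \<in> \<tau>}"
        using without_v[of \<sigma>] *[of \<sigma>] by simp
    qed
  qed
  from bij_betw_same_card[OF this] show ?thesis unfolding P_def by simp
qed

text \<open>
  If \<open>G\<close> has least weight in its class, then its modification at each of the \<open>n\<close> vertices \<open>v\<close> has
  weight at least \<open>card G\<close>; summing over \<open>v\<close> counts every face of the coboundary \<open>d + 1\<close> times.
\<close>

lemma coboundary_expansion:
  assumes d: "d \<ge> 1" and G: "G \<subseteq> faces n d"
    and min: "\<And>P. P \<subseteq> faces n (d - 1) \<Longrightarrow> card G \<le> card (sym_diff G (coboundary2 n d P))"
  shows "n * card G \<le> Suc d * card (coboundary2 n (Suc d) G)"
proof -
  have "n * card G = (\<Sum>v\<in>{1..n}. card G)" by simp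
  also have "\<dots> \<le> (\<Sum>v\<in>{1..n}. card {\<tau> \<in> coboundary2 n (Suc d) G. v \<in> \<tau>})"
  proof (rule sum_mono)
    fix v assume v: "v \<in> {1..n}"
    show "card G \<le> card {\<tau> \<in> coboundary2 n (Suc d) G. v \<in> \<tau>}"
      unfolding card_push_in[OF d G v, symmetric] by (rule min) blast
  qed
  also have "\<dots> = (\<Sum>\<tau>\<in>coboundary2 n (Suc d) G. card {v \<in> {1..n}. v \<in> \<tau>})"
    by (rule double_counting) auto
  also have "\<dots> = (\<Sum>\<tau>\<in>coboundary2 n (Suc d) G. Suc d)"
  proof (rule sum.cong)
    fix \<tau> assume "\<tau> \<in> coboundary2 n (Suc d) G"
    then have "\<tau> \<subseteq> {1..n}" "card \<tau> = Suc d" using coboundary2_subset[of n "Suc d" G] by (auto simp: faces_def)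
    moreover have "{v \<in> {1..n}. v \<in> \<tau>} = \<tau>" using \<open>\<tau> \<subseteq> {1..n}\<close> by auto
    ultimately show "card {v \<in> {1..n}. v \<in> \<tau>} = Suc d" by simp
  qed simp
  finally show ?thesis by (simp add: mult.commute)
qed

section \<open>Minimal nontrivial cocycles\<close>

text \<open>
  Two distinct faces of equal size are adjacent if one coface contains both of them.
\<close>

definition adjacent :: "nat set \<Rightarrow> nat set \<Rightarrow> bool" where
  "adjacent \<sigma> \<sigma>' \<longleftrightarrow> card \<sigma>' = card \<sigma> \<and> card (\<sigma> \<union> \<sigma>') = Suc (card \<sigma>)"

text \<open>
  The connected sets of faces, generated one face at a time so that they can be counted along their
  construction.
\<close>

inductive_set clusters :: "nat \<Rightarrow> nat \<Rightarrow> nat set set set" for n d where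
  single: "\<sigma> \<in> faces n d \<Longrightarrow> {\<sigma>} \<in> clusters n d"
| grow: "G \<in> clusters n d \<Longrightarrow> \<sigma> \<in> G \<Longrightarrow> \<sigma>' \<in> faces n d \<Longrightarrow> \<sigma>' \<notin> G \<Longrightarrow> adjacent \<sigma> \<sigma>'
    \<Longrightarrow> insert \<sigma>' G \<in> clusters n d"

lemma adjacent_sym: "adjacent \<sigma> \<sigma>' \<longleftrightarrow> adjacent \<sigma>' \<sigma>"
  by (auto simp: adjacent_def Un_commute)

lemma clusters_subset: "G \<in> clusters n d \<Longrightarrow> G \<subseteq> faces n d"
  by (induction rule: clusters.induct) auto

lemma adjacent_in_common_coface:
  assumes "\<tau> \<in> faces n (Suc d)" "\<sigma> \<in> faces n d" "\<sigma>' \<in> faces n d" "\<sigma> \<subseteq> \<tau>" "\<sigma>' \<subseteq> \<tau>" "\<sigma> \<noteq> \<sigma>'"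
  shows "adjacent \<sigma> \<sigma>'" "\<sigma> \<union> \<sigma>' = \<tau>"
proof -
  note fin = assms(1-3)[THEN facesD(3)]
  have "\<not> \<sigma>' \<subseteq> \<sigma>"
    using card_subset_eq[OF fin(2), of \<sigma>'] assms(2,3,6) by (auto simp: faces_def)
  then have "\<sigma> \<noteq> \<sigma> \<union> \<sigma>'" by blast
  then have "card \<sigma> < card (\<sigma> \<union> \<sigma>')" using fin by (intro psubset_card_mono) auto
  moreover have "card (\<sigma> \<union> \<sigma>') \<le> card \<tau>" using fin assms by (intro card_mono) auto
  ultimately have c: "card (\<sigma> \<union> \<sigma>') = Suc d" using assms by (simp add: faces_def)
  then show "adjacent \<sigma> \<sigma>'" using assms by (simp add: adjacent_def faces_def)
  show "\<sigma> \<union> \<sigma>' = \<tau>"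
    using c fin assms by (intro card_subset_eq) (auto simp: faces_def)
qed

text \<open>
  All the properties come from the minimality of \<open>card G\<close>. The restriction of a cocycle to a union of
  connected components is a cocycle, since the faces of \<open>G\<close> in one \<open>d\<close>-face are pairwise adjacent; so a
  disconnected \<open>G\<close> would be a sum of smaller, hence trivial, cocycles. A single face that is a
  cocycle is isolated. Adding a coboundary does not change the class.
\<close>

lemma minimal_nontrivial_cocycle:
  assumes d: "d \<ge> 1" and T: "T \<subseteq> faces n (Suc d)" and nt: "\<not> only_trivial_cocycles n d T"
  obtains G where "G \<in> clusters n d" "2 \<le> card G"
    "n * card G \<le> Suc d * card (coboundary2 n (Suc d) G)" "coboundary2 n (Suc d) G \<inter> T = {}"
proof -
  define bad where "bad G \<longleftrightarrow> G \<subseteq> faces n d \<and> coboundary2 n (Suc d) G \<inter> T = {} \<and> G \<notin> trivial_cocycles n d T"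
    for G
  obtain G0 where "bad G0" using nt unfolding only_trivial_cocycles_def bad_def by blast
  then obtain G where G: "bad G" and min: "\<And>H. bad H \<Longrightarrow> card G \<le> card H"
    using ex_has_least_nat[of bad G0 card] by blast
  have sub: "G \<subseteq> faces n d" and coc: "coboundary2 n (Suc d) G \<inter> T = {}"
    and ntG: "G \<notin> trivial_cocycles n d T"
    using G unfolding bad_def by auto
  have fin: "finite G" using sub by (rule finite_subset_faces)
  have ne: "G \<noteq> {}" using ntG isolated_trivial[of "{}"] by auto
  have coc': "even (card {\<sigma> \<in> G. \<sigma> \<subseteq> \<tau>})" if "\<tau> \<in> T" for \<tau>
    using coc that T unfolding coboundary2_def by blast

  have "G \<in> clusters n d"
  proof -
    obtain \<sigma>0 where "\<sigma>0 \<in> G" using ne by blast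
    then have "{\<sigma>0} \<in> {H \<in> clusters n d. H \<subseteq> G}" using sub clusters.single by blast
    \<comment> \<open>a connected component of \<open>G\<close>, as a maximal cluster in \<open>G\<close>\<close>
    then obtain H where H: "H \<in> clusters n d" "H \<subseteq> G" "{\<sigma>0} \<subseteq> H"
      and maxi: "\<And>H'. H' \<in> clusters n d \<Longrightarrow> H' \<subseteq> G \<Longrightarrow> H \<subseteq> H' \<Longrightarrow> H = H'"
      using finite_has_maximal2[of "{H \<in> clusters n d. H \<subseteq> G}" "{\<sigma>0}"] fin by auto
    show ?thesis
    proof (cases "H = G")
      case False
      have nadj: "\<not> adjacent \<sigma> \<sigma>'" if "\<sigma> \<in> H" "\<sigma>' \<in> G - H" for \<sigma> \<sigma>'
      proof
        assume "adjacent \<sigma> \<sigma>'"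
        then have "insert \<sigma>' H \<in> clusters n d"
          using clusters.grow[OF H(1) that(1), of \<sigma>'] that sub by blast
        then show False using maxi[of "insert \<sigma>' H"] that H by blast
      qed
      have one_side: "{\<sigma> \<in> G. \<sigma> \<subseteq> \<tau>} \<subseteq> H \<or> {\<sigma> \<in> G. \<sigma> \<subseteq> \<tau>} \<inter> H = {}" if "\<tau> \<in> T" for \<tau>
      proof (rule ccontr)
        assume "\<not> ?thesis"
        then obtain \<sigma> \<sigma>' where s: "\<sigma> \<in> H" "\<sigma>' \<in> G - H" "\<sigma> \<subseteq> \<tau>" "\<sigma>' \<subseteq> \<tau>" by blast
        then have "adjacent \<sigma> \<sigma>'"
          using H(2) sub T that by (intro adjacent_in_common_coface(1)[of \<tau> n d]) blast+
        then show False using nadj s by blast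
      qed
      have "coboundary2 n (Suc d) H \<inter> T = {}" "coboundary2 n (Suc d) (G - H) \<inter> T = {}"
      proof -
        have "even (card {\<sigma> \<in> H. \<sigma> \<subseteq> \<tau>}) \<and> even (card {\<sigma> \<in> G - H. \<sigma> \<subseteq> \<tau>})" if \<tau>: "\<tau> \<in> T" for \<tau>
          using one_side[OF \<tau>]
        proof
          assume "{\<sigma> \<in> G. \<sigma> \<subseteq> \<tau>} \<subseteq> H"
          then have "{\<sigma> \<in> H. \<sigma> \<subseteq> \<tau>} = {\<sigma> \<in> G. \<sigma> \<subseteq> \<tau>}" "{\<sigma> \<in> G - H. \<sigma> \<subseteq> \<tau>} = {}" using H(2) by auto
          then show ?thesis using coc'[OF \<tau>] by (metis card.empty even_zero)
        next
          assume "{\<sigma> \<in> G. \<sigma> \<subseteq> \<tau>} \<inter> H = {}"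
          then have "{\<sigma> \<in> H. \<sigma> \<subseteq> \<tau>} = {}" "{\<sigma> \<in> G - H. \<sigma> \<subseteq> \<tau>} = {\<sigma> \<in> G. \<sigma> \<subseteq> \<tau>}" using H(2) by auto
          then show ?thesis using coc'[OF \<tau>] by (metis card.empty even_zero)
        qed
        then show "coboundary2 n (Suc d) H \<inter> T = {}" "coboundary2 n (Suc d) (G - H) \<inter> T = {}"
          unfolding coboundary2_def by blast+
      qed
      moreover have "card H < card G" "card (G - H) < card G"
        using False H fin by (auto intro!: psubset_card_mono)
      moreover have "H \<subseteq> faces n d" "G - H \<subseteq> faces n d" using H(2) sub by auto
      ultimately have "H \<in> trivial_cocycles n d T" "G - H \<in> trivial_cocycles n d T"
        using min[of H] min[of "G - H"] unfolding bad_def by auto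
      then have "sym_diff H (G - H) \<in> trivial_cocycles n d T" by (rule sym_diff_trivial_cocycles)
      moreover have "sym_diff H (G - H) = G" using H(2) by auto
      ultimately show ?thesis using ntG by simp
    qed (use H in simp)
  qed
  moreover have "2 \<le> card G"
  proof (rule ccontr)
    assume "\<not> ?thesis"
    then have "card G = 1" using ne fin by (simp add: not_le less_2_cases_iff)
    then obtain \<sigma> where \<sigma>: "G = {\<sigma>}" by (rule card_1_singletonE)
    have "\<not> \<sigma> \<subseteq> \<tau>" if "\<tau> \<in> T" for \<tau>
    proof
      assume "\<sigma> \<subseteq> \<tau>"
      then have "{\<sigma>' \<in> G. \<sigma>' \<subseteq> \<tau>} = {\<sigma>}" using \<sigma> by auto
      then show False using coc'[OF that] by simp
    qed
    then have "G \<subseteq> isolated_faces n d T" using \<sigma> sub by (auto simp: isolated_faces_def)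
    then show False using ntG isolated_trivial by blast
  qed
  moreover have "n * card G \<le> Suc d * card (coboundary2 n (Suc d) G)"
  proof (rule coboundary_expansion[OF d sub])
    fix P assume P: "P \<subseteq> faces n (d - 1)"
    let ?H = "sym_diff G (coboundary2 n d P)"
    have "coboundary2 n (Suc d) (coboundary2 n d P) = {}" using coboundary2_coboundary2[OF P] d by simp
    then have "coboundary2 n (Suc d) ?H = coboundary2 n (Suc d) G"
      using coboundary2_sym_diff[OF fin finite_coboundary2, of n "Suc d" n d P] by simp
    moreover have "?H \<notin> trivial_cocycles n d T"
    proof
      assume "?H \<in> trivial_cocycles n d T"
      from sym_diff_trivial_cocycles[OF this coboundary_trivial[OF P]]
      have "sym_diff ?H (coboundary2 n d P) \<in> trivial_cocycles n d T" .
      moreover have "sym_diff ?H (coboundary2 n d P) = G" by blast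
      ultimately show False using ntG by simp
    qed
    moreover have "?H \<subseteq> faces n d" using sub coboundary2_subset[of n d P] by blast
    ultimately show "card G \<le> card ?H" using coc by (intro min) (simp add: bad_def)
  qed
  ultimately show ?thesis using that coc by blast
qed

section \<open>Counting supports of cocycles\<close>

lemma card_neighbours_le:
  assumes "\<sigma> \<in> faces n d"
  shows "card {\<sigma>' \<in> faces n d. adjacent \<sigma> \<sigma>'} \<le> d * n"
proof -
  have fin: "finite \<sigma>" and c: "card \<sigma> = d" using assms facesD by blast+
  have "{\<sigma>' \<in> faces n d. adjacent \<sigma> \<sigma>'} \<subseteq> (\<lambda>(u, v). insert v (\<sigma> - {u})) ` (\<sigma> \<times> {1..n})"
  proof
    fix \<sigma>' assume "\<sigma>' \<in> {\<sigma>' \<in> faces n d. adjacent \<sigma> \<sigma>'}"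
    then have s: "\<sigma>' \<in> faces n d" "card (\<sigma> \<union> \<sigma>') = Suc d" using c by (auto simp: adjacent_def)
    have fin': "finite \<sigma>'" "card \<sigma>' = d" using s facesD by blast+
    have "card (\<sigma>' - \<sigma>) = card (\<sigma> \<union> \<sigma>') - card \<sigma>" "card (\<sigma> - \<sigma>') = card (\<sigma> \<union> \<sigma>') - card \<sigma>'"
      using fin fin' card_Diff_subset[of \<sigma> "\<sigma> \<union> \<sigma>'"] card_Diff_subset[of \<sigma>' "\<sigma> \<union> \<sigma>'"]
      by (simp_all add: Un_Diff)
    then have "card (\<sigma>' - \<sigma>) = 1" "card (\<sigma> - \<sigma>') = 1" using s c fin' by auto
    then obtain u v where uv: "\<sigma>' - \<sigma> = {v}" "\<sigma> - \<sigma>' = {u}" by (meson card_1_singletonE)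
    have "\<sigma>' = insert v (\<sigma> - {u})" using uv by blast
    moreover have "u \<in> \<sigma>" "v \<in> \<sigma>'" using uv by blast+
    moreover have "v \<in> {1..n}" using \<open>v \<in> \<sigma>'\<close> facesD(1)[OF s(1)] by blast
    ultimately show "\<sigma>' \<in> (\<lambda>(u, v). insert v (\<sigma> - {u})) ` (\<sigma> \<times> {1..n})"
      by (intro image_eqI[of _ _ "(u, v)"]) simp_all
  qed
  then have "card {\<sigma>' \<in> faces n d. adjacent \<sigma> \<sigma>'} \<le> card (\<sigma> \<times> {1..n})"
    using fin by (intro surj_card_le) auto
  then show ?thesis using c by (simp add: card_cartesian_product)
qed

text \<open>
  A face \<open>u\<close> has \<open>n - d\<close> cofaces. Such a coface contains no other face of \<open>G\<close>, and so lies in the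
  coboundary, unless it is spanned by \<open>u\<close> and an adjacent face of \<open>G\<close>; distinct faces \<open>u\<close> yield distinct cofaces
  of the first kind.
\<close>

lemma card_coboundary2_lower:
  assumes G: "G \<subseteq> faces n d" and U: "U \<subseteq> G"
  shows "card U * (n - d) \<le> card (coboundary2 n (Suc d) G) + (\<Sum>u\<in>U. card {g \<in> G. adjacent u g})"
proof -
  have fin: "finite G" "finite U" using G U by (auto intro: finite_subset_faces finite_subset)
  have Uf: "u \<subseteq> {1..n}" "card u = d" "finite u" if "u \<in> U" for u
    using that U G facesD by blast+
  define A where "A = (SIGMA u:U. {1..n} - u)"
  define good where "good = {(u, v) \<in> A. {g \<in> G. g \<subseteq> insert v u} = {u}}"
  have finA: "finite A" using fin by (auto simp: A_def)
  have cA: "card A = card U * (n - d)"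
  proof -
    have "card A = (\<Sum>u\<in>U. card ({1..n} - u))" unfolding A_def using fin by (intro card_SigmaI) auto
    also have "\<dots> = (\<Sum>u\<in>U. n - d)"
      using Uf by (intro sum.cong) (auto simp: card_Diff_subset)
    finally show ?thesis by simp
  qed
  have ins: "insert v u \<in> faces n (Suc d)" if "(u, v) \<in> A" for u v
    using that Uf by (auto simp: A_def faces_def)
  have "card good \<le> card (coboundary2 n (Suc d) G)"
  proof (rule card_inj_on_le[of "\<lambda>(u, v). insert v u"])
    show "inj_on (\<lambda>(u, v). insert v u) good"
    proof (rule inj_onI, clarify)
      fix u v u' v' assume *: "(u, v) \<in> good" "(u', v') \<in> good" "insert v u = insert v' u'"
      then have "{g \<in> G. g \<subseteq> insert v u} = {u}" "{g \<in> G. g \<subseteq> insert v u} = {u'}" "v \<notin> u" "v' \<notin> u'"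
        by (auto simp: good_def A_def)
      then show "u = u' \<and> v = v'" using * by auto
    qed
    show "(\<lambda>(u, v). insert v u) ` good \<subseteq> coboundary2 n (Suc d) G"
      using ins by (auto simp: good_def coboundary2_def)
  qed simp
  moreover have "card (A - good) \<le> (\<Sum>u\<in>U. card {g \<in> G. adjacent u g})"
  proof -
    \<comment> \<open>a bad pair \<open>(u, v)\<close> is determined by \<open>u\<close> and a face of \<open>G\<close> in the coface, whose vertex outside \<open>u\<close> is \<open>v\<close>\<close>
    have "A - good \<subseteq> (\<lambda>(u, g). (u, THE v. v \<in> g - u)) ` (SIGMA u:U. {g \<in> G. adjacent u g})"
    proof
      fix x assume x: "x \<in> A - good"
      obtain u v where uv: "x = (u, v)" by (cases x)
      have u: "u \<in> U" "u \<in> G" "v \<notin> u" "(u, v) \<in> A" using x uv U by (auto simp: A_def)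
      then have "u \<in> {g \<in> G. g \<subseteq> insert v u}" "{g \<in> G. g \<subseteq> insert v u} \<noteq> {u}" using x uv
        by (auto simp: good_def)
      then obtain g where g: "g \<in> G" "g \<subseteq> insert v u" "g \<noteq> u" by blast
      have "adjacent u g" "u \<union> g = insert v u"
        using adjacent_in_common_coface[OF ins[OF u(4)], of u g] g u G by auto
      then have "g - u = {v}" using u g by auto
      then have "(THE v. v \<in> g - u) = v" by auto
      then have "x = (\<lambda>(u, g). (u, THE v. v \<in> g - u)) (u, g)" using uv by simp
      moreover have "(u, g) \<in> (SIGMA u:U. {g \<in> G. adjacent u g})" using u g \<open>adjacent u g\<close> by auto
      ultimately show "x \<in> (\<lambda>(u, g). (u, THE v. v \<in> g - u)) ` (SIGMA u:U. {g \<in> G. adjacent u g})"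
        by blast
    qed
    then have "card (A - good) \<le> card (SIGMA u:U. {g \<in> G. adjacent u g})"
      using fin by (intro surj_card_le) auto
    also have "\<dots> = (\<Sum>u\<in>U. card {g \<in> G. adjacent u g})"
      using fin by (intro card_SigmaI) auto
    finally show ?thesis .
  qed
  moreover have "card A = card good + card (A - good)"
    using finA card_Int_Diff[of A good] by (auto simp: good_def Int_absorb1 subset_eq)
  ultimately show ?thesis using cA by linarith
qed

text \<open>
  There are at most \<open>m * (d * n)\<close> ways to add a face to a cluster with \<open>m\<close> faces.
\<close>

lemma card_clusters_le:
  "card {G \<in> clusters n d. card G = Suc m} \<le> (n choose d) * (fact m * (d * n) ^ m)"
proof (induction m)
  case 0
  have "{G \<in> clusters n d. card G = Suc 0} \<subseteq> (\<lambda>\<sigma>. {\<sigma>}) ` faces n d"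
    using clusters_subset by (fastforce simp: card_Suc_eq)
  then have "card {G \<in> clusters n d. card G = Suc 0} \<le> card (faces n d)"
    by (intro surj_card_le) auto
  then show ?case by (simp add: card_faces)
next
  case (Suc m)
  let ?C = "\<lambda>m. {G \<in> clusters n d. card G = m}"
  have finC: "finite (?C k)" for k
    by (rule finite_subset[of _ "Pow (faces n d)"]) (auto dest: clusters_subset)
  have "?C (Suc (Suc m)) \<subseteq>
      (\<Union>G\<in>?C (Suc m). \<Union>\<sigma>\<in>G. (\<lambda>\<sigma>'. insert \<sigma>' G) ` {\<sigma>' \<in> faces n d. adjacent \<sigma> \<sigma>'})"
  proof
    fix G assume "G \<in> ?C (Suc (Suc m))"
    then have G: "G \<in> clusters n d" "card G = Suc (Suc m)" by auto
    from G(1) show "G \<in> (\<Union>G\<in>?C (Suc m). \<Union>\<sigma>\<in>G. (\<lambda>\<sigma>'. insert \<sigma>' G) ` {\<sigma>' \<in> faces n d. adjacent \<sigma> \<sigma>'})"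
    proof cases
      case (grow G' \<sigma> \<sigma>')
      have "finite G'" by (rule finite_subset_faces[OF clusters_subset[OF grow(2)]])
      then have "card G' = Suc m" using grow G by simp
      then have "G' \<in> ?C (Suc m)" "\<sigma>' \<in> {\<sigma>' \<in> faces n d. adjacent \<sigma> \<sigma>'}" using grow by auto
      then show ?thesis unfolding grow(1) using \<open>\<sigma> \<in> G'\<close>
        by (intro UN_I) (assumption, assumption, erule imageI[of _ _ "\<lambda>\<sigma>'. insert \<sigma>' G'"])
    qed (use G in simp)
  qed
  then have "card (?C (Suc (Suc m))) \<le>
      card (\<Union>G\<in>?C (Suc m). \<Union>\<sigma>\<in>G. (\<lambda>\<sigma>'. insert \<sigma>' G) ` {\<sigma>' \<in> faces n d. adjacent \<sigma> \<sigma>'})"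
    by (intro card_mono finite_UN_I finC finite_imageI)
      (auto dest: clusters_subset intro: finite_subset_faces)
  also have "\<dots> \<le> (\<Sum>G\<in>?C (Suc m). card (\<Union>\<sigma>\<in>G. (\<lambda>\<sigma>'. insert \<sigma>' G) ` {\<sigma>' \<in> faces n d. adjacent \<sigma> \<sigma>'}))"
    by (rule card_UN_le[OF finC])
  also have "\<dots> \<le> (\<Sum>G\<in>?C (Suc m). Suc m * (d * n))"
  proof (rule sum_mono)
    fix G assume "G \<in> ?C (Suc m)"
    then have G: "G \<subseteq> faces n d" "card G = Suc m" "finite G"
      using clusters_subset[of G n d] finite_subset_faces[of G n d] by auto
    have "card (\<Union>\<sigma>\<in>G. (\<lambda>\<sigma>'. insert \<sigma>' G) ` {\<sigma>' \<in> faces n d. adjacent \<sigma> \<sigma>'})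
        \<le> (\<Sum>\<sigma>\<in>G. card ((\<lambda>\<sigma>'. insert \<sigma>' G) ` {\<sigma>' \<in> faces n d. adjacent \<sigma> \<sigma>'}))"
      by (rule card_UN_le[OF G(3)])
    also have "\<dots> \<le> (\<Sum>\<sigma>\<in>G. d * n)"
    proof (rule sum_mono)
      fix \<sigma> assume "\<sigma> \<in> G"
      then have "\<sigma> \<in> faces n d" using G by auto
      have "card ((\<lambda>\<sigma>'. insert \<sigma>' G) ` {\<sigma>' \<in> faces n d. adjacent \<sigma> \<sigma>'}) \<le> card {\<sigma>' \<in> faces n d. adjacent \<sigma> \<sigma>'}"
        by (rule card_image_le) simp
      then show "card ((\<lambda>\<sigma>'. insert \<sigma>' G) ` {\<sigma>' \<in> faces n d. adjacent \<sigma> \<sigma>'}) \<le> d * n"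
        using card_neighbours_le[OF \<open>\<sigma> \<in> faces n d\<close>] by linarith
    qed
    finally show "card (\<Union>\<sigma>\<in>G. (\<lambda>\<sigma>'. insert \<sigma>' G) ` {\<sigma>' \<in> faces n d. adjacent \<sigma> \<sigma>'}) \<le> Suc m * (d * n)"
      using G by simp
  qed
  also have "\<dots> = card (?C (Suc m)) * (Suc m * (d * n))" by simp
  also have "\<dots> \<le> ((n choose d) * (fact m * (d * n) ^ m)) * (Suc m * (d * n))"
    using Suc.IH by (rule mult_right_mono) simp
  also have "\<dots> = (n choose d) * (fact (Suc m) * (d * n) ^ Suc m)"
    by (simp add: algebra_simps)
  finally show ?case .
qed

text \<open>
  Take \<open>S\<close> maximal among the sets that dominate at least \<open>K\<close> faces for each of their members. Then each
  face of \<open>G\<close> is adjacent to at most \<open>K\<close> undominated ones, as it could otherwise be added to \<open>S\<close>.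
\<close>

lemma sparse_dominating_set:
  assumes G: "finite G" and K: "K > 0"
  obtains S where "S \<subseteq> G" "K * card S \<le> card G"
    "(\<Sum>u\<in>{u \<in> G. \<forall>s\<in>S. \<not> adjacent s u}. card {g \<in> G. adjacent u g}) \<le> K * card G"
proof -
  define N where "N S = {g \<in> G. \<exists>s\<in>S. adjacent s g}" for S
  define \<S> where "\<S> = {S. S \<subseteq> G \<and> K * card S \<le> card (N S)}"
  have finN: "finite (N S)" for S using G by (auto simp: N_def)
  have "{} \<in> \<S>" by (auto simp: \<S>_def)
  have "finite \<S>" using G by (auto simp: \<S>_def)
  from finite_has_maximal2[OF this \<open>{} \<in> \<S>\<close>]
  obtain S where S: "S \<in> \<S>" and maxi: "\<And>S'. S' \<in> \<S> \<Longrightarrow> S \<subseteq> S' \<Longrightarrow> S = S'"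
    by auto
  have Ssub: "S \<subseteq> G" and Scard: "K * card S \<le> card (N S)" using S by (auto simp: \<S>_def)
  define U where "U = {u \<in> G. \<forall>s\<in>S. \<not> adjacent s u}"
  have finU: "finite U" using G by (auto simp: U_def)
  \<comment> \<open>the members of \<open>S\<close> have no undominated neighbours, hence the case distinction\<close>
  have few: "card {u \<in> U. adjacent u g} \<le> K" if g: "g \<in> G" for g
  proof (cases "g \<in> S")
    case True
    then have "{u \<in> U. adjacent u g} = {}" by (auto simp: U_def adjacent_sym)
    then show ?thesis by (metis card.empty le0)
  next
    case False
    show ?thesis
    proof (rule ccontr)
      assume *: "\<not> ?thesis"
      have "N (insert g S) = N S \<union> {u \<in> U. adjacent u g}"
        by (auto simp: N_def U_def adjacent_sym)
      moreover have "N S \<inter> {u \<in> U. adjacent u g} = {}" by (auto simp: N_def U_def)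
      ultimately have "card (N (insert g S)) = card (N S) + card {u \<in> U. adjacent u g}"
        using finN finU by (simp add: card_Un_disjoint)
      then have "K * card (insert g S) \<le> card (N (insert g S))"
        using * Scard False finite_subset[OF Ssub G] by simp
      then have "insert g S \<in> \<S>" using Ssub g by (auto simp: \<S>_def)
      then show False using maxi[of "insert g S"] False by blast
    qed
  qed
  have "(\<Sum>u\<in>U. card {g \<in> G. adjacent u g}) = (\<Sum>g\<in>G. card {u \<in> U. adjacent u g})"
    using finU G by (rule double_counting)
  also have "\<dots> \<le> (\<Sum>g\<in>G. K)" using few by (rule sum_mono)
  finally have "(\<Sum>u\<in>U. card {g \<in> G. adjacent u g}) \<le> K * card G" by (simp add: mult.commute)
  moreover have "K * card S \<le> card G"
    using Scard card_mono[OF G, of "N S"] by (auto simp: N_def)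
  ultimately show ?thesis using that[of S] Ssub unfolding U_def by simp
qed

lemma card_subsets_card_le:
  assumes "finite A"
  shows "card {S. S \<subseteq> A \<and> card S \<le> s} \<le> (card A + 1) ^ s"
proof (induction s)
  case 0
  have "{S. S \<subseteq> A \<and> card S \<le> 0} = {{}}" using assms by (auto dest: finite_subset)
  then show ?case by simp
next
  case (Suc s)
  let ?X = "{S. S \<subseteq> A \<and> card S \<le> s} \<times> insert None (Some ` A)"
  let ?f = "\<lambda>(S, x). case x of None \<Rightarrow> S | Some a \<Rightarrow> insert a S"
  have "{S. S \<subseteq> A \<and> card S \<le> Suc s} \<subseteq> ?f ` ?X"
  proof
    fix S assume S: "S \<in> {S. S \<subseteq> A \<and> card S \<le> Suc s}"
    then have fin: "finite S" using assms finite_subset by auto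
    show "S \<in> ?f ` ?X"
    proof (cases "card S \<le> s")
      case True
      then show ?thesis using S by (intro image_eqI[of _ _ "(S, None)"]) auto
    next
      case False
      then have "S \<noteq> {}" by auto
      then obtain a where a: "a \<in> S" by blast
      then have "card (S - {a}) \<le> s" using S fin by auto
      then show ?thesis using S a by (intro image_eqI[of _ _ "(S - {a}, Some a)"]) auto
    qed
  qed
  then have "card {S. S \<subseteq> A \<and> card S \<le> Suc s} \<le> card ?X"
    using assms by (intro surj_card_le) auto
  also have "\<dots> = card {S. S \<subseteq> A \<and> card S \<le> s} * (card A + 1)"
    using assms by (simp add: card_cartesian_product card_image)
  also have "\<dots> \<le> (card A + 1) ^ s * (card A + 1)" using Suc.IH by (rule mult_right_mono) simp
  finally show ?case by (simp add: mult.commute)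
qed

lemma sum_subsets_by_card:
  fixes w :: "nat \<Rightarrow> real"
  assumes "finite A"
  shows "(\<Sum>U | U \<subseteq> A \<and> card U \<le> m. w (card U)) = (\<Sum>u\<le>m. real (card A choose u) * w u)"
proof -
  have fin: "finite {U. U \<subseteq> A \<and> card U \<le> m}" using assms by simp
  have "(\<Sum>U | U \<subseteq> A \<and> card U \<le> m. w (card U))
      = (\<Sum>u\<le>m. \<Sum>U | U \<in> {U. U \<subseteq> A \<and> card U \<le> m} \<and> card U = u. w (card U))"
    using fin by (intro sum.group[symmetric]) auto
  also have "\<dots> = (\<Sum>u\<le>m. real (card A choose u) * w u)"
  proof (rule sum.cong)
    fix u assume "u \<in> {..m}"
    then have "{U. U \<in> {U. U \<subseteq> A \<and> card U \<le> m} \<and> card U = u} = {U. U \<subseteq> A \<and> card U = u}" by auto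
    then show "(\<Sum>U | U \<in> {U. U \<subseteq> A \<and> card U \<le> m} \<and> card U = u. w (card U)) = real (card A choose u) * w u"
      using n_subsets[OF assms, of u] by simp
  qed simp
  finally show ?thesis .
qed

text \<open>
  A set \<open>G\<close> is encoded by its sparse dominating set \<open>S\<close>, the dominated part \<open>G - U\<close>, which is one of the
  subsets of the neighbourhood of \<open>S\<close>, and the undominated part \<open>U\<close>. The three factors of the bound
  count these in turn; the weight \<open>f G\<close> is controlled by the size of \<open>U\<close> alone.
\<close>

lemma sum_over_dominated_sets:
  fixes w :: "nat \<Rightarrow> real" and f :: "nat set set \<Rightarrow> real"
  assumes K: "K > 0" and w: "\<And>u. w u \<ge> 0"
    and \<G>: "\<And>G. G \<in> \<G> \<Longrightarrow> G \<subseteq> faces n d \<and> card G = m"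
    and f: "\<And>G u. G \<in> \<G> \<Longrightarrow> u \<le> m \<Longrightarrow> u * (n - d) \<le> card (coboundary2 n (Suc d) G) + K * m \<Longrightarrow> f G \<le> w u"
  shows "(\<Sum>G\<in>\<G>. f G) \<le> real (((n choose d) + 1) ^ (m div K)) * 2 ^ (m div K * (d * n)) *
           (\<Sum>u\<le>m. real ((n choose d) choose u) * w u)"
proof -
  define s where "s = m div K"
  define undom where "undom S G = {u \<in> G. \<forall>s\<in>S. \<not> adjacent s u}" for S G :: "nat set set"
  define dominates where "dominates S G \<longleftrightarrow> S \<subseteq> G \<and> K * card S \<le> card G \<and>
      (\<Sum>u\<in>undom S G. card {g \<in> G. adjacent u g}) \<le> K * card G" for S G
  have "\<exists>S. dominates S G" if "G \<in> \<G>" for G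
  proof -
    have "finite G" using \<G>[OF that] finite_subset_faces[of G n d] by simp
    then obtain S where "S \<subseteq> G" "K * card S \<le> card G"
      "(\<Sum>u\<in>{u \<in> G. \<forall>s\<in>S. \<not> adjacent s u}. card {g \<in> G. adjacent u g}) \<le> K * card G"
      using K by (rule sparse_dominating_set)
    then show ?thesis unfolding undom_def dominates_def by (intro exI[of _ S] conjI)
  qed
  then obtain S where dom: "\<And>G. G \<in> \<G> \<Longrightarrow> dominates (S G) G" by metis
  note S = dom[unfolded dominates_def]
  define U where "U G = undom (S G) G" for G
  define near where "near S = (\<Union>s\<in>S. {\<sigma> \<in> faces n d. adjacent s \<sigma>})" for S
  define \<S> where "\<S> = {S. S \<subseteq> faces n d \<and> card S \<le> s}"
  define \<U> where "\<U> = {U. U \<subseteq> faces n d \<and> card U \<le> m}"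
  \<comment> \<open>the encoding is injective since \<open>G\<close> is the union of its last two components\<close>
  define code where "code G = (S G, G - U G, U G)" for G
  have Usub: "U G \<subseteq> G" for G by (auto simp: U_def undom_def)
  have fin\<G>: "finite \<G>" by (rule finite_subset[of _ "Pow (faces n d)"]) (use \<G> in auto)
  have inj: "inj_on code \<G>"
  proof (rule inj_onI)
    fix G H assume "code G = code H"
    then have "G - U G = H - U H" "U G = U H" unfolding code_def prod.inject by blast+
    then show "G = H" using Usub[of G] Usub[of H] by (metis Un_Diff_cancel2 sup.absorb1)
  qed
  have fin\<S>: "finite \<S>" "finite \<U>" by (simp_all add: \<S>_def \<U>_def)
  have finnear: "finite (near S)" if "S \<in> \<S>" for S
    using that by (auto simp: near_def \<S>_def intro: finite_subset_faces)
  have code: "code ` \<G> \<subseteq> (SIGMA S:\<S>. Pow (near S) \<times> \<U>)"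
  proof (rule image_subsetI)
    fix G assume G: "G \<in> \<G>"
    have finG: "finite G" using \<G>[OF G] finite_subset_faces[of G n d] by simp
    have "K * card (S G) \<le> m" using S[OF G] \<G>[OF G] by simp
    then have "card (S G) \<le> s" unfolding s_def using K
      by (metis div_le_mono nonzero_mult_div_cancel_left less_numeral_extra(3))
    then have "S G \<in> \<S>" using S[OF G] \<G>[OF G] by (auto simp: \<S>_def)
    moreover have "G - U G \<subseteq> near (S G)"
      using \<G>[OF G] by (auto simp: U_def undom_def near_def)
    moreover have "U G \<in> \<U>"
      using \<G>[OF G] Usub[of G] card_mono[OF finG Usub[of G]] by (auto simp: \<U>_def)
    ultimately show "code G \<in> (SIGMA S:\<S>. Pow (near S) \<times> \<U>)" by (simp add: code_def)
  qed
  have "(\<Sum>G\<in>\<G>. f G) \<le> (\<Sum>G\<in>\<G>. w (card (U G)))"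
  proof (rule sum_mono)
    fix G assume G: "G \<in> \<G>"
    have finG: "finite G" using \<G>[OF G] finite_subset_faces[of G n d] by simp
    have "card (U G) * (n - d) \<le> card (coboundary2 n (Suc d) G) + (\<Sum>u\<in>U G. card {g \<in> G. adjacent u g})"
      using \<G>[OF G] Usub[of G] by (intro card_coboundary2_lower) auto
    also have "\<dots> \<le> card (coboundary2 n (Suc d) G) + K * m"
      using S[OF G] \<G>[OF G] by (simp add: U_def)
    finally show "f G \<le> w (card (U G))"
      using card_mono[OF finG Usub[of G]] \<G>[OF G] by (intro f[OF G]) auto
  qed
  also have "\<dots> = (\<Sum>t\<in>code ` \<G>. w (card (snd (snd t))))"
    by (subst sum.reindex[OF inj]) (simp add: code_def)
  also have "\<dots> \<le> (\<Sum>t\<in>(SIGMA S:\<S>. Pow (near S) \<times> \<U>). w (card (snd (snd t))))"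
    using code w fin\<S> finnear by (intro sum_mono2 finite_SigmaI) auto
  also have "\<dots> = (\<Sum>S\<in>\<S>. \<Sum>t\<in>Pow (near S) \<times> \<U>. w (card (snd t)))"
    using fin\<S> finnear by (subst sum.Sigma) (auto simp: split_beta)
  also have "\<dots> = (\<Sum>S\<in>\<S>. 2 ^ card (near S) * (\<Sum>U\<in>\<U>. w (card U)))"
  proof (rule sum.cong)
    fix S assume "S \<in> \<S>"
    have "(\<Sum>t\<in>Pow (near S) \<times> \<U>. w (card (snd t))) = (\<Sum>X\<in>Pow (near S). \<Sum>U\<in>\<U>. w (card U))"
      unfolding sum.cartesian_product by (intro sum.cong) auto
    also have "\<dots> = 2 ^ card (near S) * (\<Sum>U\<in>\<U>. w (card U))"
      using finnear[OF \<open>S \<in> \<S>\<close>] by (simp add: card_Pow)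
    finally show "(\<Sum>t\<in>Pow (near S) \<times> \<U>. w (card (snd t))) = 2 ^ card (near S) * (\<Sum>U\<in>\<U>. w (card U))" .
  qed simp
  also have "\<dots> \<le> (\<Sum>S\<in>\<S>. 2 ^ (s * (d * n)) * (\<Sum>U\<in>\<U>. w (card U)))"
  proof (intro sum_mono mult_right_mono power_increasing)
    fix S assume "S \<in> \<S>"
    then have S: "S \<subseteq> faces n d" "card S \<le> s" "finite S"
      using finite_subset_faces[of S n d] by (auto simp: \<S>_def)
    have "card (near S) \<le> (\<Sum>s\<in>S. card {\<sigma> \<in> faces n d. adjacent s \<sigma>})"
      unfolding near_def by (rule card_UN_le[OF S(3)])
    also have "\<dots> \<le> (\<Sum>s\<in>S. d * n)" using S card_neighbours_le by (intro sum_mono) auto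
    also have "\<dots> \<le> s * (d * n)" using S(2) by (simp add: mult_le_mono1)
    finally show "card (near S) \<le> s * (d * n)" .
  qed (auto intro: sum_nonneg w)
  also have "\<dots> = real (card \<S>) * 2 ^ (s * (d * n)) * (\<Sum>U\<in>\<U>. w (card U))" by simp
  also have "\<dots> \<le> real (((n choose d) + 1) ^ s) * 2 ^ (s * (d * n)) * (\<Sum>U\<in>\<U>. w (card U))"
  proof (intro mult_right_mono)
    show "real (card \<S>) \<le> real (((n choose d) + 1) ^ s)"
      using card_subsets_card_le[OF finite_faces, of n d s] unfolding \<S>_def card_faces of_nat_le_iff .
  qed (auto intro: sum_nonneg w)
  also have "(\<Sum>U\<in>\<U>. w (card U)) = (\<Sum>u\<le>m. real ((n choose d) choose u) * w u)"
    unfolding \<U>_def by (subst sum_subsets_by_card) (simp_all add: card_faces)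
  finally show ?thesis unfolding s_def .
qed

section \<open>Linear algebra\<close>

text \<open>
  Restriction to the coordinates in \<open>J\<close> is a linear map from \<open>Z\<close> onto the functions on \<open>J\<close>, with kernel
  \<open>W\<close>; the vectors \<open>e j\<close> witness surjectivity, and their cosets form a basis of the quotient.
\<close>

lemma dim_quotient_by_coordinates:
  fixes Z :: "('i \<Rightarrow> 'a :: field) set" and mu :: "('i \<Rightarrow> 'a) \<Rightarrow> ('i \<Rightarrow> 'a) \<Rightarrow> 'i \<Rightarrow> 'a"
  assumes zero: "(\<lambda>i. 0) \<in> Z"
    and add: "\<And>x y. x \<in> Z \<Longrightarrow> y \<in> Z \<Longrightarrow> (\<lambda>i. x i + y i) \<in> Z"
    and smult: "\<And>a x. x \<in> Z \<Longrightarrow> (\<lambda>i. a * x i) \<in> Z"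
    and W: "W = {x \<in> Z. \<forall>j\<in>J. x j = 0}"
    and J: "finite J"
    and e: "\<And>j. j \<in> J \<Longrightarrow> e j \<in> Z" "\<And>i j. i \<in> J \<Longrightarrow> j \<in> J \<Longrightarrow> e j i = of_bool (i = j)"
  shows "vectorspace.dim (class_ring :: 'a ring) (quotient_space
      \<lparr>carrier = Z, mult = mu, one = u, zero = (\<lambda>i. 0),
       add = (\<lambda>f g i. f i + g i), smult = (\<lambda>a f i. a * f i)\<rparr> W) = card J"
proof -
  define V :: "('a, 'i \<Rightarrow> 'a) module" where "V = \<lparr>carrier = Z, mult = mu, one = u, zero = (\<lambda>i. 0),
       add = (\<lambda>f g i. f i + g i), smult = (\<lambda>a f i. a * f i)\<rparr>"
  define Q where "Q = quotient_space V W"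
  \<comment> \<open>the coset of \<open>z\<close>, described by the coordinates in \<open>J\<close>\<close>
  define C where "C z = {y \<in> Z. \<forall>j\<in>J. y j = z j}" for z
  have diff: "(\<lambda>i. x i - y i) \<in> Z" if "x \<in> Z" "y \<in> Z" for x y
    using add[OF that(1) smult[OF that(2), of "-1"]] by simp
  have CI: "z \<in> C z" if "z \<in> Z" for z using that by (simp add: C_def)
  have C_eq: "C y = C z \<longleftrightarrow> (\<forall>j\<in>J. y j = z j)" if "y \<in> Z" "z \<in> Z" for y z
  proof
    assume "C y = C z"
    then have "y \<in> C z" using CI[OF that(1)] by simp
    then show "\<forall>j\<in>J. y j = z j" by (simp add: C_def)
  qed (auto simp: C_def)
  have coset: "W +>\<^bsub>V\<^esub> z = C z" if z: "z \<in> Z" for z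
  proof (intro Set.set_eqI iffI)
    fix y assume "y \<in> W +>\<^bsub>V\<^esub> z"
    then show "y \<in> C z" using z add by (auto simp: a_r_coset_def' V_def W C_def)
  next
    fix y assume y: "y \<in> C z"
    then have "(\<lambda>i. y i - z i) \<in> W" using z diff by (auto simp: W C_def)
    then show "y \<in> W +>\<^bsub>V\<^esub> z"
      unfolding a_r_coset_def' V_def by (auto intro!: bexI[of _ "\<lambda>i. y i - z i"])
  qed
  have carrQ: "carrier Q = C ` Z"
    using coset by (auto simp: Q_def quotient_space_def A_RCOSETS_def' V_def)
  have zeroQ: "\<zero>\<^bsub>Q\<^esub> = C (\<lambda>i. 0)"
    by (simp add: Q_def quotient_space_def W C_def)
  have add_cosets: "A \<oplus>\<^bsub>Q\<^esub> B = (\<Union>y\<in>A. \<Union>z\<in>B. {\<lambda>i. y i + z i})" for A B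
    by (simp add: Q_def quotient_space_def set_add_def' V_def)
  have addQ: "C y \<oplus>\<^bsub>Q\<^esub> C z = C (\<lambda>i. y i + z i)" if y: "y \<in> Z" and z: "z \<in> Z" for y z
  proof (intro Set.set_eqI iffI)
    fix x assume "x \<in> C y \<oplus>\<^bsub>Q\<^esub> C z"
    then show "x \<in> C (\<lambda>i. y i + z i)" using add by (auto simp: add_cosets C_def)
  next
    fix x assume x: "x \<in> C (\<lambda>i. y i + z i)"
    then have "(\<lambda>i. x i - y i) \<in> C z" using y z diff by (auto simp: C_def)
    moreover have "x \<in> {\<lambda>i. y i + (x i - y i)}" by simp
    ultimately show "x \<in> C y \<oplus>\<^bsub>Q\<^esub> C z" using CI[OF y] unfolding add_cosets by blast
  qed
  have smultQ: "a \<odot>\<^bsub>Q\<^esub> C z = C (\<lambda>i. a * z i)" if z: "z \<in> Z" for a z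
  proof -
    have "W +>\<^bsub>V\<^esub> (a \<odot>\<^bsub>V\<^esub> x) = C (\<lambda>i. a * z i)" if "x \<in> C z" for x
    proof -
      have x: "x \<in> Z" "\<forall>j\<in>J. x j = z j" using that by (auto simp: C_def)
      have "W +>\<^bsub>V\<^esub> (a \<odot>\<^bsub>V\<^esub> x) = C (\<lambda>i. a * x i)"
        using coset[OF smult[OF x(1), of a]] by (simp add: V_def)
      also have "\<dots> = C (\<lambda>i. a * z i)" using x by (auto simp: C_def)
      finally show ?thesis .
    qed
    then have "(\<Union>x\<in>C z. W +>\<^bsub>V\<^esub> (a \<odot>\<^bsub>V\<^esub> x)) = C (\<lambda>i. a * z i)" using CI[OF z] by auto
    then show ?thesis by (simp add: Q_def quotient_space_def)
  qed
  have opsZ: "(\<lambda>i. - x i) \<in> Z" if "x \<in> Z" for x using smult[OF that, of "-1"] by simp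
  interpret Q: vectorspace "class_ring :: 'a ring" Q
  proof (rule vs_criteria)
    show "\<forall>v\<in>carrier Q. \<exists>w\<in>carrier Q. v \<oplus>\<^bsub>Q\<^esub> w = \<zero>\<^bsub>Q\<^esub>"
    proof
      fix v assume "v \<in> carrier Q"
      then obtain x where x: "x \<in> Z" "v = C x" by (auto simp: carrQ)
      then have "v \<oplus>\<^bsub>Q\<^esub> C (\<lambda>i. - x i) = \<zero>\<^bsub>Q\<^esub>" using addQ[OF x(1) opsZ[OF x(1)]] by (simp add: zeroQ)
      then show "\<exists>w\<in>carrier Q. v \<oplus>\<^bsub>Q\<^esub> w = \<zero>\<^bsub>Q\<^esub>" using opsZ[OF x(1)] by (auto simp: carrQ)
    qed
  qed (auto simp: class_field carrQ zeroQ addQ smultQ add smult zero algebra_simps)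
  define B where "B = (\<lambda>j. C (e j)) ` J"
  have inj: "inj_on (\<lambda>j. C (e j)) J"
  proof (rule inj_onI)
    fix i j assume ij: "i \<in> J" "j \<in> J" "C (e i) = C (e j)"
    then have "e i i = e j i" using C_eq[OF e(1) e(1)] by blast
    then show "i = j" using e(2) ij by (auto split: if_splits)
  qed
  have finB: "finite B" and cB: "card B = card J"
    using J card_image[OF inj] by (auto simp: B_def)
  have Bsub: "B \<subseteq> carrier Q" using e by (auto simp: B_def carrQ)
  have sumZ: "(\<lambda>i. \<Sum>j\<in>I. c j * e j i) \<in> Z" if "I \<subseteq> J" for I c
    using finite_subset[OF that J] that
  proof (induction I)
    case (insert j I)
    then show ?case using add[OF smult[OF e(1), of j "c j"], of "\<lambda>i. \<Sum>j\<in>I. c j * e j i"] by simp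
  qed (use zero in simp)
  have lin: "Q.lincomb a B = C (\<lambda>i. \<Sum>j\<in>J. a (C (e j)) * e j i)" for a
  proof -
    have "(\<Oplus>\<^bsub>Q\<^esub>v\<in>(\<lambda>j. C (e j)) ` I. a v \<odot>\<^bsub>Q\<^esub> v) = C (\<lambda>i. \<Sum>j\<in>I. a (C (e j)) * e j i)"
      if "I \<subseteq> J" for I
      using finite_subset[OF that J] that
    proof (induction I)
      case (insert j I)
      have nin: "C (e j) \<notin> (\<lambda>j. C (e j)) ` I" using inj insert by (auto simp: inj_on_def)
      have "(\<Oplus>\<^bsub>Q\<^esub>v\<in>(\<lambda>j. C (e j)) ` insert j I. a v \<odot>\<^bsub>Q\<^esub> v)
          = a (C (e j)) \<odot>\<^bsub>Q\<^esub> C (e j) \<oplus>\<^bsub>Q\<^esub> (\<Oplus>\<^bsub>Q\<^esub>v\<in>(\<lambda>j. C (e j)) ` I. a v \<odot>\<^bsub>Q\<^esub> v)"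
        unfolding image_insert
      proof (rule Q.finsum_insert)
        have sub: "(\<lambda>j. C (e j)) ` insert j I \<subseteq> carrier Q"
          using insert.prems Bsub by (auto simp: B_def)
        show "(\<lambda>v. a v \<odot>\<^bsub>Q\<^esub> v) \<in> (\<lambda>j. C (e j)) ` I \<rightarrow> carrier Q"
          using sub by (intro Pi_I Q.smult_closed) auto
        show "a (C (e j)) \<odot>\<^bsub>Q\<^esub> C (e j) \<in> carrier Q"
          using sub by (intro Q.smult_closed) auto
      qed (use insert nin in auto)
      also have "\<dots> = C (\<lambda>i. \<Sum>j\<in>insert j I. a (C (e j)) * e j i)"
        using insert e sumZ[of I "\<lambda>j. a (C (e j))"] by (simp add: smultQ addQ smult)
      finally show ?case .
    qed (simp add: zeroQ)
    then show ?thesis by (simp add: Q.lincomb_def B_def)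
  qed
  have coord: "(\<Sum>j\<in>J. c j * e j i) = c i" if "i \<in> J" for c i
    using that J e(2) by (simp add: of_bool_def if_distrib[of "\<lambda>x. _ * x"] sum.delta' cong: if_cong sum.cong)
  have "Q.basis B"
    unfolding Q.basis_criterion[OF finB Bsub]
  proof (intro allI impI)
    fix v assume "v \<in> carrier Q"
    then obtain z where z: "z \<in> Z" "v = C z" by (auto simp: carrQ)
    define b where "b = restrict (\<lambda>v. z (THE j. j \<in> J \<and> C (e j) = v)) B"
    have b: "b (C (e j)) = z j" if "j \<in> J" for j
    proof -
      have "(THE i. i \<in> J \<and> C (e i) = C (e j)) = j"
        using inj that by (auto simp: inj_on_def)
      then show ?thesis using that by (simp add: b_def B_def)
    qed
    have iff: "Q.lincomb a B = v \<longleftrightarrow> (\<forall>j\<in>J. a (C (e j)) = z j)" for a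
      unfolding lin z(2) C_eq[OF sumZ[OF order_refl, of "\<lambda>j. a (C (e j))"] z(1)]
      using coord[of _ "\<lambda>j. a (C (e j))"] by auto
    show "\<exists>!a. a \<in> B \<rightarrow>\<^sub>E carrier class_ring \<and> Q.lincomb a B = v"
    proof (rule ex1I[of _ b])
      show "b \<in> B \<rightarrow>\<^sub>E carrier class_ring \<and> Q.lincomb b B = v"
        using b by (auto simp: iff b_def)
      fix a assume a: "a \<in> B \<rightarrow>\<^sub>E carrier class_ring \<and> Q.lincomb a B = v"
      show "a = b"
      proof (rule PiE_ext[of _ B "\<lambda>_. UNIV"])
        show "a \<in> B \<rightarrow>\<^sub>E UNIV" "b \<in> B \<rightarrow>\<^sub>E UNIV" using a by (auto simp: b_def)
        show "a x = b x" if "x \<in> B" for x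
        proof -
          obtain j where "j \<in> J" "x = C (e j)" using \<open>x \<in> B\<close> by (auto simp: B_def)
          then show ?thesis using a b by (simp add: iff)
        qed
      qed
    qed
  qed
  from Q.dim_basis[OF finB this] show ?thesis
    by (simp add: cB Q_def V_def)
qed

text \<open>
  The Fredholm alternative, proved by elimination of the vectors \<open>b t\<close> one after the other.
\<close>

lemma in_span_or_separated:
  fixes b :: "'t \<Rightarrow> 's \<Rightarrow> 'a :: field"
  assumes F: "finite F" and T: "finite T"
  shows "(\<exists>c. \<forall>s\<in>F. z s = (\<Sum>t\<in>T. c t * b t s)) \<or>
    (\<exists>l. (\<forall>t\<in>T. (\<Sum>s\<in>F. l s * b t s) = 0) \<and> (\<Sum>s\<in>F. l s * z s) \<noteq> 0)"
  using T
proof (induction T arbitrary: z)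
  case empty
  show ?case
  proof (cases "\<forall>s\<in>F. z s = 0")
    case False
    then obtain s where s: "s \<in> F" "z s \<noteq> 0" by blast
    have "(\<Sum>t\<in>F. of_bool (t = s) * z t) = z s" using F s by simp
    then have "(\<Sum>t\<in>F. of_bool (t = s) * z t) \<noteq> 0" using s by simp
    then show ?thesis by (intro disjI2 exI[of _ "\<lambda>t. of_bool (t = s)"]) simp
  qed simp
next
  case (insert t T)
  consider (span) "\<exists>c. \<forall>s\<in>F. z s = (\<Sum>t\<in>T. c t * b t s)"
    | (sep) l where "\<forall>t\<in>T. (\<Sum>s\<in>F. l s * b t s) = 0" "(\<Sum>s\<in>F. l s * z s) \<noteq> 0"
    using insert.IH[of z] by blast
  then show ?case
  proof cases
    case span
    then obtain c where "\<forall>s\<in>F. z s = (\<Sum>t\<in>T. c t * b t s)" by blast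
    then show ?thesis
      using insert.hyps
      by (intro disjI1 exI[of _ "c(t := 0)"]) (auto intro!: sum.cong)
  next
    case sep
    define lt where "lt = (\<Sum>s\<in>F. l s * b t s)"
    define lz where "lz = (\<Sum>s\<in>F. l s * z s)"
    show ?thesis
    proof (cases "lt = 0")
      case True
      then show ?thesis using sep insert.hyps by (intro disjI2 exI[of _ l]) (auto simp: lt_def)
    next
      case False
      \<comment> \<open>project \<open>z\<close> along \<open>b t\<close> to the kernel of \<open>l\<close>, so that the induction hypothesis concerns \<open>T\<close> alone\<close>
      define z' where "z' s = z s - lz / lt * b t s" for s
      have lz': "(\<Sum>s\<in>F. l s * z' s) = 0"
      proof -
        have "(\<Sum>s\<in>F. l s * z' s) = (\<Sum>s\<in>F. l s * z s - lz / lt * (l s * b t s))"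
          by (simp add: z'_def algebra_simps)
        also have "\<dots> = lz - lz / lt * lt"
          unfolding sum_subtractf sum_distrib_left[symmetric] lt_def lz_def ..
        finally show ?thesis using False by simp
      qed
      consider (span') c where "\<forall>s\<in>F. z' s = (\<Sum>t\<in>T. c t * b t s)"
        | (sep') l' where "\<forall>t\<in>T. (\<Sum>s\<in>F. l' s * b t s) = 0" "(\<Sum>s\<in>F. l' s * z' s) \<noteq> 0"
        using insert.IH[of z'] by blast
      then show ?thesis
      proof cases
        case span'
        have "z s = (\<Sum>u\<in>insert t T. (c(t := lz / lt)) u * b u s)" if "s \<in> F" for s
        proof -
          have "(\<Sum>u\<in>T. (c(t := lz / lt)) u * b u s) = (\<Sum>u\<in>T. c u * b u s)"
            using insert.hyps by (intro sum.cong) auto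
          then show ?thesis using span' that insert.hyps by (simp add: z'_def algebra_simps)
        qed
        then show ?thesis by blast
      next
        case sep'
        \<comment> \<open>correct \<open>l'\<close> by a multiple of \<open>l\<close>, which vanishes on all \<open>b t\<close> with \<open>t \<in> T\<close>, so that it also vanishes on the new vector\<close>
        define r where "r = (\<Sum>s\<in>F. l' s * b t s) / lt"
        define l'' where "l'' s = l' s - r * l s" for s
        have ev: "(\<Sum>s\<in>F. l'' s * x s) = (\<Sum>s\<in>F. l' s * x s) - r * (\<Sum>s\<in>F. l s * x s)" for x
          by (simp add: l''_def left_diff_distrib sum_subtractf sum_distrib_left mult.assoc)
        have t0: "(\<Sum>s\<in>F. l'' s * b t s) = 0"
          unfolding ev using False by (simp add: r_def lt_def[symmetric])
        have "(\<Sum>s\<in>F. l'' s * z s) = (\<Sum>s\<in>F. l'' s * z' s) + lz / lt * (\<Sum>s\<in>F. l'' s * b t s)"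
          by (simp add: z'_def right_diff_distrib sum_subtractf sum_distrib_left mult.left_commute)
        also have "\<dots> = (\<Sum>s\<in>F. l' s * z' s)" unfolding t0 unfolding ev lz' by simp
        finally have "(\<Sum>s\<in>F. l'' s * z s) \<noteq> 0" using sep' by simp
        moreover have "\<forall>u\<in>insert t T. (\<Sum>s\<in>F. l'' s * b u s) = 0"
          using t0 sep sep' by (auto simp: ev)
        ultimately show ?thesis by blast
      qed
    qed
  qed
qed

lemma common_denominator:
  fixes f :: "'a \<Rightarrow> rat"
  assumes "finite A"
  shows "\<exists>D::int. D > 0 \<and> (\<forall>x\<in>A. of_int D * f x \<in> \<int>)"
  using assms
proof (induction A)
  case (insert a A)
  then obtain D :: int where D: "D > 0" "\<forall>x\<in>A. of_int D * f x \<in> \<int>" by blast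
  obtain p q where pq: "quotient_of (f a) = (p, q)" by (cases "quotient_of (f a)")
  have q: "q > 0" "f a = of_int p / of_int q"
    using quotient_of_denom_pos[OF pq] quotient_of_div[OF pq] by auto
  have "of_int (D * q) * f x \<in> \<int>" if "x \<in> insert a A" for x
  proof (cases "x = a")
    case True
    then have "of_int (D * q) * f x = of_int (D * p)" using q by simp
    then show ?thesis by (metis Ints_of_int)
  next
    case False
    then have "of_int D * f x \<in> \<int>" using D that by simp
    from Ints_mult[OF Ints_of_int[of q] this] show ?thesis by (simp only: of_int_mult mult_ac)
  qed
  then show ?case using D q by (intro exI[of _ "D * q"]) auto
qed (auto intro: exI[of _ 1])

section \<open>From mod 2 cocycles to the rational Betti number\<close>

text \<open>
  The coefficient of \<open>\<rho>\<close> in the boundary of \<open>\<sigma>\<close>, as an integer so that it can be reduced modulo \<open>2\<close>.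
\<close>

definition incidence :: "nat set \<Rightarrow> nat set \<Rightarrow> int" where
  "incidence \<rho> \<sigma> = (\<Sum>v\<in>\<sigma>. (-1) ^ card {u \<in> \<sigma>. u < v} * of_bool (\<rho> = \<sigma> - {v}))"

definition skeleton_with :: "nat \<Rightarrow> nat \<Rightarrow> nat set set \<Rightarrow> nat set set" where
  "skeleton_with d n T = {\<sigma>. \<sigma> \<subseteq> {1..n} \<and> \<sigma> \<noteq> {} \<and> card \<sigma> \<le> d} \<union> T"

lemma incidence_eq_0: "(\<And>v. v \<in> \<sigma> \<Longrightarrow> \<rho> \<noteq> \<sigma> - {v}) \<Longrightarrow> incidence \<rho> \<sigma> = 0"
  by (auto simp: incidence_def intro!: sum.neutral)

lemma incidence_not_subset: "\<not> \<rho> \<subseteq> \<sigma> \<Longrightarrow> incidence \<rho> \<sigma> = 0"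
  by (rule incidence_eq_0) auto

lemma incidence_remove:
  assumes "finite \<sigma>" "v \<in> \<sigma>"
  shows "incidence (\<sigma> - {v}) \<sigma> = (-1) ^ card {u \<in> \<sigma>. u < v}"
proof -
  have "incidence (\<sigma> - {v}) \<sigma> = (\<Sum>w\<in>\<sigma>. if v = w then (-1) ^ card {u \<in> \<sigma>. u < w} else 0)"
    unfolding incidence_def using assms by (intro sum.cong) auto
  then show ?thesis using assms by simp
qed

lemma odd_incidence_iff:
  assumes "\<sigma> \<in> faces n (Suc k)" "\<rho> \<in> faces n k"
  shows "odd (incidence \<rho> \<sigma>) \<longleftrightarrow> \<rho> \<subseteq> \<sigma>"
proof (cases "\<rho> \<subseteq> \<sigma>")
  case True
  have fin: "finite \<sigma>" "finite \<rho>" and c: "card \<sigma> = Suc k" "card \<rho> = k" using assms by (auto dest: facesD)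
  then have "card (\<sigma> - \<rho>) = 1" using True by (simp add: card_Diff_subset)
  then obtain v where "\<sigma> - \<rho> = {v}" by (rule card_1_singletonE)
  then have "\<rho> = \<sigma> - {v}" "v \<in> \<sigma>" using True by auto
  then show ?thesis using True incidence_remove[OF fin(1)] by simp
qed (simp add: incidence_not_subset)

lemma incidence_face:
  assumes "\<tau> \<in> faces n (Suc k)" "incidence \<sigma> \<tau> \<noteq> 0"
  shows "\<sigma> \<in> faces n k"
proof -
  obtain v where "v \<in> \<tau>" "\<sigma> = \<tau> - {v}" using incidence_eq_0 assms(2) by blast
  then show ?thesis using assms(1) facesD(3)[OF assms(1)] by (auto simp: faces_def)
qed

text \<open>
  Removing the vertices \<open>v\<close> and \<open>w\<close> in the two possible orders gives opposite signs.
\<close>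

lemma incidence_incidence:
  assumes \<tau>: "\<tau> \<in> faces n (Suc k)"
  shows "(\<Sum>\<sigma>\<in>faces n k. incidence \<rho> \<sigma> * incidence \<sigma> \<tau>) = 0"
proof -
  have fin: "finite \<tau>" using \<tau> by (rule facesD)
  define s where "s v A = ((-1) ^ card {u \<in> A. u < v} :: int)" for v :: nat and A
  define h where "h v w = (if v = w then 0 else s v \<tau> * s w (\<tau> - {v}) * of_bool (\<rho> = \<tau> - {v} - {w}))"
    for v w
  have face: "\<tau> - {v} \<in> faces n k" if "v \<in> \<tau>" for v
    using that \<tau> fin by (auto simp: faces_def)
  have "(\<Sum>\<sigma>\<in>faces n k. incidence \<rho> \<sigma> * incidence \<sigma> \<tau>)
      = (\<Sum>v\<in>\<tau>. \<Sum>\<sigma>\<in>faces n k. incidence \<rho> \<sigma> * (s v \<tau> * of_bool (\<sigma> = \<tau> - {v})))"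
    by (subst sum.swap) (simp add: incidence_def[of _ \<tau>] s_def sum_distrib_left)
  also have "\<dots> = (\<Sum>v\<in>\<tau>. incidence \<rho> (\<tau> - {v}) * s v \<tau>)"
  proof (rule sum.cong)
    fix v assume v: "v \<in> \<tau>"
    have "(\<Sum>\<sigma>\<in>faces n k. incidence \<rho> \<sigma> * (s v \<tau> * of_bool (\<sigma> = \<tau> - {v})))
        = (\<Sum>\<sigma>\<in>faces n k. if \<tau> - {v} = \<sigma> then incidence \<rho> \<sigma> * s v \<tau> else 0)"
      by (intro sum.cong) auto
    then show "(\<Sum>\<sigma>\<in>faces n k. incidence \<rho> \<sigma> * (s v \<tau> * of_bool (\<sigma> = \<tau> - {v})))
        = incidence \<rho> (\<tau> - {v}) * s v \<tau>"
      using face[OF v] by simp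
  qed simp
  also have "\<dots> = (\<Sum>v\<in>\<tau>. \<Sum>w\<in>\<tau>. h v w)"
  proof (rule sum.cong)
    fix v assume v: "v \<in> \<tau>"
    have "(\<Sum>w\<in>\<tau>. h v w) = (\<Sum>w\<in>\<tau> - {v}. h v w)"
      by (rule sum.mono_neutral_right) (use fin in \<open>auto simp: h_def\<close>)
    also have "\<dots> = incidence \<rho> (\<tau> - {v}) * s v \<tau>"
      unfolding incidence_def sum_distrib_right by (intro sum.cong) (auto simp: h_def s_def)
    finally show "incidence \<rho> (\<tau> - {v}) * s v \<tau> = (\<Sum>w\<in>\<tau>. h v w)" by simp
  qed simp
  finally have eq: "(\<Sum>\<sigma>\<in>faces n k. incidence \<rho> \<sigma> * incidence \<sigma> \<tau>) = (\<Sum>v\<in>\<tau>. \<Sum>w\<in>\<tau>. h v w)" .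
  \<comment> \<open>removing the smaller vertex shifts the position of the larger one by one, but not conversely\<close>
  have anti: "h w v = - h v w" if vw: "v \<in> \<tau>" "w \<in> \<tau>" "v < w" for v w
  proof -
    have "{u \<in> \<tau>. u < w} = insert v {u \<in> \<tau> - {v}. u < w}" using vw by auto
    then have "s w \<tau> = - s w (\<tau> - {v})" using fin by (simp add: s_def)
    moreover have "{u \<in> \<tau> - {w}. u < v} = {u \<in> \<tau>. u < v}" using vw by auto
    then have "s v (\<tau> - {w}) = s v \<tau>" by (simp add: s_def)
    moreover have "\<tau> - {w} - {v} = \<tau> - {v} - {w}" by auto
    ultimately show ?thesis using vw by (simp add: h_def mult_ac)
  qed
  have anti': "h w v = - h v w" if "v \<in> \<tau>" "w \<in> \<tau>" for v w
    using anti[of v w] anti[of w v] that by (cases v w rule: linorder_cases) (auto simp: h_def)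
  have "(\<Sum>v\<in>\<tau>. \<Sum>w\<in>\<tau>. h v w) = (\<Sum>v\<in>\<tau>. \<Sum>w\<in>\<tau>. h w v)" by (rule sum.swap)
  also have "\<dots> = (\<Sum>v\<in>\<tau>. \<Sum>w\<in>\<tau>. - h v w)"
    by (intro sum.cong refl anti')
  also have "\<dots> = - (\<Sum>v\<in>\<tau>. \<Sum>w\<in>\<tau>. h v w)" by (simp add: sum_negf)
  finally have "(\<Sum>v\<in>\<tau>. \<Sum>w\<in>\<tau>. h v w) = 0" by simp
  then show ?thesis using eq by simp
qed

text \<open>
  The descent step: modulo \<open>2\<close> the cocycle \<open>l\<close> is the coboundary of a set \<open>P\<close> plus a set \<open>J\<close> of isolated
  faces. Lifting both to integral cochains leaves twice an integral cocycle \<open>m\<close>. The coboundary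
  pairs to \<open>0\<close> with the cycle \<open>z\<close>, and so does \<open>J\<close>, on which \<open>z\<close> vanishes.
\<close>

lemma pairing_with_cycle_divisible:
  fixes z l :: "nat set \<Rightarrow> int"
  assumes d: "d \<ge> 1" and T: "T \<subseteq> faces n (Suc d)" and triv: "only_trivial_cocycles n d T"
    and cyc: "\<And>\<rho>. \<rho> \<in> faces n (d - 1) \<Longrightarrow> (\<Sum>\<sigma>\<in>faces n d. incidence \<rho> \<sigma> * z \<sigma>) = 0"
    and free: "\<And>\<sigma>. \<sigma> \<in> isolated_faces n d T \<Longrightarrow> z \<sigma> = 0"
    and coc: "\<And>\<tau>. \<tau> \<in> T \<Longrightarrow> (\<Sum>\<sigma>\<in>faces n d. l \<sigma> * incidence \<sigma> \<tau>) = 0"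
  shows "2 ^ N dvd (\<Sum>\<sigma>\<in>faces n d. l \<sigma> * z \<sigma>)"
  using coc
proof (induction N arbitrary: l)
  case (Suc N)
  define G where "G = {\<sigma> \<in> faces n d. odd (l \<sigma>)}"
  have sub: "G \<subseteq> faces n d" by (auto simp: G_def)
  have coc: "coboundary2 n (Suc d) G \<inter> T = {}"
  proof -
    have "even (card {\<sigma> \<in> G. \<sigma> \<subseteq> \<tau>})" if \<tau>: "\<tau> \<in> T" for \<tau>
    proof -
      have "{\<sigma> \<in> G. \<sigma> \<subseteq> \<tau>} = {\<sigma> \<in> faces n d. odd (l \<sigma> * incidence \<sigma> \<tau>)}"
        using odd_incidence_iff[of \<tau> n d] \<tau> T by (auto simp: G_def)
      then show ?thesis
        using Suc.prems[OF \<tau>] even_sum_iff[of "faces n d" "\<lambda>\<sigma>. l \<sigma> * incidence \<sigma> \<tau>"] by simp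
    qed
    then show ?thesis unfolding coboundary2_def by blast
  qed
  have "G \<in> trivial_cocycles n d T" using triv sub coc by (simp add: only_trivial_cocycles_def)
  then obtain P J where P: "P \<subseteq> faces n (d - 1)" and J: "J \<subseteq> isolated_faces n d T"
    and G: "G = sym_diff (coboundary2 n d P) J" by (rule trivial_cocyclesE)
  define p where "p \<sigma> = (\<Sum>\<rho>\<in>P. incidence \<rho> \<sigma>)" for \<sigma>
  have finP: "finite P" using P by (rule finite_subset_faces)
  have odd_p: "odd (p \<sigma>) \<longleftrightarrow> \<sigma> \<in> coboundary2 n d P" if \<sigma>: "\<sigma> \<in> faces n d" for \<sigma>
  proof -
    have "{\<rho> \<in> P. odd (incidence \<rho> \<sigma>)} = {\<rho> \<in> P. \<rho> \<subseteq> \<sigma>}"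
      using odd_incidence_iff[of \<sigma> n "d - 1"] \<sigma> P d by auto
    then show ?thesis using even_sum_iff[OF finP, of "\<lambda>\<rho>. incidence \<rho> \<sigma>"] \<sigma> by (simp add: p_def coboundary2_def)
  qed
  define m where "m \<sigma> = (l \<sigma> - p \<sigma> - of_bool (\<sigma> \<in> J)) div 2" for \<sigma>
  have l: "l \<sigma> = p \<sigma> + of_bool (\<sigma> \<in> J) + 2 * m \<sigma>" if \<sigma>: "\<sigma> \<in> faces n d" for \<sigma>
  proof -
    have "odd (l \<sigma>) \<longleftrightarrow> \<sigma> \<in> G" using \<sigma> by (simp add: G_def)
    then have "even (l \<sigma> - p \<sigma> - of_bool (\<sigma> \<in> J))" using odd_p[OF \<sigma>] G by auto
    then show ?thesis by (simp add: m_def)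
  qed
  have p_pair: "(\<Sum>\<sigma>\<in>faces n d. p \<sigma> * x \<sigma>) = (\<Sum>\<rho>\<in>P. \<Sum>\<sigma>\<in>faces n d. incidence \<rho> \<sigma> * x \<sigma>)" for x
    unfolding p_def sum_distrib_right by (rule sum.swap)
  have expand: "(\<Sum>\<sigma>\<in>faces n d. l \<sigma> * x \<sigma>) = (\<Sum>\<rho>\<in>P. \<Sum>\<sigma>\<in>faces n d. incidence \<rho> \<sigma> * x \<sigma>)
      + (\<Sum>\<sigma>\<in>faces n d. of_bool (\<sigma> \<in> J) * x \<sigma>) + 2 * (\<Sum>\<sigma>\<in>faces n d. m \<sigma> * x \<sigma>)" for x
  proof -
    have "(\<Sum>\<sigma>\<in>faces n d. l \<sigma> * x \<sigma>)
        = (\<Sum>\<sigma>\<in>faces n d. p \<sigma> * x \<sigma> + of_bool (\<sigma> \<in> J) * x \<sigma> + 2 * (m \<sigma> * x \<sigma>))"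
      by (intro sum.cong refl) (simp only: l algebra_simps)
    then show ?thesis by (simp only: sum.distrib sum_distrib_left p_pair)
  qed
  have "(\<Sum>\<sigma>\<in>faces n d. m \<sigma> * incidence \<sigma> \<tau>) = 0" if \<tau>: "\<tau> \<in> T" for \<tau>
  proof -
    have "(\<Sum>\<sigma>\<in>faces n d. of_bool (\<sigma> \<in> J) * incidence \<sigma> \<tau>) = 0"
      using J \<tau> by (intro sum.neutral) (auto simp: isolated_faces_def incidence_not_subset)
    moreover have "(\<Sum>\<sigma>\<in>faces n d. incidence \<rho> \<sigma> * incidence \<sigma> \<tau>) = 0" for \<rho>
      using incidence_incidence T \<tau> by blast
    ultimately show ?thesis using expand[of "\<lambda>\<sigma>. incidence \<sigma> \<tau>"] Suc.prems[OF \<tau>] by simp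
  qed
  then have "2 ^ N dvd (\<Sum>\<sigma>\<in>faces n d. m \<sigma> * z \<sigma>)" by (rule Suc.IH)
  moreover have "(\<Sum>\<sigma>\<in>faces n d. l \<sigma> * z \<sigma>) = 2 * (\<Sum>\<sigma>\<in>faces n d. m \<sigma> * z \<sigma>)"
  proof -
    have "(\<Sum>\<sigma>\<in>faces n d. of_bool (\<sigma> \<in> J) * z \<sigma>) = 0"
      using J free by (intro sum.neutral) auto
    moreover have "(\<Sum>\<rho>\<in>P. \<Sum>\<sigma>\<in>faces n d. incidence \<rho> \<sigma> * z \<sigma>) = 0"
      using P cyc by (intro sum.neutral) auto
    ultimately show ?thesis using expand[of z] by simp
  qed
  ultimately show ?case by simp
qed simp

text \<open>
  After clearing denominators the pairing is an integer divisible by every power of \<open>2\<close>.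
\<close>

lemma pairing_with_cycle_eq_0:
  fixes z l :: "nat set \<Rightarrow> rat"
  assumes d: "d \<ge> 1" and T: "T \<subseteq> faces n (Suc d)" and triv: "only_trivial_cocycles n d T"
    and cyc: "\<And>\<rho>. \<rho> \<in> faces n (d - 1) \<Longrightarrow> (\<Sum>\<sigma>\<in>faces n d. of_int (incidence \<rho> \<sigma>) * z \<sigma>) = 0"
    and free: "\<And>\<sigma>. \<sigma> \<in> isolated_faces n d T \<Longrightarrow> z \<sigma> = 0"
    and coc: "\<And>\<tau>. \<tau> \<in> T \<Longrightarrow> (\<Sum>\<sigma>\<in>faces n d. l \<sigma> * of_int (incidence \<sigma> \<tau>)) = 0"
  shows "(\<Sum>\<sigma>\<in>faces n d. l \<sigma> * z \<sigma>) = 0"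
proof -
  obtain D :: int where D: "D > 0" "\<forall>\<sigma>\<in>faces n d. of_int D * z \<sigma> \<in> \<int>"
    using common_denominator[OF finite_faces, of n d z] by blast
  obtain E :: int where E: "E > 0" "\<forall>\<sigma>\<in>faces n d. of_int E * l \<sigma> \<in> \<int>"
    using common_denominator[OF finite_faces, of n d l] by blast
  define z' where "z' \<sigma> = \<lfloor>of_int D * z \<sigma>\<rfloor>" for \<sigma>
  define l' where "l' \<sigma> = \<lfloor>of_int E * l \<sigma>\<rfloor>" for \<sigma>
  have z': "of_int (z' \<sigma>) = of_int D * z \<sigma>" if "\<sigma> \<in> faces n d" for \<sigma>
    using D(2) that unfolding z'_def by (metis Ints_cases floor_of_int)
  have l': "of_int (l' \<sigma>) = of_int E * l \<sigma>" if "\<sigma> \<in> faces n d" for \<sigma>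
    using E(2) that unfolding l'_def by (metis Ints_cases floor_of_int)
  have zc: "(\<Sum>\<sigma>\<in>faces n d. incidence \<rho> \<sigma> * z' \<sigma>) = 0" if "\<rho> \<in> faces n (d - 1)" for \<rho>
  proof -
    have "rat_of_int (\<Sum>\<sigma>\<in>faces n d. incidence \<rho> \<sigma> * z' \<sigma>)
        = (\<Sum>\<sigma>\<in>faces n d. of_int D * (of_int (incidence \<rho> \<sigma>) * z \<sigma>))"
      unfolding of_int_sum of_int_mult by (intro sum.cong) (simp_all add: z')
    also have "\<dots> = 0" unfolding sum_distrib_left[symmetric] cyc[OF that] by simp
    finally show ?thesis by (simp only: of_int_eq_0_iff)
  qed
  have lc: "(\<Sum>\<sigma>\<in>faces n d. l' \<sigma> * incidence \<sigma> \<tau>) = 0" if "\<tau> \<in> T" for \<tau>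
  proof -
    have "rat_of_int (\<Sum>\<sigma>\<in>faces n d. l' \<sigma> * incidence \<sigma> \<tau>)
        = (\<Sum>\<sigma>\<in>faces n d. of_int E * (l \<sigma> * of_int (incidence \<sigma> \<tau>)))"
      unfolding of_int_sum of_int_mult by (intro sum.cong) (simp_all add: l')
    also have "\<dots> = 0" unfolding sum_distrib_left[symmetric] coc[OF that] by simp
    finally show ?thesis by (simp only: of_int_eq_0_iff)
  qed
  define x where "x = (\<Sum>\<sigma>\<in>faces n d. l' \<sigma> * z' \<sigma>)"
  have dvd: "2 ^ N dvd x" for N
    unfolding x_def using d T triv zc lc
    by (intro pairing_with_cycle_divisible) (auto simp: free z'_def)
  have "x = 0"
  proof (rule ccontr)
    assume "x \<noteq> 0"
    then have "\<bar>2 ^ nat \<bar>x\<bar>\<bar> \<le> \<bar>x\<bar>" using dvd by (intro dvd_imp_le_int)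
    moreover have "int (nat \<bar>x\<bar>) < 2 ^ nat \<bar>x\<bar>" by (rule of_nat_less_two_power)
    ultimately show False by simp
  qed
  moreover have "rat_of_int x = of_int E * of_int D * (\<Sum>\<sigma>\<in>faces n d. l \<sigma> * z \<sigma>)"
    unfolding x_def of_int_sum of_int_mult sum_distrib_left
    by (intro sum.cong) (simp_all add: z' l')
  ultimately show ?thesis using D E by simp
qed

lemma chains_skeleton_with:
  assumes d: "d \<ge> 1" and T: "T \<subseteq> faces n (Suc d)"
  shows "chains (d - 1) (skeleton_with d n T) = {f. \<forall>\<sigma>. f \<sigma> \<noteq> 0 \<longrightarrow> \<sigma> \<in> faces n d}"
    and "chains d (skeleton_with d n T) = {f. \<forall>\<sigma>. f \<sigma> \<noteq> 0 \<longrightarrow> \<sigma> \<in> T}"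
proof -
  have "{\<sigma> \<in> skeleton_with d n T. card \<sigma> = d - 1 + 1} = faces n d"
    using T d by (auto simp: skeleton_with_def faces_def)
  moreover have "{\<sigma> \<in> skeleton_with d n T. card \<sigma> = d + 1} = T"
    using T by (auto simp: skeleton_with_def faces_def)
  moreover have "{f :: nat set \<Rightarrow> rat. finite {\<sigma>. f \<sigma> \<noteq> 0} \<and> {\<sigma>. f \<sigma> \<noteq> 0} \<subseteq> F} = {f. \<forall>\<sigma>. f \<sigma> \<noteq> 0 \<longrightarrow> \<sigma> \<in> F}"
    if "finite F" for F
    using that by (auto intro: finite_subset)
  ultimately show "chains (d - 1) (skeleton_with d n T) = {f. \<forall>\<sigma>. f \<sigma> \<noteq> 0 \<longrightarrow> \<sigma> \<in> faces n d}"
    and "chains d (skeleton_with d n T) = {f. \<forall>\<sigma>. f \<sigma> \<noteq> 0 \<longrightarrow> \<sigma> \<in> T}"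
    using finite_subset_faces[OF T] unfolding chains_def by simp_all
qed

lemma boundary_eq:
  assumes k: "k \<noteq> 0" and A: "finite A" "\<And>\<sigma>. f \<sigma> \<noteq> 0 \<Longrightarrow> \<sigma> \<in> A"
  shows "boundary k f \<rho> = (\<Sum>\<sigma>\<in>A. of_int (incidence \<rho> \<sigma>) * f \<sigma>)"
proof -
  have "boundary k f \<rho> = (\<Sum>\<sigma> | f \<sigma> \<noteq> 0. of_int (incidence \<rho> \<sigma>) * f \<sigma>)"
  proof -
    have "of_int (incidence \<rho> \<sigma>) =
        (\<Sum>v\<in>\<sigma>. (-1) ^ card {u \<in> \<sigma>. u < v} * of_bool (\<rho> = \<sigma> - {v}) :: rat)" for \<sigma>
      by (simp add: incidence_def)
    then show ?thesis using k by (simp add: boundary_def mult.commute)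
  qed
  also have "\<dots> = (\<Sum>\<sigma>\<in>A. of_int (incidence \<rho> \<sigma>) * f \<sigma>)"
    using A by (intro sum.mono_neutral_left) auto
  finally show ?thesis .
qed

text \<open>
  Each of the other members of \<open>J\<close> lies in at most one coface of \<open>\<sigma>\<close>, and \<open>\<sigma>\<close> has \<open>n - d\<close> cofaces.
\<close>

lemma private_coface:
  assumes \<sigma>: "\<sigma> \<in> J" and J: "J \<subseteq> faces n d" and card: "card J \<le> n - d"
  obtains \<tau> where "\<tau> \<in> faces n (Suc d)" "\<sigma> \<subseteq> \<tau>" "\<And>\<sigma>'. \<sigma>' \<in> J \<Longrightarrow> \<sigma>' \<subseteq> \<tau> \<Longrightarrow> \<sigma>' = \<sigma>"
proof -
  have finJ: "finite J" using J by (rule finite_subset_faces)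
  have s: "\<sigma> \<in> faces n d" using \<sigma> J by auto
  note s' = facesD[OF s]
  have "card ((\<lambda>\<sigma>'. THE v. v \<in> \<sigma>' - \<sigma>) ` (J - {\<sigma>})) \<le> card (J - {\<sigma>})"
    using finJ by (intro card_image_le) auto
  also have "\<dots> < card J" using \<sigma> finJ by (rule card_Diff1_less[rotated])
  also have "\<dots> \<le> card ({1..n} - \<sigma>)" using card s' by (simp add: card_Diff_subset)
  finally have "\<not> {1..n} - \<sigma> \<subseteq> (\<lambda>\<sigma>'. THE v. v \<in> \<sigma>' - \<sigma>) ` (J - {\<sigma>})"
    using finJ by (meson card_mono finite_Diff finite_imageI leD)
  then obtain v where v: "v \<in> {1..n} - \<sigma>" "v \<notin> (\<lambda>\<sigma>'. THE v. v \<in> \<sigma>' - \<sigma>) ` (J - {\<sigma>})" by blast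
  have "\<sigma>' = \<sigma>" if \<sigma>': "\<sigma>' \<in> J" "\<sigma>' \<subseteq> insert v \<sigma>" for \<sigma>'
  proof (rule ccontr)
    assume "\<sigma>' \<noteq> \<sigma>"
    have f: "\<sigma>' \<in> faces n d" using \<sigma>' J by auto
    have "\<not> \<sigma>' \<subseteq> \<sigma>"
      using card_subset_eq[OF s'(3), of \<sigma>'] facesD(2)[OF f] s' \<open>\<sigma>' \<noteq> \<sigma>\<close> by auto
    then have "\<sigma>' - \<sigma> = {v}" using \<sigma>' by auto
    then have "(THE v. v \<in> \<sigma>' - \<sigma>) = v" by auto
    then show False using v(2) \<sigma>'(1) \<open>\<sigma>' \<noteq> \<sigma>\<close> by blast
  qed
  moreover have "insert v \<sigma> \<in> faces n (Suc d)" using s' v by (auto simp: faces_def)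
  ultimately show ?thesis using that[of "insert v \<sigma>"] by blast
qed

lemma boundary_sq_incidence:
  assumes T: "T \<subseteq> faces n (Suc d)"
  shows "(\<Sum>\<sigma>\<in>faces n d. of_int (incidence \<rho> \<sigma>) * (\<Sum>\<tau>\<in>T. of_int (incidence \<sigma> \<tau>) * f \<tau>)) = (0::rat)"
proof -
  have "(\<Sum>\<sigma>\<in>faces n d. of_int (incidence \<rho> \<sigma>) * (\<Sum>\<tau>\<in>T. of_int (incidence \<sigma> \<tau>) * f \<tau>))
      = (\<Sum>\<tau>\<in>T. of_int (\<Sum>\<sigma>\<in>faces n d. incidence \<rho> \<sigma> * incidence \<sigma> \<tau>) * f \<tau>)"
    unfolding of_int_sum of_int_mult sum_distrib_left sum_distrib_right mult.assoc by (rule sum.swap)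
  also have "\<dots> = 0"
  proof (rule sum.neutral, rule ballI)
    fix \<tau> assume "\<tau> \<in> T"
    then have "\<tau> \<in> faces n (Suc d)" using T by auto
    from incidence_incidence[OF this] show "of_int (\<Sum>\<sigma>\<in>faces n d. incidence \<rho> \<sigma> * incidence \<sigma> \<tau>) * f \<tau> = 0"
      by (metis mult_zero_left of_int_0)
  qed
  finally show ?thesis .
qed

text \<open>
  A boundary vanishes on the isolated faces, since these lie in no \<open>d\<close>-face of the complex. Conversely a
  cycle that does is a boundary: no functional separates it from the boundaries, because such a
  functional would be a cocycle. The cycles with prescribed coefficients at the isolated faces are
  combinations of boundaries of private cofaces; these \<open>d\<close>-faces do not belong to the complex, but
  their boundaries are cycles of its complete \<open>(d - 1)\<close>-skeleton.
\<close>

lemma betti_eq_card_isolated_faces: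
  assumes d: "d \<ge> 2" and T: "T \<subseteq> faces n (Suc d)" and triv: "only_trivial_cocycles n d T"
    and few: "card (isolated_faces n d T) \<le> n - d"
  shows "betti (d - 1) (skeleton_with d n T) = card (isolated_faces n d T)"
proof -
  define Y where "Y = skeleton_with d n T"
  define Z where "Z = cycles (d - 1) Y"
  define J where "J = isolated_faces n d T"
  have d1: "d \<ge> 1" "d - 1 \<noteq> 0" "d \<noteq> 0" "d - 1 + 1 = d" using d by auto
  have finT: "finite T" using T by (rule finite_subset_faces)
  have J: "J \<subseteq> faces n d" "finite J"
    using isolated_faces_subset finite_subset_faces[OF isolated_faces_subset] unfolding J_def by auto
  have Z: "z \<in> Z \<longleftrightarrow> (\<forall>\<sigma>. z \<sigma> \<noteq> 0 \<longrightarrow> \<sigma> \<in> faces n d) \<and>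
      (\<forall>\<rho>. (\<Sum>\<sigma>\<in>faces n d. of_int (incidence \<rho> \<sigma>) * z \<sigma>) = 0)" for z
  proof -
    have "boundary (d - 1) z \<rho> = (\<Sum>\<sigma>\<in>faces n d. of_int (incidence \<rho> \<sigma>) * z \<sigma>)"
      if "\<forall>\<sigma>. z \<sigma> \<noteq> 0 \<longrightarrow> \<sigma> \<in> faces n d" for \<rho>
      using that by (intro boundary_eq d1) auto
    then show ?thesis
      unfolding Z_def Y_def cycles_def chains_skeleton_with(1)[OF d1(1) T] by (auto simp: fun_eq_iff)
  qed
  have bd: "boundary d f \<sigma> = (\<Sum>\<tau>\<in>T. of_int (incidence \<sigma> \<tau>) * f \<tau>)"
    if "\<forall>\<tau>. f \<tau> \<noteq> 0 \<longrightarrow> \<tau> \<in> T" for f \<sigma>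
    using that finT by (intro boundary_eq d1) auto
  have inc_free: "incidence \<sigma> \<tau> = 0" if "\<sigma> \<in> J" "\<tau> \<in> T" for \<sigma> \<tau>
    using that by (intro incidence_not_subset) (auto simp: J_def isolated_faces_def)
  have W: "boundaries (d - 1) Y = {z \<in> Z. \<forall>\<sigma>\<in>J. z \<sigma> = 0}"
  proof (intro Set.set_eqI iffI)
    fix z assume "z \<in> boundaries (d - 1) Y"
    then obtain f where f: "\<forall>\<tau>. f \<tau> \<noteq> 0 \<longrightarrow> \<tau> \<in> T" "z = boundary d f"
      unfolding boundaries_def d1(4) Y_def chains_skeleton_with(2)[OF d1(1) T] by auto
    have z: "z \<sigma> = (\<Sum>\<tau>\<in>T. of_int (incidence \<sigma> \<tau>) * f \<tau>)" for \<sigma>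
      unfolding f(2) by (rule bd[OF f(1)])
    have "\<sigma> \<in> faces n d" if "z \<sigma> \<noteq> 0" for \<sigma>
    proof -
      have "\<exists>\<tau>\<in>T. incidence \<sigma> \<tau> \<noteq> 0"
        using that unfolding z by (rule contrapos_np) simp
      then obtain \<tau> where "\<tau> \<in> T" "incidence \<sigma> \<tau> \<noteq> 0" by blast
      then show ?thesis using incidence_face T by blast
    qed
    moreover have "(\<Sum>\<sigma>\<in>faces n d. of_int (incidence \<rho> \<sigma>) * z \<sigma>) = 0" for \<rho>
      unfolding z by (rule boundary_sq_incidence[OF T])
    moreover have "z \<sigma> = 0" if "\<sigma> \<in> J" for \<sigma>
      unfolding z using inc_free that by simp
    ultimately show "z \<in> {z \<in> Z. \<forall>\<sigma>\<in>J. z \<sigma> = 0}" by (simp add: Z)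
  next
    fix z assume "z \<in> {z \<in> Z. \<forall>\<sigma>\<in>J. z \<sigma> = 0}"
    then have z: "\<forall>\<sigma>. z \<sigma> \<noteq> 0 \<longrightarrow> \<sigma> \<in> faces n d"
      "\<And>\<rho>. (\<Sum>\<sigma>\<in>faces n d. of_int (incidence \<rho> \<sigma>) * z \<sigma>) = 0"
      "\<And>\<sigma>. \<sigma> \<in> J \<Longrightarrow> z \<sigma> = 0" by (auto simp: Z)
    have "(\<Sum>\<sigma>\<in>faces n d. l \<sigma> * z \<sigma>) = 0"
      if "\<forall>\<tau>\<in>T. (\<Sum>\<sigma>\<in>faces n d. l \<sigma> * of_int (incidence \<sigma> \<tau>)) = 0" for l
    proof (rule pairing_with_cycle_eq_0[OF d1(1) T triv])
      show "z \<sigma> = 0" if "\<sigma> \<in> isolated_faces n d T" for \<sigma> using z(3) that by (simp only: J_def)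
    qed (rule z(2), use that in blast)
    then obtain c where c: "\<forall>\<sigma>\<in>faces n d. z \<sigma> = (\<Sum>\<tau>\<in>T. c \<tau> * of_int (incidence \<sigma> \<tau>))"
      using in_span_or_separated[OF finite_faces finT, where z = z and b = "\<lambda>\<tau> \<sigma>. of_int (incidence \<sigma> \<tau>)"]
      by blast
    define f where "f \<tau> = (if \<tau> \<in> T then c \<tau> else 0)" for \<tau>
    have f: "\<forall>\<tau>. f \<tau> \<noteq> 0 \<longrightarrow> \<tau> \<in> T" by (simp add: f_def)
    have "z \<sigma> = boundary d f \<sigma>" for \<sigma>
    proof (cases "\<sigma> \<in> faces n d")
      case True
      then have "z \<sigma> = (\<Sum>\<tau>\<in>T. of_int (incidence \<sigma> \<tau>) * f \<tau>)"
        using c by (simp add: f_def mult.commute cong: sum.cong)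
      then show ?thesis by (simp only: bd[OF f])
    next
      case False
      then have "incidence \<sigma> \<tau> = 0" if "\<tau> \<in> T" for \<tau> using incidence_face that T by blast
      then have "boundary d f \<sigma> = 0" unfolding bd[OF f] by simp
      then show ?thesis using z(1) False by auto
    qed
    then show "z \<in> boundaries (d - 1) Y"
      unfolding boundaries_def d1(4) Y_def chains_skeleton_with(2)[OF d1(1) T] using f by blast
  qed
  have "\<exists>e\<in>Z. \<forall>i\<in>J. e i = of_bool (i = \<sigma>)" if \<sigma>: "\<sigma> \<in> J" for \<sigma>
  proof -
    obtain \<tau> where \<tau>: "\<tau> \<in> faces n (Suc d)" "\<sigma> \<subseteq> \<tau>" "\<And>i. i \<in> J \<Longrightarrow> i \<subseteq> \<tau> \<Longrightarrow> i = \<sigma>"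
      using private_coface[OF \<sigma> J(1)] few unfolding J_def by blast
    \<comment> \<open>the boundary of \<open>\<tau>\<close>, with the sign that makes the coefficient at \<open>\<sigma>\<close> equal to \<open>1\<close>\<close>
    define e :: "nat set \<Rightarrow> rat"
      where "e i = (\<Sum>\<tau>\<in>{\<tau>}. of_int (incidence i \<tau>) * of_int (incidence \<sigma> \<tau>))" for i
    have sgn: "incidence \<sigma> \<tau> * incidence \<sigma> \<tau> = 1"
    proof -
      have "\<sigma> \<in> faces n d" using \<sigma> J by blast
      note fin = facesD(3)[OF \<tau>(1)] and s = facesD(2,3)[OF this]
      then have "card (\<tau> - \<sigma>) = 1" using \<tau>(2) facesD(2)[OF \<tau>(1)] by (simp add: card_Diff_subset)
      then obtain v where "\<tau> - \<sigma> = {v}" by (rule card_1_singletonE)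
      then have "\<sigma> = \<tau> - {v}" "v \<in> \<tau>" using \<tau>(2) by auto
      then show ?thesis using incidence_remove[OF fin] by (simp add: power_mult_distrib[symmetric])
    qed
    have "e \<in> Z"
    proof -
      have "i \<in> faces n d" if "e i \<noteq> 0" for i
        using that incidence_face[OF \<tau>(1), of i] by (auto simp: e_def)
      moreover have "(\<Sum>\<sigma>\<in>faces n d. of_int (incidence \<rho> \<sigma>) * e \<sigma>) = 0" for \<rho>
        unfolding e_def by (rule boundary_sq_incidence) (use \<tau> in simp)
      ultimately show ?thesis by (simp add: Z)
    qed
    moreover have "e i = of_bool (i = \<sigma>)" if "i \<in> J" for i
    proof (cases "i = \<sigma>")
      case True
      have "e i = of_int (incidence \<sigma> \<tau> * incidence \<sigma> \<tau>)" using True by (simp add: e_def)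
      then show ?thesis using True sgn by simp
    next
      case False
      then have "incidence i \<tau> = 0" using \<tau>(3)[OF that] by (intro incidence_not_subset) auto
      then show ?thesis using False by (simp add: e_def)
    qed
    ultimately show ?thesis by blast
  qed
  then obtain e where e: "\<And>j. j \<in> J \<Longrightarrow> e j \<in> Z" "\<And>i j. i \<in> J \<Longrightarrow> j \<in> J \<Longrightarrow> e j i = of_bool (i = j)"
    by metis
  have "vectorspace.dim (class_ring :: rat ring) (quotient_space (cycle_space (d - 1) Y) (boundaries (d - 1) Y)) = card J"
    unfolding cycle_space_def Z_def[symmetric]
  proof (rule dim_quotient_by_coordinates[OF _ _ _ W J(2) e])
    show "(\<lambda>i. 0) \<in> Z" by (simp add: Z)
    show "(\<lambda>i. x i + y i) \<in> Z" if "x \<in> Z" "y \<in> Z" for x y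
    proof -
      have "(\<forall>\<sigma>. x \<sigma> + y \<sigma> \<noteq> 0 \<longrightarrow> \<sigma> \<in> faces n d)"
        using that unfolding Z by (metis add.right_neutral)
      then show ?thesis using that by (simp add: Z distrib_left sum.distrib)
    qed
    show "(\<lambda>i. a * x i) \<in> Z" if "x \<in> Z" for a x
    proof -
      have "(\<Sum>\<sigma>\<in>faces n d. of_int (incidence \<rho> \<sigma>) * (a * x \<sigma>)) = 0" for \<rho>
        using that unfolding Z mult.left_commute[of _ a] sum_distrib_left[symmetric] by simp
      then show ?thesis using that by (simp add: Z)
    qed
  qed
  then show ?thesis unfolding betti_def homology_def Y_def J_def .
qed

section \<open>First moment estimates\<close>

lemma power_le_fact_exp: "real u ^ u \<le> fact u * exp (real u)"
proof -
  have "(\<Sum>k\<in>{u}. real u ^ k /\<^sub>R fact k) \<le> (\<Sum>k. real u ^ k /\<^sub>R fact k)"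
    by (intro sum_le_suminf summable_exp_generic) auto
  then show ?thesis by (simp add: exp_def field_simps)
qed

lemma binomial_le_pow_real: "real (n choose k) \<le> real n ^ k"
proof -
  have "(n choose k) * 1 \<le> (n choose k) * fact k" by (intro mult_left_mono) auto
  also have "\<dots> \<le> n ^ k" by (rule binomial_fact_pow)
  finally show ?thesis by (metis mult.right_neutral of_nat_le_iff of_nat_power)
qed

lemma binomial_le_exp:
  assumes N: "real N \<le> exp x" and u: "u > 0"
  shows "real (N choose u) \<le> exp (x * real u + real u - real u * ln (real u))"
proof -
  have "real (N choose u) * fact u \<le> real N ^ u"
    using binomial_fact_pow[of N u] by (metis of_nat_fact of_nat_le_iff of_nat_mult of_nat_power)
  also have "\<dots> \<le> exp x ^ u" using N by (intro power_mono) auto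
  also have "\<dots> = exp (x * real u)" by (simp add: exp_of_nat_mult[symmetric] mult.commute)
  finally have 1: "real (N choose u) * fact u \<le> exp (x * real u)" .
  have "real (N choose u) * exp (real u * ln (real u)) = real (N choose u) * real u ^ u"
    using u by (simp add: exp_of_nat_mult)
  also have "\<dots> \<le> real (N choose u) * (fact u * exp (real u))"
    using power_le_fact_exp by (rule mult_left_mono) simp
  also have "\<dots> = (real (N choose u) * fact u) * exp (real u)" by (simp only: mult.assoc)
  also have "\<dots> \<le> exp (x * real u) * exp (real u)" using 1 by (rule mult_right_mono) simp
  also have "\<dots> = exp (x * real u + real u)" by (simp add: exp_add)
  finally have "real (N choose u) * exp (real u * ln (real u)) \<le> exp (x * real u + real u)" .
  then show ?thesis by (simp add: exp_diff field_simps)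
qed

lemma one_minus_power_le_exp:
  fixes p b :: real
  assumes p: "0 \<le> p" "p \<le> 1" and b: "b \<le> real k"
  shows "(1 - p) ^ k \<le> exp (- p * b)"
proof -
  have "(1 - p) ^ k \<le> exp (- p) ^ k"
    using p exp_ge_add_one_self[of "- p"] by (intro power_mono) auto
  also have "\<dots> = exp (- p * real k)" by (simp add: exp_of_nat_mult[symmetric] mult.commute)
  also have "\<dots> \<le> exp (- p * b)" using p b by (simp add: mult_left_mono)
  finally show ?thesis .
qed

text \<open>
  The contribution of the sets with \<open>u\<close> undominated faces. If \<open>u \<le> \<kappa> m\<close>, the number of choices of these
  faces is at most \<open>n^(d \<kappa> m)\<close>, which the probability \<open>n^(- 2 d \<kappa> m)\<close> from the expansion outweighs. If
  \<open>u > \<kappa> m\<close>, the \<open>n^(d u)\<close> ordered choices and the probability \<open>n^(- d u)\<close> balance up to the small error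
  \<open>n^(d \<epsilon> m)\<close>, and the gain is the factor \<open>1 / u!\<close>, which as \<open>m\<close> is at least \<open>sqrt n\<close> is at most
  \<open>n^(- \<kappa> m / 2)\<close> up to a factor exponential in \<open>m\<close>.
\<close>

lemma undominated_term_bound:
  fixes x p C \<epsilon> \<kappa> :: real
  assumes d: "d \<ge> 1" and n: "n \<ge> 1" and m: "m \<ge> 1" "n \<le> m ^ 2" and u: "u \<le> m"
    and x: "x = real d * ln (real n)" and p: "0 \<le> p" "p * real d \<le> 1"
    and L: "\<bar>p * real n - x\<bar> \<le> C"
    and \<kappa>: "\<kappa> = 1 / (2 * (real d + 1))" and \<epsilon>: "\<epsilon> = \<kappa> / (4 * real d)"
    and K: "real K \<le> \<epsilon> * real n"
    and N: "real N \<le> real n ^ d"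
  shows "real (N choose u) * exp (- p * max (real u * (real n - real d) - real K * real m) (real n * real m / (real d + 1)))
      \<le> exp (real m * (2 * C + 3 - \<kappa> / 4 * ln (real n)))"
proof -
  define b where "b = max (real u * (real n - real d) - real K * real m) (real n * real m / (real d + 1))"
  have kpos: "\<kappa> > 0" "\<kappa> \<le> 1 / 4" using d by (auto simp: \<kappa> field_simps)
  have epos: "\<epsilon> > 0" "\<epsilon> \<le> 1" "\<epsilon> * real d = \<kappa> / 4"
    using kpos d by (auto simp: \<epsilon> field_simps)
  have C: "C \<ge> 0" using L by linarith
  have lnn: "ln (real n) \<ge> 0" using n by simp
  have xpos: "x \<ge> 0" "x \<ge> ln (real n)"
  proof -
    show "x \<ge> 0" using lnn d by (simp add: x)
    have "1 * ln (real n) \<le> real d * ln (real n)" using lnn d by (intro mult_right_mono) auto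
    then show "x \<ge> ln (real n)" by (simp add: x)
  qed
  have N': "real N \<le> exp x"
    using N n by (simp add: x exp_of_nat_mult)
  have b: "b \<ge> real u * (real n - real d) - real K * real m" "b \<ge> real n * real m / (real d + 1)"
    by (simp_all add: b_def)
  show ?thesis
  proof (cases "real u \<le> \<kappa> * real m")
    case True
    have "real (N choose u) \<le> exp x ^ u"
      using N' by (intro order_trans[OF binomial_le_pow_real power_mono]) auto
    also have "\<dots> = exp (x * real u)" by (simp add: exp_of_nat_mult[symmetric] mult.commute)
    also have "\<dots> \<le> exp (x * (\<kappa> * real m))" using True xpos by (simp add: mult_left_mono)
    finally have 1: "real (N choose u) \<le> exp (x * (\<kappa> * real m))" .
    have "p * (real n * real m / (real d + 1)) \<le> p * b" using b p by (intro mult_left_mono)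
    moreover have "p * (real n * real m / (real d + 1)) = 2 * \<kappa> * real m * (p * real n)"
    proof -
      have "2 * \<kappa> = 1 / (real d + 1)" by (simp add: \<kappa> divide_simps)
      then show ?thesis by simp
    qed
    moreover have "2 * \<kappa> * real m * (x - C) \<le> 2 * \<kappa> * real m * (p * real n)"
      using L kpos by (intro mult_left_mono) auto
    ultimately have "exp (- p * b) \<le> exp (- (2 * \<kappa> * real m * (x - C)))" by simp
    with 1 have "real (N choose u) * exp (- p * b) \<le> exp (x * (\<kappa> * real m)) * exp (- (2 * \<kappa> * real m * (x - C)))"
      by (intro mult_mono) auto
    also have "\<dots> = exp (real m * (2 * \<kappa> * C - \<kappa> * x))" by (simp add: exp_add[symmetric] algebra_simps)
    also have "\<dots> \<le> exp (real m * (2 * C + 3 - \<kappa> / 4 * ln (real n)))"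
    proof -
      have "2 * \<kappa> * C \<le> 2 * C" using kpos C by (simp add: mult_left_le_one_le)
      moreover have "\<kappa> / 4 * ln (real n) \<le> \<kappa> * x"
      proof -
        have "\<kappa> / 4 * ln (real n) \<le> \<kappa> * ln (real n)" using kpos lnn by (intro mult_right_mono) auto
        also have "\<dots> \<le> \<kappa> * x" using xpos kpos by (intro mult_left_mono) auto
        finally show ?thesis .
      qed
      ultimately show ?thesis by (simp add: mult_left_mono)
    qed
    finally show ?thesis by (simp add: b_def)
  next
    case False
    then have upos: "u > 0" "real u \<ge> \<kappa> * real m" using kpos m by (auto intro: gr0I)
    have 1: "real (N choose u) \<le> exp (x * real u + real u - real u * ln (real u))"
      using N' upos by (intro binomial_le_exp)
    have "p * (real u * (real n - real d) - real K * real m) \<le> p * b" using b p by (intro mult_left_mono)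
    moreover have "p * (real u * (real n - real d) - real K * real m)
        = real u * (p * real n) - real u * (p * real d) - p * real K * real m" by (simp add: algebra_simps)
    moreover have "real u * (x - C) \<le> real u * (p * real n)" using L by (intro mult_left_mono) auto
    moreover have "real u * (p * real d) \<le> real u * 1" using p by (intro mult_left_mono) auto
    moreover have "p * real K * real m \<le> (\<epsilon> * x + C) * real m"
    proof (rule mult_right_mono)
      have "p * real K \<le> p * (\<epsilon> * real n)" using K p by (intro mult_left_mono)
      also have "\<dots> = \<epsilon> * (p * real n)" by simp
      also have "\<dots> \<le> \<epsilon> * (x + C)" using L epos by (intro mult_left_mono) auto
      also have "\<dots> \<le> \<epsilon> * x + C" using epos C by (simp add: distrib_left mult_left_le_one_le)
      finally show "p * real K \<le> \<epsilon> * x + C" .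
    qed simp
    ultimately have 2: "- p * b \<le> - (real u * (x - C)) + real u + (\<epsilon> * x + C) * real m" by linarith
    \<comment> \<open>split \<open>ln u\<close> into \<open>ln m - ln (m / u)\<close>; the second part costs at most \<open>m\<close>\<close>
    have ulnu: "\<kappa> / 2 * real m * ln (real n) - real m \<le> real u * ln (real u)"
    proof -
      have "ln (real n) \<le> ln (real m ^ 2)"
      proof (subst ln_le_cancel_iff)
        show "real n \<le> real m ^ 2" using m by (metis of_nat_le_iff of_nat_power)
      qed (use n m in auto)
      then have lnm: "ln (real n) / 2 \<le> ln (real m)" using m by (simp add: ln_realpow)
      have "ln (real m / real u) \<le> real m / real u - 1" using m upos by (intro ln_le_minus_one) auto
      then have "real u * ln (real m / real u) \<le> real u * (real m / real u - 1)" by (intro mult_left_mono) auto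
      also have "\<dots> \<le> real m" using upos by (simp add: algebra_simps)
      finally have "real u * ln (real m) - real m \<le> real u * ln (real u)"
        using upos m by (simp add: ln_div algebra_simps)
      moreover have "\<kappa> * real m * (ln (real n) / 2) \<le> real u * ln (real m)"
        using upos lnm lnn m kpos by (intro mult_mono) auto
      ultimately show ?thesis by simp
    qed
    have "real (N choose u) * exp (- p * b)
        \<le> exp (x * real u + real u - real u * ln (real u)) * exp (- (real u * (x - C)) + real u + (\<epsilon> * x + C) * real m)"
      using 1 2 by (intro mult_mono) auto
    also have "\<dots> = exp (real u * (2 + C) - real u * ln (real u) + (\<epsilon> * x + C) * real m)"
      by (simp add: exp_add[symmetric] algebra_simps)
    also have "\<dots> \<le> exp (real m * (2 * C + 3 - \<kappa> / 4 * ln (real n)))"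
    proof -
      have um: "real u * (2 + C) \<le> real m * (2 + C)" using u C by (intro mult_right_mono) auto
      have ex: "\<epsilon> * x = \<kappa> / 4 * ln (real n)" using epos(3) by (simp add: x)
      have "real u * (2 + C) - real u * ln (real u) + (\<epsilon> * x + C) * real m
          \<le> real m * (2 + C) - (\<kappa> / 2 * real m * ln (real n) - real m) + (\<kappa> / 4 * ln (real n) + C) * real m"
        unfolding ex using um ulnu by linarith
      also have "\<dots> = real m * (2 * C + 3 - \<kappa> / 4 * ln (real n))" by (simp add: algebra_simps)
      finally show ?thesis by simp
    qed
    finally show ?thesis by (simp add: b_def)
  qed
qed

definition random_faces :: "nat \<Rightarrow> nat \<Rightarrow> real \<Rightarrow> nat set set pmf" where
  "random_faces d n p = map_pmf (\<lambda>\<omega>. {\<tau> \<in> faces n (Suc d). \<omega> \<tau>})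
     (Pi_pmf (faces n (Suc d)) False (\<lambda>_. bernoulli_pmf p))"

lemma set_random_faces: "T \<in> set_pmf (random_faces d n p) \<Longrightarrow> T \<subseteq> faces n (Suc d)"
  by (auto simp: random_faces_def)

lemma prob_avoid:
  assumes p: "0 \<le> p" "p \<le> 1" and X: "X \<subseteq> faces n (Suc d)"
  shows "measure_pmf.prob (random_faces d n p) {T. X \<inter> T = {}} = (1 - p) ^ card X"
proof -
  let ?M = "Pi_pmf (faces n (Suc d)) False (\<lambda>_. bernoulli_pmf p)"
  let ?B = "\<lambda>\<tau>. if \<tau> \<in> X then {False} else UNIV"
  have "(\<lambda>\<omega>. {\<tau> \<in> faces n (Suc d). \<omega> \<tau>}) -` {T. X \<inter> T = {}} = Pi (faces n (Suc d)) ?B"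
    using X by (auto simp: Pi_def split: if_splits)
  then have "measure_pmf.prob (random_faces d n p) {T. X \<inter> T = {}} = measure_pmf.prob ?M (Pi (faces n (Suc d)) ?B)"
    by (simp add: random_faces_def)
  also have "\<dots> = (\<Prod>\<tau>\<in>faces n (Suc d). measure_pmf.prob (bernoulli_pmf p) (?B \<tau>))"
    by (rule measure_Pi_pmf_Pi) simp
  also have "\<dots> = (\<Prod>\<tau>\<in>faces n (Suc d). if \<tau> \<in> X then 1 - p else 1)"
    using p by (intro prod.cong) (auto simp: measure_pmf_single)
  also have "\<dots> = (1 - p) ^ card X"
    using X by (simp add: prod.If_cases Int_absorb1 flip: prod.inter_restrict)
  finally show ?thesis .
qed

text \<open>
  With \<open>K\<close> proportional to \<open>n\<close>, the dominating set has \<open>O(m / n)\<close> faces. The number of its choices and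
  the number of subsets of its neighbourhood are then at most exponential in \<open>m\<close>, which is negligible
  against the saving of a power of \<open>n\<close> for each of the \<open>m\<close> faces.
\<close>

lemma large_supports_sum:
  fixes x p C \<epsilon> \<kappa> :: real
  assumes d: "d \<ge> 1" and n: "n \<ge> 1" and m: "m \<ge> 1" "n \<le> m ^ 2"
    and x: "x = real d * ln (real n)" and p: "0 \<le> p" "p \<le> 1" "p * real d \<le> 1"
    and L: "\<bar>p * real n - x\<bar> \<le> C"
    and \<kappa>: "\<kappa> = 1 / (2 * (real d + 1))" and \<epsilon>: "\<epsilon> = \<kappa> / (4 * real d)"
    and K: "K > 0" "real K \<le> \<epsilon> * real n" "\<epsilon> * real n \<le> 2 * real K"
    and big: "2 * (1 + x) \<le> \<epsilon> * real n"
    and \<G>: "\<And>G. G \<in> \<G> \<Longrightarrow> G \<subseteq> faces n d \<and> card G = m"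
    and exp: "\<And>G. G \<in> \<G> \<Longrightarrow> n * m \<le> Suc d * card (coboundary2 n (Suc d) G)"
  shows "(\<Sum>G\<in>\<G>. (1 - p) ^ card (coboundary2 n (Suc d) G))
    \<le> exp (2 * real d / \<epsilon> + 2 * C + 5 - \<kappa> / 4 * ln (real n)) ^ m"
proof -
  define w where "w u = exp (- p * max (real u * (real n - real d) - real K * real m) (real n * real m / (real d + 1)))"
    for u
  define s where "s = m div K"
  have epos: "\<epsilon> > 0" using d by (simp add: \<epsilon> \<kappa>)
  have xpos: "x \<ge> 0" using n by (simp add: x)
  have s: "real s * (\<epsilon> * real n) \<le> 2 * real m"
  proof -
    have "real s * real K \<le> real m" unfolding s_def by (metis div_times_less_eq_dividend of_nat_le_iff of_nat_mult)
    moreover have "real s * (\<epsilon> * real n) \<le> real s * (2 * real K)" using K by (intro mult_left_mono) auto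
    ultimately show ?thesis by simp
  qed
  have N: "real (n choose d) \<le> real n ^ d" by (rule binomial_le_pow_real)
  have "(\<Sum>G\<in>\<G>. (1 - p) ^ card (coboundary2 n (Suc d) G))
    \<le> real (((n choose d) + 1) ^ s) * 2 ^ (s * (d * n)) * (\<Sum>u\<le>m. real ((n choose d) choose u) * w u)"
    unfolding s_def
  proof (rule sum_over_dominated_sets[OF K(1)])
    fix G u assume G: "G \<in> \<G>" and u: "u * (n - d) \<le> card (coboundary2 n (Suc d) G) + K * m"
    have "real u * (real n - real d) \<le> real u * real (n - d)" by (intro mult_left_mono) auto
    also have "\<dots> \<le> real (card (coboundary2 n (Suc d) G)) + real K * real m"
      using u by (metis of_nat_add of_nat_le_iff of_nat_mult)
    finally have 1: "real u * (real n - real d) - real K * real m \<le> real (card (coboundary2 n (Suc d) G))" by simp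
    have "real n * real m \<le> (real d + 1) * real (card (coboundary2 n (Suc d) G))"
      using exp[OF G] by (metis of_nat_Suc of_nat_le_iff of_nat_mult add.commute)
    then have 2: "real n * real m / (real d + 1) \<le> real (card (coboundary2 n (Suc d) G))"
      by (simp add: divide_le_eq mult.commute)
    show "(1 - p) ^ card (coboundary2 n (Suc d) G) \<le> w u"
      unfolding w_def using 1 2 p by (intro one_minus_power_le_exp) auto
  qed (use \<G> in \<open>auto simp: w_def\<close>)
  also have "\<dots> \<le> exp (real m) * exp (real m * (2 * real d / \<epsilon>)) * (exp (real m) * exp (real m * (2 * C + 3 - \<kappa> / 4 * ln (real n))))"
  proof (intro mult_mono)
    have "1 \<le> real n ^ d" using n by simp
    then have "real ((n choose d) + 1) \<le> 2 * real n ^ d"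
      unfolding of_nat_add of_nat_1 using N by linarith
    also have "\<dots> = 2 * exp x" using n by (simp add: x exp_of_nat_mult)
    also have "\<dots> \<le> exp 1 * exp x" using exp_ge_add_one_self[of 1] by (intro mult_right_mono) auto
    finally have "real ((n choose d) + 1) ^ s \<le> exp (1 + x) ^ s" by (intro power_mono) (auto simp: exp_add)
    also have "\<dots> = exp (real s * (1 + x))" by (simp add: exp_of_nat_mult)
    also have "\<dots> \<le> exp (real m)"
    proof -
      have "real s * (2 * (1 + x)) \<le> real s * (\<epsilon> * real n)" using big by (intro mult_left_mono) auto
      moreover have "real s * (2 * (1 + x)) = 2 * (real s * (1 + x))" by (rule mult.left_commute)
      ultimately have "real s * (1 + x) \<le> real m" using s by linarith
      then show ?thesis by simp
    qed
    finally show "real (((n choose d) + 1) ^ s) \<le> exp (real m)" by simp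
    have "(2::real) ^ (s * (d * n)) \<le> exp 1 ^ (s * (d * n))"
      using exp_ge_add_one_self[of 1] by (intro power_mono) auto
    also have "\<dots> = exp (real (s * (d * n)))" by (simp add: exp_of_nat_mult[symmetric])
    also have "\<dots> \<le> exp (real m * (2 * real d / \<epsilon>))"
    proof -
      have "real d * (real s * (\<epsilon> * real n)) \<le> real d * (2 * real m)" using s by (intro mult_left_mono) auto
      then show ?thesis using epos by (simp add: field_simps)
    qed
    finally show "(2::real) ^ (s * (d * n)) \<le> exp (real m * (2 * real d / \<epsilon>))" .
    have "(\<Sum>u\<le>m. real ((n choose d) choose u) * w u)
        \<le> (\<Sum>u\<le>m. exp (real m * (2 * C + 3 - \<kappa> / 4 * ln (real n))))"
      unfolding w_def
      by (intro sum_mono undominated_term_bound[OF d n m _ x p(1,3) L \<kappa> \<epsilon> K(2) N]) auto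
    also have "\<dots> = (1 + real m) * exp (real m * (2 * C + 3 - \<kappa> / 4 * ln (real n)))" by simp
    also have "\<dots> \<le> exp (real m) * exp (real m * (2 * C + 3 - \<kappa> / 4 * ln (real n)))"
      by (intro mult_right_mono exp_ge_add_one_self) auto
    finally show "(\<Sum>u\<le>m. real ((n choose d) choose u) * w u)
        \<le> exp (real m) * exp (real m * (2 * C + 3 - \<kappa> / 4 * ln (real n)))" .
  qed (auto intro!: sum_nonneg mult_nonneg_nonneg simp: w_def)
  also have "\<dots> = exp (real m * (2 * real d / \<epsilon> + 2 * C + 5 - \<kappa> / 4 * ln (real n)))"
    by (simp add: exp_add[symmetric] algebra_simps)
  also have "\<dots> = exp (2 * real d / \<epsilon> + 2 * C + 5 - \<kappa> / 4 * ln (real n)) ^ m"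
    by (rule exp_of_nat_mult)
  finally show ?thesis .
qed

text \<open>
  A cluster with \<open>m = k + 1\<close> faces can be chosen in about \<open>n^d (m d n)^k\<close> ways and has at least
  \<open>m (n - d - m)\<close> faces in its coboundary, so it is a cocycle with probability about \<open>n^(- d m)\<close>. Every
  face after the first thus contributes a factor of about \<open>m d n^(1 - d)\<close>, which is at most
  \<open>d / sqrt n\<close> as \<open>d \<ge> 2\<close> and \<open>m \<le> sqrt n\<close>.
\<close>

lemma small_clusters_sum:
  fixes x p C :: real
  assumes d: "d \<ge> 2" and n: "n \<ge> 1" and k: "k \<ge> 1" "(Suc k) ^ 2 \<le> n"
    and x: "x = real d * ln (real n)" and p: "0 \<le> p" "p \<le> 1" "p * (real d + sqrt (real n)) \<le> 1"
    and L: "\<bar>p * real n - x\<bar> \<le> C"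
  shows "(\<Sum>G | G \<in> clusters n d \<and> card G = Suc k. (1 - p) ^ card (coboundary2 n (Suc d) G))
    \<le> (real d * exp (2 * C + 2) / sqrt (real n)) ^ k"
proof -
  let ?\<G> = "{G \<in> clusters n d. card G = Suc k}"
  define m where "m = Suc k"
  have C: "C \<ge> 0" using L by linarith
  have m_sqrt: "real m \<le> sqrt (real n)"
    using k(2) unfolding m_def by (metis of_nat_le_iff of_nat_power real_le_rsqrt)
  have npos: "real n > 0" using n by simp
  have each: "(1 - p) ^ card (coboundary2 n (Suc d) G) \<le> exp (real m * (C + 1 - x))" if G: "G \<in> ?\<G>" for G
  proof -
    have Gf: "G \<subseteq> faces n d" "card G = m" "finite G"
      using G clusters_subset[of G n d] finite_subset_faces[of G n d] by (auto simp: m_def)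
    have "(\<Sum>u\<in>G. card {g \<in> G. adjacent u g}) \<le> (\<Sum>u\<in>G. m)"
      using Gf card_mono[OF Gf(3)] by (intro sum_mono) (metis (no_types, lifting) mem_Collect_eq subsetI)
    then have "m * (n - d) \<le> card (coboundary2 n (Suc d) G) + m * m"
      using card_coboundary2_lower[OF Gf(1) order_refl] Gf(2) by simp
    then have "real m * real (n - d) \<le> real (card (coboundary2 n (Suc d) G)) + real m * real m"
      by (metis of_nat_add of_nat_le_iff of_nat_mult)
    moreover have "real m * (real n - real d) \<le> real m * real (n - d)" by (intro mult_left_mono) auto
    ultimately have "real m * (real n - real d - real m) \<le> real (card (coboundary2 n (Suc d) G))"
      by (simp add: algebra_simps)
    from one_minus_power_le_exp[OF p(1,2) this]
    have "(1 - p) ^ card (coboundary2 n (Suc d) G) \<le> exp (- p * (real m * (real n - real d - real m)))" .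
    also have "\<dots> \<le> exp (real m * (C + 1 - x))"
    proof -
      have "p * (real d + real m) \<le> p * (real d + sqrt (real n))" using m_sqrt p by (intro mult_left_mono) auto
      then have "p * (real d + real m) - p * real n \<le> C + 1 - x" using p(3) L by linarith
      then have "real m * (p * (real d + real m) - p * real n) \<le> real m * (C + 1 - x)"
        by (intro mult_left_mono) auto
      then show ?thesis by (simp add: algebra_simps)
    qed
    finally show ?thesis .
  qed
  have "(\<Sum>G\<in>?\<G>. (1 - p) ^ card (coboundary2 n (Suc d) G)) \<le> (\<Sum>G\<in>?\<G>. exp (real m * (C + 1 - x)))"
    using each by (rule sum_mono)
  also have "\<dots> = real (card ?\<G>) * exp (real m * (C + 1 - x))" by simp
  also have "\<dots> \<le> (real n ^ d * (real k * (real d * real n)) ^ k) * exp (real m * (C + 1 - x))"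
  proof (rule mult_right_mono)
    have "real (card ?\<G>) \<le> real ((n choose d) * (fact k * (d * n) ^ k))"
      unfolding of_nat_le_iff by (rule card_clusters_le)
    also have "\<dots> = real (n choose d) * (fact k * (real d * real n) ^ k)" by simp
    also have "\<dots> \<le> real n ^ d * (real k ^ k * (real d * real n) ^ k)"
      using fact_le_power[of k, where 'a = real]
      by (intro mult_mono binomial_le_pow_real) auto
    finally show "real (card ?\<G>) \<le> real n ^ d * (real k * (real d * real n)) ^ k"
      by (simp add: power_mult_distrib)
  qed simp
  also have "exp (real m * (C + 1 - x)) = exp (C + 1) ^ Suc k / (real n ^ d * (real n ^ d) ^ k)"
  proof -
    have "exp (real m * (C + 1 - x)) = exp (C + 1 - x) ^ Suc k"
      unfolding m_def by (rule exp_of_nat_mult)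
    also have "exp (C + 1 - x) = exp (C + 1) / real n ^ d"
      using npos by (simp add: exp_diff x exp_of_nat_mult)
    finally show ?thesis by (simp add: power_divide)
  qed
  also have "real n ^ d * (real k * (real d * real n)) ^ k * (exp (C + 1) ^ Suc k / (real n ^ d * (real n ^ d) ^ k))
      = (real k * (real d * real n) / real n ^ d) ^ k * exp (C + 1) ^ Suc k"
    using npos by (simp add: power_divide)
  also have "\<dots> \<le> (real d / sqrt (real n)) ^ k * exp (2 * C + 2) ^ k"
  proof (intro mult_mono power_mono)
    have "real n ^ 2 \<le> real n ^ d" using n d by (intro power_increasing) auto
    then have "real k * (real d * real n) / real n ^ d \<le> sqrt (real n) * (real d * real n) / real n ^ 2"
      using m_sqrt npos by (intro frac_le mult_right_mono) (auto simp: m_def)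
    also have "\<dots> = real d * (sqrt (real n) / real n)" using npos by (simp add: power2_eq_square)
    also have "\<dots> = real d / sqrt (real n)" using npos by (simp add: real_div_sqrt field_simps)
    finally show "real k * (real d * real n) / real n ^ d \<le> real d / sqrt (real n)" .
    have "exp (C + 1) ^ Suc k \<le> exp (C + 1) ^ (2 * k)" using k C by (intro power_increasing) auto
    also have "\<dots> = exp (2 * C + 2) ^ k"
      by (simp add: power_mult exp_of_nat_mult[symmetric] flip: exp_double)
    finally show "exp (C + 1) ^ Suc k \<le> exp (2 * C + 2) ^ k" .
  qed auto
  also have "\<dots> = (real d * exp (2 * C + 2) / sqrt (real n)) ^ k"
    by (simp add: power_mult_distrib[symmetric])
  finally show ?thesis .
qed

section \<open>Nontrivial cocycles are unlikely\<close>

text \<open>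
  The deterministic part of what is known about a minimal nontrivial cocycle.
\<close>

definition minimal_clusters :: "nat \<Rightarrow> nat \<Rightarrow> nat set set set" where
  "minimal_clusters n d = {G \<in> clusters n d. 2 \<le> card G \<and> n * card G \<le> Suc d * card (coboundary2 n (Suc d) G)}"

lemma finite_clusters: "finite (clusters n d)"
  by (rule finite_subset[of _ "Pow (faces n d)"]) (auto dest: clusters_subset)

lemma prob_nontrivial_le_sum:
  assumes d: "d \<ge> 1" and p: "0 \<le> p" "p \<le> 1"
  shows "measure_pmf.prob (random_faces d n p) {T. \<not> only_trivial_cocycles n d T}
    \<le> (\<Sum>G\<in>minimal_clusters n d. (1 - p) ^ card (coboundary2 n (Suc d) G))"
proof -
  let ?M = "random_faces d n p"
  have fin: "finite (minimal_clusters n d)"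
    unfolding minimal_clusters_def using finite_clusters by simp
  have "measure_pmf.prob ?M {T. \<not> only_trivial_cocycles n d T}
      = measure_pmf.prob ?M ({T. \<not> only_trivial_cocycles n d T} \<inter> set_pmf ?M)"
    by (simp add: measure_Int_set_pmf)
  also have "\<dots> \<le> measure_pmf.prob ?M (\<Union>G\<in>minimal_clusters n d. {T. coboundary2 n (Suc d) G \<inter> T = {}})"
  proof (rule measure_pmf.finite_measure_mono)
    show "{T. \<not> only_trivial_cocycles n d T} \<inter> set_pmf ?M
        \<subseteq> (\<Union>G\<in>minimal_clusters n d. {T. coboundary2 n (Suc d) G \<inter> T = {}})"
    proof
      fix T assume "T \<in> {T. \<not> only_trivial_cocycles n d T} \<inter> set_pmf ?M"
      then have T: "T \<subseteq> faces n (Suc d)" "\<not> only_trivial_cocycles n d T"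
        using set_random_faces[of T d n p] by auto
      from d T obtain G where "G \<in> clusters n d" "2 \<le> card G"
        "n * card G \<le> Suc d * card (coboundary2 n (Suc d) G)" "coboundary2 n (Suc d) G \<inter> T = {}"
        by (rule minimal_nontrivial_cocycle)
      then show "T \<in> (\<Union>G\<in>minimal_clusters n d. {T. coboundary2 n (Suc d) G \<inter> T = {}})"
        by (auto simp: minimal_clusters_def)
    qed
  qed simp
  also have "\<dots> \<le> (\<Sum>G\<in>minimal_clusters n d. measure_pmf.prob ?M {T. coboundary2 n (Suc d) G \<inter> T = {}})"
    using fin by (intro measure_pmf.finite_measure_subadditive_finite) auto
  also have "\<dots> = (\<Sum>G\<in>minimal_clusters n d. (1 - p) ^ card (coboundary2 n (Suc d) G))"
    using p coboundary2_subset by (intro sum.cong prob_avoid) auto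
  finally show ?thesis .
qed

lemma geometric_tail:
  fixes q :: real
  assumes "0 \<le> q" "q \<le> 1 / 2"
  shows "(\<Sum>m\<in>{2..M}. q ^ (m - 1)) \<le> 2 * q"
proof -
  \<comment> \<open>the subtracted term leaves room for the terms still to come\<close>
  have "(\<Sum>m\<in>{2..Suc M}. q ^ (m - 1)) \<le> 2 * q - 2 * q * (1 / 2) ^ M" for M
  proof (induction M)
    case (Suc M)
    have "q * q ^ M \<le> q * (1 / 2) ^ M" using assms by (intro mult_left_mono power_mono) auto
    then show ?case using Suc.IH by simp
  qed simp
  from this[of "M - 1"] have "(\<Sum>m\<in>{2..M}. q ^ (m - 1)) \<le> 2 * q - 2 * q * (1 / 2) ^ (M - 1)"
    using assms by (cases M) auto
  also have "\<dots> \<le> 2 * q" using assms by simp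
  finally show ?thesis .
qed

lemma minimal_clusters_sum:
  fixes x p C \<epsilon> \<kappa> q :: real
  assumes d: "d \<ge> 2" and n: "n \<ge> 1"
    and x: "x = real d * ln (real n)" and p: "0 \<le> p" "p * (real d + sqrt (real n)) \<le> 1"
    and L: "\<bar>p * real n - x\<bar> \<le> C"
    and \<kappa>: "\<kappa> = 1 / (2 * (real d + 1))" and \<epsilon>: "\<epsilon> = \<kappa> / (4 * real d)"
    and big: "2 * (1 + x) \<le> \<epsilon> * real n"
    and q: "real d * exp (2 * C + 2) / sqrt (real n) \<le> q"
      "exp (2 * real d / \<epsilon> + 2 * C + 5 - \<kappa> / 4 * ln (real n)) \<le> q" "q \<le> 1 / 2"
  shows "(\<Sum>G\<in>minimal_clusters n d. (1 - p) ^ card (coboundary2 n (Suc d) G)) \<le> 2 * q"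
proof -
  have q0: "q \<ge> 0" using q(2) exp_ge_zero order_trans by blast
  have xpos: "x \<ge> 0" using n by (simp add: x)
  have p1: "p \<le> 1" "p * real d \<le> 1"
  proof -
    have "p * real d \<le> p * (real d + sqrt (real n))" using p by (intro mult_left_mono) auto
    then show "p * real d \<le> 1" using p by linarith
    moreover have "p * 1 \<le> p * real d" using p d by (intro mult_left_mono) auto
    ultimately show "p \<le> 1" by simp
  qed
  \<comment> \<open>the domination threshold; \<open>\<epsilon> * n \<ge> 2\<close> keeps the rounding within a factor \<open>2\<close>\<close>
  define K where "K = nat \<lfloor>\<epsilon> * real n\<rfloor>"
  have en: "\<epsilon> * real n \<ge> 2" using big xpos by simp
  have K: "K > 0" "real K \<le> \<epsilon> * real n" "\<epsilon> * real n \<le> 2 * real K"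
  proof -
    have "real K = of_int \<lfloor>\<epsilon> * real n\<rfloor>" using en by (simp add: K_def)
    then have "real K \<le> \<epsilon> * real n" "\<epsilon> * real n < real K + 1" by linarith+
    then show "K > 0" "real K \<le> \<epsilon> * real n" "\<epsilon> * real n \<le> 2 * real K" using en by linarith+
  qed
  define f where "f G = (1 - p) ^ card (coboundary2 n (Suc d) G)" for G
  have f0: "f G \<ge> 0" for G using p1 by (simp add: f_def)
  define M where "M = card (faces n d)"
  have fin: "finite (minimal_clusters n d)"
    unfolding minimal_clusters_def using finite_clusters by simp
  have sub: "G \<subseteq> faces n d" if "G \<in> minimal_clusters n d" for G
    using that clusters_subset by (auto simp: minimal_clusters_def)
  have "(\<Sum>G\<in>minimal_clusters n d. f G)
      = (\<Sum>m\<in>{2..M}. \<Sum>G | G \<in> minimal_clusters n d \<and> card G = m. f G)"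
  proof (rule sum.group[symmetric])
    show "card ` minimal_clusters n d \<subseteq> {2..M}"
      using card_mono[OF finite_faces sub] by (auto simp: minimal_clusters_def M_def)
  qed (use fin in auto)
  also have "\<dots> \<le> (\<Sum>m\<in>{2..M}. q ^ (m - 1))"
  proof (rule sum_mono)
    fix m assume "m \<in> {2..M}"
    then have m: "m \<ge> 2" by simp
    show "(\<Sum>G | G \<in> minimal_clusters n d \<and> card G = m. f G) \<le> q ^ (m - 1)"
    proof (cases "m ^ 2 \<le> n")
      case True
      have "(\<Sum>G | G \<in> minimal_clusters n d \<and> card G = m. f G)
          \<le> (\<Sum>G | G \<in> clusters n d \<and> card G = Suc (m - 1). f G)"
        using finite_clusters m f0 by (intro sum_mono2) (auto simp: minimal_clusters_def)
      also have "\<dots> \<le> (real d * exp (2 * C + 2) / sqrt (real n)) ^ (m - 1)"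
        unfolding f_def using m True by (intro small_clusters_sum[OF d n _ _ x p(1) p1(1) p(2) L]) auto
      also have "\<dots> \<le> q ^ (m - 1)" using q by (intro power_mono) auto
      finally show ?thesis .
    next
      case False
      have "(\<Sum>G | G \<in> minimal_clusters n d \<and> card G = m. f G)
          \<le> exp (2 * real d / \<epsilon> + 2 * C + 5 - \<kappa> / 4 * ln (real n)) ^ m"
        unfolding f_def
      proof (rule large_supports_sum[OF _ n _ _ x p(1) p1 L \<kappa> \<epsilon> K big])
        show "1 \<le> d" "1 \<le> m" "n \<le> m ^ 2" using d m False by auto
        show "n * m \<le> Suc d * card (coboundary2 n (Suc d) G)"
          if "G \<in> {G \<in> minimal_clusters n d. card G = m}" for G
          using that unfolding minimal_clusters_def by blast
      qed (use sub in auto)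
      also have "\<dots> \<le> q ^ m" using q by (intro power_mono) auto
      also have "\<dots> \<le> q ^ (m - 1)" using q q0 by (intro power_decreasing) auto
      finally show ?thesis .
    qed
  qed
  also have "\<dots> \<le> 2 * q" using q0 q(3) by (rule geometric_tail)
  finally show ?thesis by (simp add: f_def)
qed

theorem nontrivial_cocycles_unlikely:
  fixes p :: "nat \<Rightarrow> real"
  assumes d: "d \<ge> 2" and L: "\<forall>\<^sub>F n in sequentially. \<bar>p n * real n - real d * ln (real n)\<bar> \<le> C"
  shows "(\<lambda>n. measure_pmf.prob (random_faces d n (p n)) {T. \<not> only_trivial_cocycles n d T}) \<longlonglongrightarrow> 0"
proof -
  define \<kappa> where "\<kappa> = 1 / (2 * (real d + 1))"
  define \<epsilon> where "\<epsilon> = \<kappa> / (4 * real d)"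
  have pos: "\<kappa> > 0" "\<epsilon> > 0" "real d > 0" using d by (auto simp: \<kappa>_def \<epsilon>_def)
  define q1 where "q1 n = real d * exp (2 * C + 2) / sqrt (real n)" for n
  define q2 where "q2 n = exp (2 * real d / \<epsilon> + 2 * C + 5 - \<kappa> / 4 * ln (real n))" for n
  define q where "q n = max (q1 n) (q2 n)" for n
  have "q1 \<longlonglongrightarrow> 0" unfolding q1_def using pos by real_asymp
  moreover have "q2 \<longlonglongrightarrow> 0" unfolding q2_def using pos by real_asymp
  ultimately have q: "q \<longlonglongrightarrow> 0" unfolding q_def using tendsto_max[of q1 0 sequentially q2 0] by simp
  have "(\<lambda>n. (real d * ln (real n) + C) / real n * (real d + sqrt (real n))) \<longlonglongrightarrow> 0"
    using pos by real_asymp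
  then have ev1: "\<forall>\<^sub>F n in sequentially. (real d * ln (real n) + C) / real n * (real d + sqrt (real n)) < 1"
    by (rule order_tendstoD) simp
  have ev2: "\<forall>\<^sub>F n in sequentially. 2 * (1 + real d * ln (real n)) \<le> \<epsilon> * real n"
    using pos by real_asymp
  have ev3: "\<forall>\<^sub>F n in sequentially. real d * ln (real n) \<ge> C"
    using pos by real_asymp
  have ev4: "\<forall>\<^sub>F n in sequentially. q n < 1 / 2" using q by (rule order_tendstoD) simp
  have bound: "\<forall>\<^sub>F n in sequentially.
      measure_pmf.prob (random_faces d n (p n)) {T. \<not> only_trivial_cocycles n d T} \<le> 2 * q n"
    using L ev1 ev2 ev3 ev4 eventually_ge_at_top[of 1]
  proof eventually_elim
    case (elim n)
    have n: "real n > 0" using elim(6) by simp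
    have "0 \<le> p n * real n" using elim(1,4) by linarith
    then have p0: "0 \<le> p n" using n by (simp add: zero_le_mult_iff)
    have "p n \<le> (real d * ln (real n) + C) / real n" using elim(1) n by (simp add: field_simps)
    then have "p n * (real d + sqrt (real n)) \<le> (real d * ln (real n) + C) / real n * (real d + sqrt (real n))"
      by (intro mult_right_mono) auto
    then have p1: "p n * (real d + sqrt (real n)) \<le> 1" using elim(2) by linarith
    have "p n * 1 \<le> p n * (real d + sqrt (real n))" using p0 d by (intro mult_left_mono) (auto intro: add_increasing2)
    then have p2: "p n \<le> 1" using p1 by linarith
    have "measure_pmf.prob (random_faces d n (p n)) {T. \<not> only_trivial_cocycles n d T}
        \<le> (\<Sum>G\<in>minimal_clusters n d. (1 - p n) ^ card (coboundary2 n (Suc d) G))"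
      using d p0 p2 by (intro prob_nontrivial_le_sum) auto
    also have "\<dots> \<le> 2 * q n"
      using elim by (intro minimal_clusters_sum[OF d _ refl p0 p1 elim(1) \<kappa>_def \<epsilon>_def elim(3)])
        (auto simp: q_def q1_def q2_def)
    finally show ?case .
  qed
  have "(\<lambda>n. 2 * q n) \<longlonglongrightarrow> 0" using tendsto_mult_right[OF q, of 2] by simp
  from tendsto_sandwich[OF _ bound tendsto_const this] show ?thesis by simp
qed

section \<open>Isolated faces are asymptotically Poisson\<close>

lemma alternating_binomial_partial_sum:
  "(\<Sum>j\<le>J. (-1) ^ j * real (Suc Y choose j)) = (-1) ^ J * real (Y choose J)"
  by (induction J) (simp_all add: algebra_simps)

text \<open>
  Truncated inclusion and exclusion for the event of having exactly \<open>k\<close> occurrences among \<open>X\<close>.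
\<close>

lemma bonferroni:
  "\<bar>of_bool (X = k) - (\<Sum>j\<le>J. (-1) ^ j * real ((k + j) choose k) * real (X choose (k + j)))\<bar>
    \<le> real ((k + J) choose k) * real (X choose (k + J))"
proof (cases "X < k")
  case True
  then show ?thesis by (simp add: binomial_eq_0)
next
  case False
  then have kX: "k \<le> X" by simp
  have reduce: "real ((k + j) choose k) * real (X choose (k + j)) = real (X choose k) * real ((X - k) choose j)" for j
  proof (cases "k + j \<le> X")
    case True
    have "((X choose (k + j)) * ((k + j) choose k)) = (X choose k) * ((X - k) choose j)"
      using choose_mult[of k "k + j" X] True by simp
    then show ?thesis by (metis mult.commute of_nat_mult)
  next
    case False
    then have "X - k < j" using kX by simp
    then show ?thesis using False by (simp add: binomial_eq_0)
  qed
  have sum: "(\<Sum>j\<le>J. (-1) ^ j * real ((k + j) choose k) * real (X choose (k + j)))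
      = real (X choose k) * (\<Sum>j\<le>J. (-1) ^ j * real ((X - k) choose j))"
    unfolding mult.assoc reduce by (simp add: sum_distrib_left mult.left_commute)
  show ?thesis
  proof (cases "X = k")
    case True
    have "(\<Sum>j\<le>J. (-1) ^ j * real (0 choose j)) = 1" by (induction J) simp_all
    then show ?thesis unfolding sum reduce using True by simp
  next
    case neq: False
    then obtain Y where Y: "X - k = Suc Y" using False by (metis Suc_pred diff_is_0_eq le_neq_implies_less linorder_not_le not_gr_zero)
    have "Y choose J \<le> Suc Y choose J" by (cases J) simp_all
    then show ?thesis unfolding sum reduce Y alternating_binomial_partial_sum using neq
      by (simp add: abs_mult mult_left_mono)
  qed
qed

text \<open>
  Two successive limits, first \<open>n\<close> and then the truncation level \<open>J\<close>.
\<close>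

lemma tendsto_by_approximation:
  fixes f :: "nat \<Rightarrow> real"
  assumes approx: "\<And>J. \<forall>\<^sub>F n in sequentially. \<bar>f n - S J n\<bar> \<le> R J n"
    and S: "\<And>J. S J \<longlonglongrightarrow> s J" and R: "\<And>J. R J \<longlonglongrightarrow> r J"
    and s: "s \<longlonglongrightarrow> l" and r: "r \<longlonglongrightarrow> 0"
  shows "f \<longlonglongrightarrow> l"
proof (rule tendstoI)
  fix e :: real assume e: "e > 0"
  have "\<forall>\<^sub>F J in sequentially. dist (s J) l < e / 4 \<and> dist (r J) 0 < e / 4"
    using tendstoD[OF s, of "e / 4"] tendstoD[OF r, of "e / 4"] e by (auto intro: eventually_conj)
  then obtain J where J: "dist (s J) l < e / 4" "dist (r J) 0 < e / 4"
    by (auto dest: eventually_happens)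
  have "\<forall>\<^sub>F n in sequentially. dist (S J n) (s J) < e / 4" "\<forall>\<^sub>F n in sequentially. dist (R J n) (r J) < e / 4"
    using tendstoD[OF S, of "e / 4" J] tendstoD[OF R, of "e / 4" J] e by auto
  with approx[of J] show "\<forall>\<^sub>F n in sequentially. dist (f n) l < e"
  proof eventually_elim
    case (elim n)
    have "\<bar>f n - l\<bar> \<le> \<bar>f n - S J n\<bar> + \<bar>S J n - s J\<bar> + \<bar>s J - l\<bar>" by simp
    moreover have "R J n \<le> \<bar>R J n - r J\<bar> + \<bar>r J\<bar>" by simp
    ultimately show ?case using elim J unfolding dist_real_def by linarith
  qed
qed

lemma binomial_over_power_tendsto:
  "(\<lambda>n. real (n choose k) / real n ^ k) \<longlonglongrightarrow> 1 / fact k"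
proof -
  have "(\<lambda>n. (\<Prod>i<k. 1 - real i / real n) / fact k) \<longlonglongrightarrow> (\<Prod>i<k. 1 - 0) / fact k"
  proof -
    have "(\<lambda>n. real i / real n) \<longlonglongrightarrow> 0" for i by real_asymp
    then show ?thesis by (intro tendsto_intros) auto
  qed
  moreover have "\<forall>\<^sub>F n in sequentially. (\<Prod>i<k. 1 - real i / real n) / fact k = real (n choose k) / real n ^ k"
    using eventually_gt_at_top[of 0]
  proof eventually_elim
    case (elim n)
    have "(\<Prod>i<k. real n - real i) / real n ^ k = (\<Prod>i<k. (real n - real i) / real n)"
      by (simp add: prod_dividef)
    also have "\<dots> = (\<Prod>i<k. 1 - real i / real n)"
      using elim by (intro prod.cong) (auto simp: diff_divide_distrib)
    finally have "(\<Prod>i<k. 1 - real i / real n) = (\<Prod>i<k. real n - real i) / real n ^ k" ..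
    then show ?case
      by (simp add: binomial_gbinomial gbinomial_prod_rev atLeast0LessThan)
  qed
  ultimately show ?thesis by (simp add: filterlim_cong)
qed

lemma card_cofaces:
  assumes "\<sigma> \<in> faces n d"
  shows "card {\<tau> \<in> faces n (Suc d). \<sigma> \<subseteq> \<tau>} = n - d"
proof -
  have "{\<tau> \<in> faces n (Suc d). \<sigma> \<subseteq> \<tau>} = {\<tau>. \<sigma> \<subseteq> \<tau> \<and> \<tau> \<subseteq> {1..n} \<and> card \<tau> = Suc (card \<sigma>)}"
    using facesD[OF assms] by (auto simp: faces_def)
  then show ?thesis using card_between[of "{1..n}" \<sigma>] facesD[OF assms] by simp
qed

definition expected_binomial :: "nat \<Rightarrow> nat \<Rightarrow> real \<Rightarrow> nat \<Rightarrow> real" where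
  "expected_binomial d n p r =
     measure_pmf.expectation (random_faces d n p) (\<lambda>T. real (card (isolated_faces n d T) choose r))"

lemma finite_set_random_faces: "finite (set_pmf (random_faces d n p))"
  by (rule finite_subset[of _ "Pow (faces n (Suc d))"]) (auto dest: set_random_faces)

lemma integrable_random_faces: "integrable (measure_pmf (random_faces d n p)) (f :: _ \<Rightarrow> real)"
  by (rule integrable_measure_pmf_finite[OF finite_set_random_faces])

text \<open>
  A binomial coefficient of the number of isolated faces counts the sets \<open>A\<close> of \<open>r\<close> isolated faces, and
  the faces of \<open>A\<close> are isolated exactly when none of their cofaces is chosen.
\<close>

lemma expected_binomial_eq:
  assumes p: "0 \<le> p" "p \<le> 1"
  shows "expected_binomial d n p r = (\<Sum>A | A \<subseteq> faces n d \<and> card A = r.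
    (1 - p) ^ card {\<tau> \<in> faces n (Suc d). \<exists>\<sigma>\<in>A. \<sigma> \<subseteq> \<tau>})"
proof -
  let ?M = "random_faces d n p"
  let ?\<A> = "{A. A \<subseteq> faces n d \<and> card A = r}"
  let ?cof = "\<lambda>A. {\<tau> \<in> faces n (Suc d). \<exists>\<sigma>\<in>A. \<sigma> \<subseteq> \<tau>}"
  have fin: "finite ?\<A>" by simp
  have choose: "real (card (isolated_faces n d T) choose r) = (\<Sum>A\<in>?\<A>. indicator {T. ?cof A \<inter> T = {}} T)"
    if T: "T \<in> set_pmf ?M" for T
  proof -
    have T': "T \<subseteq> faces n (Suc d)" using T by (rule set_random_faces)
    have iff: "A \<subseteq> isolated_faces n d T \<longleftrightarrow> ?cof A \<inter> T = {}" if "A \<in> ?\<A>" for A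
      using that T' by (auto simp: isolated_faces_def)
    have "A \<subseteq> isolated_faces n d T \<and> card A = r \<longleftrightarrow> A \<in> ?\<A> \<and> ?cof A \<inter> T = {}" for A
    proof (cases "A \<in> ?\<A>")
      case True
      then show ?thesis using iff[OF True] by simp
    next
      case False
      then show ?thesis using subset_trans[OF _ isolated_faces_subset, of A n d T] by auto
    qed
    then have "{A. A \<subseteq> isolated_faces n d T \<and> card A = r} = {A \<in> ?\<A>. ?cof A \<inter> T = {}}"
      by (rule Collect_cong)
    then have "card (isolated_faces n d T) choose r = card {A \<in> ?\<A>. ?cof A \<inter> T = {}}"
      using n_subsets[OF finite_subset_faces[OF isolated_faces_subset], of n d T r] by simp
    also have "real \<dots> = (\<Sum>A\<in>?\<A>. indicator {T. ?cof A \<inter> T = {}} T)"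
      using fin by (simp add: indicator_def sum.If_cases Int_def)
    finally show ?thesis .
  qed
  have "expected_binomial d n p r = measure_pmf.expectation ?M (\<lambda>T. \<Sum>A\<in>?\<A>. indicator {T. ?cof A \<inter> T = {}} T)"
    unfolding expected_binomial_def using choose by (intro integral_cong_AE) (auto simp: AE_measure_pmf_iff)
  also have "\<dots> = (\<Sum>A\<in>?\<A>. measure_pmf.expectation ?M (indicator {T. ?cof A \<inter> T = {}}))"
    by (rule Bochner_Integration.integral_sum) (rule integrable_random_faces)
  also have "\<dots> = (\<Sum>A\<in>?\<A>. (1 - p) ^ card (?cof A))"
  proof (rule sum.cong)
    fix A
    have "measure_pmf.expectation ?M (indicator {T. ?cof A \<inter> T = {}})
        = measure_pmf.prob ?M {T. ?cof A \<inter> T = {}}" by simp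
    also have "\<dots> = (1 - p) ^ card (?cof A)" using p by (intro prob_avoid) auto
    finally show "measure_pmf.expectation ?M (indicator {T. ?cof A \<inter> T = {}}) = (1 - p) ^ card (?cof A)" .
  qed simp
  finally show ?thesis .
qed

text \<open>
  The \<open>r\<close> faces have \<open>n - d\<close> cofaces each, of which only a bounded number coincide.
\<close>

lemma expected_binomial_bounds:
  assumes p: "0 \<le> p" "p \<le> 1"
  shows "real ((n choose d) choose r) * (1 - p) ^ (r * (n - d)) \<le> expected_binomial d n p r"
    and "expected_binomial d n p r \<le> real ((n choose d) choose r) * (1 - p) ^ (r * (n - d) - r * r)"
proof -
  let ?\<A> = "{A. A \<subseteq> faces n d \<and> card A = r}"
  let ?cof = "\<lambda>A. {\<tau> \<in> faces n (Suc d). \<exists>\<sigma>\<in>A. \<sigma> \<subseteq> \<tau>}"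
  have card\<A>: "card ?\<A> = (n choose d) choose r"
    using n_subsets[OF finite_faces, of n d r] by (simp add: card_faces)
  have bounds: "card (?cof A) \<le> r * (n - d)" "r * (n - d) - r * r \<le> card (?cof A)" if A: "A \<in> ?\<A>" for A
  proof -
    have fin: "finite A" using A finite_subset_faces[of A n d] by simp
    have "card (?cof A) = card (\<Union>\<sigma>\<in>A. {\<tau> \<in> faces n (Suc d). \<sigma> \<subseteq> \<tau>})"
      by (rule arg_cong[of _ _ card]) auto
    also have "\<dots> \<le> (\<Sum>\<sigma>\<in>A. card {\<tau> \<in> faces n (Suc d). \<sigma> \<subseteq> \<tau>})" by (rule card_UN_le[OF fin])
    also have "\<dots> = (\<Sum>\<sigma>\<in>A. n - d)" using A by (intro sum.cong card_cofaces) auto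
    finally show "card (?cof A) \<le> r * (n - d)" using A by simp
    have "(\<Sum>u\<in>A. card {g \<in> A. adjacent u g}) \<le> (\<Sum>u\<in>A. r)"
      using A fin by (intro sum_mono) (auto intro!: card_mono)
    then have "r * (n - d) \<le> card (coboundary2 n (Suc d) A) + r * r"
      using card_coboundary2_lower[of A n d A] A by simp
    moreover have "coboundary2 n (Suc d) A \<subseteq> ?cof A"
    proof
      fix \<tau> assume "\<tau> \<in> coboundary2 n (Suc d) A"
      then have \<tau>: "\<tau> \<in> faces n (Suc d)" "odd (card {\<sigma> \<in> A. \<sigma> \<subseteq> \<tau>})" by (auto simp: coboundary2_def)
      have "{\<sigma> \<in> A. \<sigma> \<subseteq> \<tau>} \<noteq> {}"
      proof
        assume empty: "{\<sigma> \<in> A. \<sigma> \<subseteq> \<tau>} = {}"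
        show False using \<tau>(2) unfolding empty by simp
      qed
      then show "\<tau> \<in> ?cof A" using \<tau>(1) by auto
    qed
    then have "card (coboundary2 n (Suc d) A) \<le> card (?cof A)" by (intro card_mono) auto
    ultimately show "r * (n - d) - r * r \<le> card (?cof A)" by simp
  qed
  have "(\<Sum>A\<in>?\<A>. (1 - p) ^ (r * (n - d))) \<le> (\<Sum>A\<in>?\<A>. (1 - p) ^ card (?cof A))"
    using p bounds by (intro sum_mono power_decreasing) auto
  then show "real ((n choose d) choose r) * (1 - p) ^ (r * (n - d)) \<le> expected_binomial d n p r"
    unfolding expected_binomial_eq[OF p] sum_constant card\<A> .
  have "(\<Sum>A\<in>?\<A>. (1 - p) ^ card (?cof A)) \<le> (\<Sum>A\<in>?\<A>. (1 - p) ^ (r * (n - d) - r * r))"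
    using p bounds by (intro sum_mono power_decreasing) auto
  then show "expected_binomial d n p r \<le> real ((n choose d) choose r) * (1 - p) ^ (r * (n - d) - r * r)"
    unfolding expected_binomial_eq[OF p] sum_constant card\<A> .
qed

text \<open>
  As \<open>p n * n\<close> grows like \<open>ln n\<close>, not only \<open>p n\<close> but also \<open>n * (p n)^2\<close> vanishes in the limit, so that
  \<open>ln (1 - p n)\<close> may be replaced by \<open>- p n\<close> even after multiplication by \<open>n\<close>.
\<close>

lemma critical_window_estimates:
  fixes p :: "nat \<Rightarrow> real"
  assumes H: "(\<lambda>n. p n * real n - real d * ln (real n)) \<longlonglongrightarrow> c" and d: "d \<ge> 1"
  shows "\<forall>\<^sub>F n in sequentially. \<bar>p n * real n - real d * ln (real n)\<bar> \<le> \<bar>c\<bar> + 1"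
    and "\<forall>\<^sub>F n in sequentially. 0 \<le> p n \<and> p n \<le> 1 / 2"
    and "p \<longlonglongrightarrow> 0"
    and "(\<lambda>n. real n * (p n) ^ 2) \<longlonglongrightarrow> 0"
proof -
  define C where "C = \<bar>c\<bar> + 1"
  have dpos: "real d > 0" using d by simp
  have "\<forall>\<^sub>F n in sequentially. dist (p n * real n - real d * ln (real n)) c < 1"
    using tendstoD[OF H, of 1] by simp
  then have ev: "\<forall>\<^sub>F n in sequentially. \<bar>p n * real n - real d * ln (real n)\<bar> \<le> C"
    by eventually_elim (unfold dist_real_def C_def, linarith)
  then show "\<forall>\<^sub>F n in sequentially. \<bar>p n * real n - real d * ln (real n)\<bar> \<le> \<bar>c\<bar> + 1"
    by (simp add: C_def)
  have ev3: "\<forall>\<^sub>F n in sequentially. real d * ln (real n) \<ge> C" using dpos by real_asymp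
  have ev': "\<forall>\<^sub>F n in sequentially. 0 \<le> p n \<and> p n \<le> (real d * ln (real n) + C) / real n"
    using ev ev3 eventually_gt_at_top[of 0]
  proof eventually_elim
    case (elim n)
    then have "0 \<le> p n * real n" by linarith
    then have "0 \<le> p n" using elim(3) by (simp add: zero_le_mult_iff)
    moreover have "p n \<le> (real d * ln (real n) + C) / real n" using elim(1,3) by (simp add: field_simps)
    ultimately show ?case ..
  qed
  have lim: "(\<lambda>n. (real d * ln (real n) + C) / real n) \<longlonglongrightarrow> 0" using dpos by real_asymp
  show p: "p \<longlonglongrightarrow> 0"
    by (rule tendsto_sandwich[OF _ _ tendsto_const lim]) (use ev' in \<open>auto elim: eventually_mono\<close>)
  have "\<forall>\<^sub>F n in sequentially. p n < 1 / 2" using p by (rule order_tendstoD) simp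
  with ev' show "\<forall>\<^sub>F n in sequentially. 0 \<le> p n \<and> p n \<le> 1 / 2"
    by eventually_elim auto
  have lim2: "(\<lambda>n. real n * ((real d * ln (real n) + C) / real n) ^ 2) \<longlonglongrightarrow> 0" using dpos by real_asymp
  have "\<forall>\<^sub>F n in sequentially. real n * (p n) ^ 2 \<le> real n * ((real d * ln (real n) + C) / real n) ^ 2"
    using ev' by eventually_elim (intro mult_left_mono power_mono, auto)
  from tendsto_sandwich[OF _ this tendsto_const lim2]
  show "(\<lambda>n. real n * (p n) ^ 2) \<longlonglongrightarrow> 0" by simp
qed

lemma expected_isolated_faces_tendsto:
  fixes p :: "nat \<Rightarrow> real"
  assumes H: "(\<lambda>n. p n * real n - real d * ln (real n)) \<longlonglongrightarrow> c" and d: "d \<ge> 1"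
  shows "(\<lambda>n. real (n choose d) * (1 - p n) ^ (n - d)) \<longlonglongrightarrow> exp (- c) / fact d"
proof -
  note est = critical_window_estimates[OF H d]
  \<comment> \<open>the logarithm of \<open>n^d * (1 - p)^(n - d)\<close>\<close>
  define g where "g n = real (n - d) * ln (1 - p n) + real d * ln (real n)" for n
  have lower: "\<forall>\<^sub>F n in sequentially.
      - (p n * real n - real d * ln (real n)) + real d * p n - 2 * (real n * p n ^ 2) \<le> g n"
    using est(2) eventually_ge_at_top[of d]
  proof eventually_elim
    case (elim n)
    have "- p n - 2 * (p n)\<^sup>2 \<le> ln (1 - p n)" using elim by (intro ln_one_minus_pos_lower_bound) auto
    then have "real (n - d) * (- p n - 2 * (p n)\<^sup>2) \<le> real (n - d) * ln (1 - p n)" by (intro mult_left_mono) auto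
    moreover have "real (n - d) * (- p n - 2 * (p n)\<^sup>2)
        = - (p n * real n) + real d * p n - 2 * (real n * p n ^ 2) + 2 * (real d * p n ^ 2)"
      using elim by (simp add: of_nat_diff algebra_simps)
    moreover have "0 \<le> real d * p n ^ 2" by simp
    ultimately show ?case unfolding g_def by linarith
  qed
  have upper: "\<forall>\<^sub>F n in sequentially. g n \<le> - (p n * real n - real d * ln (real n)) + real d * p n"
    using est(2) eventually_ge_at_top[of d]
  proof eventually_elim
    case (elim n)
    have "ln (1 - p n) \<le> - p n" using elim ln_le_minus_one[of "1 - p n"] by simp
    then have "real (n - d) * ln (1 - p n) \<le> real (n - d) * (- p n)" by (intro mult_left_mono) auto
    then show ?case using elim by (simp add: g_def of_nat_diff algebra_simps)
  qed
  have "(\<lambda>n. - (p n * real n - real d * ln (real n)) + real d * p n - 2 * (real n * p n ^ 2)) \<longlonglongrightarrow> - c + real d * 0 - 2 * 0"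
    by (intro tendsto_intros H est)
  moreover have "(\<lambda>n. - (p n * real n - real d * ln (real n)) + real d * p n) \<longlonglongrightarrow> - c + real d * 0"
    by (intro tendsto_intros H est)
  ultimately have "g \<longlonglongrightarrow> - c" using tendsto_sandwich[OF lower upper] by simp
  then have "(\<lambda>n. real (n choose d) / real n ^ d * exp (g n)) \<longlonglongrightarrow> 1 / fact d * exp (- c)"
    by (intro tendsto_mult tendsto_exp binomial_over_power_tendsto)
  moreover have "\<forall>\<^sub>F n in sequentially.
      real (n choose d) / real n ^ d * exp (g n) = real (n choose d) * (1 - p n) ^ (n - d)"
    using est(2) eventually_gt_at_top[of 0]
  proof eventually_elim
    case (elim n)
    have "exp (g n) = (1 - p n) ^ (n - d) * real n ^ d"
      using elim by (simp add: g_def exp_add exp_of_nat_mult)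
    then show ?case using elim by simp
  qed
  ultimately show ?thesis by (simp add: filterlim_cong)
qed

lemma expected_binomial_tendsto:
  fixes p :: "nat \<Rightarrow> real"
  assumes H: "(\<lambda>n. p n * real n - real d * ln (real n)) \<longlonglongrightarrow> c" and d: "d \<ge> 1"
  shows "(\<lambda>n. expected_binomial d n (p n) r) \<longlonglongrightarrow> (exp (- c) / fact d) ^ r / fact r"
proof -
  note est = critical_window_estimates[OF H d]
  define low where "low n = real ((n choose d) choose r) * (1 - p n) ^ (r * (n - d))" for n
  \<comment> \<open>the number of faces tends to infinity, so that the asymptotics of binomial coefficients apply to it\<close>
  have "filterlim (\<lambda>n. real (n choose d) / real n ^ d * real n ^ d) at_top sequentially"
  proof (rule filterlim_tendsto_pos_mult_at_top[OF binomial_over_power_tendsto])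
    show "filterlim (\<lambda>n. real n ^ d) at_top sequentially"
      using d by (intro filterlim_pow_at_top filterlim_real_sequentially) auto
  qed simp
  moreover have "\<forall>\<^sub>F n in sequentially. real (n choose d) / real n ^ d * real n ^ d = real (n choose d)"
    using eventually_gt_at_top[of 0] by eventually_elim simp
  ultimately have "filterlim (\<lambda>n. real (n choose d)) at_top sequentially"
    by (simp add: filterlim_cong)
  then have Ninf: "filterlim (\<lambda>n. n choose d) at_top sequentially"
    by (simp add: filterlim_sequentially_iff_filterlim_real)
  have "(\<lambda>n. real ((n choose d) choose r) / real (n choose d) ^ r * (real (n choose d) * (1 - p n) ^ (n - d)) ^ r)
      \<longlonglongrightarrow> 1 / fact r * (exp (- c) / fact d) ^ r"
    by (intro tendsto_mult tendsto_power expected_isolated_faces_tendsto[OF H d]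
        filterlim_compose[OF binomial_over_power_tendsto Ninf])
  moreover have "\<forall>\<^sub>F n in sequentially.
      real ((n choose d) choose r) / real (n choose d) ^ r * (real (n choose d) * (1 - p n) ^ (n - d)) ^ r = low n"
    using filterlim_at_top_dense[THEN iffD1, OF \<open>filterlim (\<lambda>n. real (n choose d)) at_top sequentially\<close>, rule_format, of 0]
    by eventually_elim (simp add: low_def power_mult_distrib power_mult[symmetric] mult.commute)
  ultimately have low: "low \<longlonglongrightarrow> (exp (- c) / fact d) ^ r / fact r"
    by (simp add: filterlim_cong)
  have "(\<lambda>n. low n / (1 - p n) ^ (r * r)) \<longlonglongrightarrow> (exp (- c) / fact d) ^ r / fact r / (1 - 0) ^ (r * r)"
    by (intro tendsto_intros low est) auto
  then have up: "(\<lambda>n. low n / (1 - p n) ^ (r * r)) \<longlonglongrightarrow> (exp (- c) / fact d) ^ r / fact r" by simp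
  show ?thesis
  proof (rule tendsto_sandwich[OF _ _ low up])
    show "\<forall>\<^sub>F n in sequentially. low n \<le> expected_binomial d n (p n) r"
      using est(2) by eventually_elim (auto simp: low_def intro!: expected_binomial_bounds(1))
    show "\<forall>\<^sub>F n in sequentially. expected_binomial d n (p n) r \<le> low n / (1 - p n) ^ (r * r)"
      using est(2) eventually_ge_at_top[of "d + r"]
    proof eventually_elim
      case (elim n)
      have "r * r \<le> r * (n - d)" using elim by (intro mult_left_mono) auto
      then have "(1 - p n) ^ (r * (n - d) - r * r) = (1 - p n) ^ (r * (n - d)) / (1 - p n) ^ (r * r)"
        using elim by (intro power_diff) auto
      then show ?case
        using expected_binomial_bounds(2)[of "p n" d n r] elim by (simp add: low_def)
    qed
  qed
qed

lemma expectation_mono_random_faces: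
  assumes "\<And>T. f T \<le> (g T :: real)"
  shows "measure_pmf.expectation (random_faces d n p) f \<le> measure_pmf.expectation (random_faces d n p) g"
  by (intro integral_mono integrable_random_faces assms)

text \<open>
  The \<open>r\<close>-th binomial moment converges to \<open>l^r / r!\<close>, that of the Poisson law with mean \<open>l\<close>. For each fixed
  truncation \<open>J\<close> the Bonferroni inequalities pass to the limit in \<open>n\<close>; letting \<open>J\<close> grow then gives the
  exponential series, and the error term is a term of a convergent series.
\<close>

theorem isolated_faces_poisson:
  fixes p :: "nat \<Rightarrow> real"
  assumes H: "(\<lambda>n. p n * real n - real d * ln (real n)) \<longlonglongrightarrow> c" and d: "d \<ge> 1"
  shows "(\<lambda>n. measure_pmf.prob (random_faces d n (p n)) {T. card (isolated_faces n d T) = k})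
    \<longlonglongrightarrow> pmf (poisson_pmf (exp (- c) / fact d)) k"
proof -
  define l where "l = exp (- c) / fact d"
  have lpos: "l > 0" by (simp add: l_def)
  define E where "E r n = expected_binomial d n (p n) r" for r n
  have E: "E r \<longlonglongrightarrow> l ^ r / fact r" for r
    unfolding E_def l_def by (rule expected_binomial_tendsto[OF H d])
  define S where "S J n = (\<Sum>j\<le>J. (-1) ^ j * real ((k + j) choose k) * E (k + j) n)" for J n
  define R where "R J n = real ((k + J) choose k) * E (k + J) n" for J n
  have coeff: "real ((k + j) choose k) * (l ^ (k + j) / fact (k + j)) = l ^ k / fact k * (l ^ j / fact j)" for j
    by (simp add: binomial_fact power_add)
  have approx: "\<bar>measure_pmf.prob (random_faces d n (p n)) {T. card (isolated_faces n d T) = k} - S J n\<bar> \<le> R J n"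
    for J n
  proof -
    let ?E = "measure_pmf.expectation (random_faces d n (p n))"
    let ?X = "\<lambda>T. card (isolated_faces n d T)"
    have P: "measure_pmf.prob (random_faces d n (p n)) {T. ?X T = k} = ?E (\<lambda>T. of_bool (?X T = k))"
    proof -
      have "(\<lambda>T. of_bool (?X T = k) :: real) = indicator {T. ?X T = k}" by (auto simp: indicator_def)
      then show ?thesis by simp
    qed
    have S: "S J n = ?E (\<lambda>T. \<Sum>j\<le>J. (-1) ^ j * real ((k + j) choose k) * real (?X T choose (k + j)))"
      unfolding S_def E_def expected_binomial_def
      by (subst Bochner_Integration.integral_sum) (simp_all add: integrable_random_faces)
    have "\<bar>measure_pmf.prob (random_faces d n (p n)) {T. ?X T = k} - S J n\<bar>
        = \<bar>?E (\<lambda>T. of_bool (?X T = k) - (\<Sum>j\<le>J. (-1) ^ j * real ((k + j) choose k) * real (?X T choose (k + j))))\<bar>"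
      unfolding P S by (subst Bochner_Integration.integral_diff) (simp_all add: integrable_random_faces)
    also have "\<dots> \<le> ?E (\<lambda>T. \<bar>of_bool (?X T = k) - (\<Sum>j\<le>J. (-1) ^ j * real ((k + j) choose k) * real (?X T choose (k + j)))\<bar>)"
      by (rule integral_abs_bound)
    also have "\<dots> \<le> ?E (\<lambda>T. real ((k + J) choose k) * real (?X T choose (k + J)))"
      by (intro expectation_mono_random_faces bonferroni)
    also have "\<dots> = R J n" by (simp add: R_def E_def expected_binomial_def)
    finally show ?thesis .
  qed
  have limS: "S J \<longlonglongrightarrow> (\<Sum>j\<le>J. (-1) ^ j * real ((k + j) choose k) * (l ^ (k + j) / fact (k + j)))" for J
    unfolding S_def by (intro tendsto_intros E)
  have limR: "R J \<longlonglongrightarrow> real ((k + J) choose k) * (l ^ (k + J) / fact (k + J))" for J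
    unfolding R_def by (intro tendsto_intros E)
  have lims: "(\<lambda>J. \<Sum>j\<le>J. (-1) ^ j * real ((k + j) choose k) * (l ^ (k + j) / fact (k + j)))
      \<longlonglongrightarrow> pmf (poisson_pmf l) k"
  proof -
    have "(\<lambda>j. (- l) ^ j /\<^sub>R fact j) sums exp (- l)" by (rule exp_converges)
    then have "(\<lambda>J. \<Sum>j\<le>J. (- l) ^ j /\<^sub>R fact j) \<longlonglongrightarrow> exp (- l)" by (simp add: sums_def_le)
    then have "(\<lambda>J. l ^ k / fact k * (\<Sum>j\<le>J. (- l) ^ j /\<^sub>R fact j)) \<longlonglongrightarrow> l ^ k / fact k * exp (- l)"
      by (rule tendsto_mult_left)
    moreover have "l ^ k / fact k * (\<Sum>j\<le>J. (- l) ^ j /\<^sub>R fact j)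
        = (\<Sum>j\<le>J. (-1) ^ j * real ((k + j) choose k) * (l ^ (k + j) / fact (k + j)))" for J
      unfolding sum_distrib_left mult.assoc coeff
      by (intro sum.cong) (simp_all add: power_minus[of l] field_simps)
    ultimately show ?thesis using lpos by simp
  qed
  have limr: "(\<lambda>J. real ((k + J) choose k) * (l ^ (k + J) / fact (k + J))) \<longlonglongrightarrow> 0"
  proof -
    have "(\<lambda>J. l ^ J / fact J) \<longlonglongrightarrow> 0"
      using summable_LIMSEQ_zero[OF summable_exp[of l]] by (simp add: field_simps)
    from tendsto_mult_left[OF this, of "l ^ k / fact k"] show ?thesis unfolding coeff by simp
  qed
  show ?thesis unfolding l_def[symmetric]
    by (rule tendsto_by_approximation[OF always_eventually[OF allI[OF approx]] limS limR lims limr])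
qed

text \<open>
  Markov's inequality: the mean stays bounded. The threshold \<open>n - d\<close> is the one that guarantees private
  cofaces.
\<close>

lemma few_isolated_faces:
  fixes p :: "nat \<Rightarrow> real"
  assumes H: "(\<lambda>n. p n * real n - real d * ln (real n)) \<longlonglongrightarrow> c" and d: "d \<ge> 1"
  shows "(\<lambda>n. measure_pmf.prob (random_faces d n (p n)) {T. card (isolated_faces n d T) > n - d}) \<longlonglongrightarrow> 0"
proof (rule tendsto_sandwich[OF _ _ tendsto_const])
  show "\<forall>\<^sub>F n in sequentially. measure_pmf.prob (random_faces d n (p n)) {T. card (isolated_faces n d T) > n - d}
      \<le> expected_binomial d n (p n) 1 * (1 / (real n - real d))"
    using eventually_gt_at_top[of d]
  proof eventually_elim
    case (elim n)
    let ?M = "random_faces d n (p n)"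
    have "real (n - d) * measure_pmf.prob ?M {T. card (isolated_faces n d T) > n - d}
        = measure_pmf.expectation ?M (\<lambda>T. real (n - d) * indicator {T. card (isolated_faces n d T) > n - d} T)"
      by simp
    also have "\<dots> \<le> expected_binomial d n (p n) 1"
      unfolding expected_binomial_def by (intro expectation_mono_random_faces) (auto simp: indicator_def)
    finally show ?case using elim by (simp add: of_nat_diff field_simps)
  qed
  have "(\<lambda>n. 1 / (real n - real d)) \<longlonglongrightarrow> 0" by real_asymp
  from tendsto_mult[OF expected_binomial_tendsto[OF H d, of 1] this]
  show "(\<lambda>n. expected_binomial d n (p n) 1 * (1 / (real n - real d))) \<longlonglongrightarrow> 0" by simp
qed auto

section \<open>The limit law of the Betti number\<close>

lemma random_complex_eq: "random_complex d n p = map_pmf (skeleton_with d n) (random_faces d n p)"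
  unfolding random_complex_def random_faces_def map_pmf_comp faces_def
  by (intro map_pmf_cong) (auto simp: skeleton_with_def)

theorem betti_poisson:
  fixes p :: "nat \<Rightarrow> real"
  assumes H: "(\<lambda>n. p n * real n - real d * ln (real n)) \<longlonglongrightarrow> c" and d: "d \<ge> 2"
  shows "(\<lambda>n. pmf (map_pmf (betti (d - 1)) (random_complex d n (p n))) k)
    \<longlonglongrightarrow> pmf (poisson_pmf (exp (- c) / fact d)) k"
proof -
  have d1: "d \<ge> 1" using d by simp
  define b where "b n = pmf (map_pmf (betti (d - 1)) (random_complex d n (p n))) k" for n
  define f where "f n = measure_pmf.prob (random_faces d n (p n)) {T. card (isolated_faces n d T) = k}" for n
  define bad where "bad n = measure_pmf.prob (random_faces d n (p n)) {T. \<not> only_trivial_cocycles n d T}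
    + measure_pmf.prob (random_faces d n (p n)) {T. card (isolated_faces n d T) > n - d}" for n
  have diff: "\<bar>b n - f n\<bar> \<le> bad n" for n
  proof -
    let ?M = "random_faces d n (p n)"
    let ?B = "{T. betti (d - 1) (skeleton_with d n T) = k} \<inter> set_pmf ?M"
    let ?F = "{T. card (isolated_faces n d T) = k} \<inter> set_pmf ?M"
    let ?N = "{T. \<not> only_trivial_cocycles n d T} \<union> {T. card (isolated_faces n d T) > n - d}"
    have b: "b n = measure_pmf.prob ?M ?B"
      by (simp add: b_def random_complex_eq map_pmf_comp pmf_map vimage_def measure_Int_set_pmf)
    have f: "f n = measure_pmf.prob ?M ?F" by (simp add: f_def measure_Int_set_pmf)
    have agree: "betti (d - 1) (skeleton_with d n T) = card (isolated_faces n d T)"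
      if "T \<in> set_pmf ?M" "T \<notin> ?N" for T
      using that set_random_faces[of T d n "p n"] by (intro betti_eq_card_isolated_faces d) auto
    have N: "measure_pmf.prob ?M ?N \<le> bad n"
      unfolding bad_def by (rule measure_Un_le) auto
    have un: "measure_pmf.prob ?M (X \<union> ?N) \<le> measure_pmf.prob ?M X + measure_pmf.prob ?M ?N" for X
      by (rule measure_Un_le) auto
    have "measure_pmf.prob ?M ?B \<le> measure_pmf.prob ?M (?F \<union> ?N)"
      using agree by (intro measure_pmf.finite_measure_mono) auto
    moreover have "measure_pmf.prob ?M ?F \<le> measure_pmf.prob ?M (?B \<union> ?N)"
      using agree by (intro measure_pmf.finite_measure_mono) auto
    ultimately show ?thesis unfolding b f using N un[of ?B] un[of ?F] by linarith
  qed
  have "bad \<longlonglongrightarrow> 0 + 0"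
    unfolding bad_def
    by (intro tendsto_add nontrivial_cocycles_unlikely[OF d critical_window_estimates(1)[OF H d1]]
        few_isolated_faces[OF H d1])
  then have "bad \<longlonglongrightarrow> 0" by simp
  then have "(\<lambda>n. b n - f n) \<longlonglongrightarrow> 0"
    by (rule Lim_null_comparison[rotated]) (use diff in auto)
  moreover have "f \<longlonglongrightarrow> pmf (poisson_pmf (exp (- c) / fact d)) k"
    unfolding f_def by (rule isolated_faces_poisson[OF H d1])
  ultimately have "(\<lambda>n. (b n - f n) + f n) \<longlonglongrightarrow> 0 + pmf (poisson_pmf (exp (- c) / fact d)) k"
    by (rule tendsto_add)
  then show ?thesis by (simp add: b_def)
qed

text \<open>
  For laws on the natural numbers a distribution function is a finite sum of point probabilities.
\<close>

lemma weak_conv_m_nat_pmf: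
  fixes q :: "nat \<Rightarrow> nat pmf"
  assumes "\<And>k. (\<lambda>n. pmf (q n) k) \<longlonglongrightarrow> pmf q' k"
  shows "weak_conv_m (\<lambda>n. distr (measure_pmf (q n)) borel real) (distr (measure_pmf q') borel real)"
  unfolding weak_conv_m_def weak_conv_def
proof (intro allI impI)
  fix x :: real
  have fin: "finite {k. real k \<le> x}"
    by (rule finite_subset[of _ "{..nat \<lfloor>x\<rfloor>}"]) (auto intro: le_nat_floor)
  have "cdf (distr (measure_pmf r) borel real) x = (\<Sum>k | real k \<le> x. pmf r k)" for r
  proof -
    have "cdf (distr (measure_pmf r) borel real) x = measure_pmf.prob r {k. real k \<le> x}"
      unfolding cdf_def by (subst measure_distr) (auto simp: vimage_def)
    then show ?thesis using fin by (simp add: measure_measure_pmf_finite)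
  qed
  then show "(\<lambda>n. cdf (distr (measure_pmf (q n)) borel real) x) \<longlonglongrightarrow> cdf (distr (measure_pmf q') borel real) x"
    by (simp add: tendsto_sum assms)
qed

theorem corollary3p4:
  fixes d :: nat and c :: real and p e :: "nat \<Rightarrow> real"
  assumes "d \<ge> 2"
    and "e \<in> o(\<lambda>_. 1)"
    and "\<forall>\<^sub>F n in sequentially. p n = (real d * ln (real n) + c + e n) / real n"
  shows "weak_conv_m
    (\<lambda>n. distr (measure_pmf (random_complex d n (p n))) borel (\<lambda>Y. real (betti (d - 1) Y)))
    (distr (measure_pmf (poisson_pmf (exp (- c) / fact d))) borel real)"
proof -
  have "e \<longlonglongrightarrow> 0" using smalloD_tendsto[OF assms(2)] by simp
  then have "(\<lambda>n. c + e n) \<longlonglongrightarrow> c + 0" by (intro tendsto_intros)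
  moreover have "\<forall>\<^sub>F n in sequentially. c + e n = p n * real n - real d * ln (real n)"
    using assms(3) eventually_gt_at_top[of 0] by eventually_elim simp
  ultimately have H: "(\<lambda>n. p n * real n - real d * ln (real n)) \<longlonglongrightarrow> c"
    by (simp add: filterlim_cong)
  have distr: "distr (measure_pmf (random_complex d n (p n))) borel (\<lambda>Y. real (betti (d - 1) Y))
      = distr (measure_pmf (map_pmf (betti (d - 1)) (random_complex d n (p n)))) borel real" for n
    by (simp add: map_pmf_rep_eq distr_distr o_def)
  show ?thesis
    unfolding distr by (rule weak_conv_m_nat_pmf) (rule betti_poisson[OF H assms(1)])
qed

end
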